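(* Assume that any one of the settings (S1), (S2), (S3) described in the context holds, and let $\hat\phi_n$ be the convex least squares estimator computed from $(X_1,Y_1),\ldots,(X_n,Y_n)$. Then: (i) $\mathbf{P}\left(\sup_{x\in K}|\hat\phi_n(x)-\phi(x)|\to 0 \text{ for every compact set } K\subset\mathfrak{X}^\circ\right)=1$. (ii) For every $x\in\mathfrak{X}^\circ$ and every $\xi\in\mathbb{R}^d$, $$\limsup_{n\to\infty}\lim_{h\downarrow 0}\frac{\hat\phi_n(x+h\xi)-\hat\phi_n(x)}{h}\le\lim_{h\downarrow 0}\frac{\phi(x+h\xi)-\phi(x)}{h}\quad\text{almost surely.}$$ (iii) With $\mathbf{B}$ the Euclidean unit ball of $\mathbb{R}^d$, for every $\epsilon>0$ and every $x\in\mathfrak{X}^\circ$, $$\mathbf{P}_*\left(\partial\hat\phi_n(x)\subset\partial\phi(x)+\epsilon\mathbf{B}\text{ for all but finitely many } n\right)=1.$$ (iv) If $\phi$ is differentiable at $x\in\mathfrak{X}^\circ$, then $\sup_{\xi\in\partial\hat\phi_n(x)}|\xi-\nabla\phi(x)|\to 0$ almost surely, in the sense that the inner probability of this convergence is $1$.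
   Context: Fix $d\ge 1$. In all settings, $\mathfrak{X}\subset\mathbb{R}^d$ is a closed convex set with nonempty interior $\mathfrak{X}^\circ$, and $\phi:\mathbb{R}^d\to(-\infty,+\infty]$ is a proper (i.e. never $-\infty$) convex function with $\mathfrak{X}\subset\mathrm{Dom}(\phi)=\{x:\phi(x)<\infty\}$. For a Borel set $A$ write $N_n(A)=\#\{1\le j\le n:X_j\in A\}$. (S1) Fixed design, i.i.d. errors: $(X_n)_{n\ge1}$ is a non-random sequence in $\mathfrak{X}$; $Y_k=\phi(X_k)+\epsilon_k$ with $(\epsilon_k)$ i.i.d., $\mathbf{E}(\epsilon_k)=0$, $\mathbf{E}(\epsilon_k^2)=\sigma^2<\infty$; there is a Borel probability measure $\nu$ on $\mathfrak{X}$ having exactly the same Borel null sets as Lebesgue measure on $\mathfrak{X}$ and such that $\frac1nN_n(R)\to\nu(R)$ for every open rectangle $R\subset\mathfrak{X}^\circ$. (S2) Fixed design, heteroscedastic errors: $(X_n)$ and $\nu$ are as in (S1); $Y_k=\phi(X_k)+\epsilon_k$ with $(\epsilon_k)$ independent, $\mathbf{E}(\epsilon_k)=0$ for all $k$, $\liminf_{n}\frac1n\sum_{k=1}^n\mathbf{E}(|\epsilon_k|)>0$, $\sum_{n\ge1}\mathrm{Var}(\epsilon_n^2)/n^2<\infty$, $\sup_n\mathbf{E}(\epsilon_n^2)<\infty$; here $\sigma^2:=\limsup_{n}\frac1n\sum_{j=1}^n\mathbf{E}(\epsilon_j^2)$. (S3) Stochastic design: $(X_n,Y_n)_{n\ge1}$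 is i.i.d. from a Borel probability measure $\mu$ on $\mathbb{R}^{d+1}$ with $\mu(\mathfrak{X}\times\mathbb{R})=1$ and $\int y^2\,\mu(dx,dy)<\infty$; for $(X,Y)\sim\mu$, $\mathbf{E}(Y-\phi(X)\mid X)=0$ and $\mathbf{E}(|Y-\phi(X)|^2)=\sigma^2<\infty$; the marginal $\nu(\cdot)=\mu((\cdot)\times\mathbb{R})$ has exactly the same Borel null sets as Lebesgue measure on $\mathfrak{X}$. Estimator: let $Z_n=(Z_n^1,\ldots,Z_n^n)$ be the unique minimizer of $\sum_{k=1}^n|Y_k-z^k|^2$ over all $z\in\mathbb{R}^n$ for which there is a convex $\psi:\mathfrak{X}\to\mathbb{R}$ with $\psi(X_j)=z^j$ for all $j\le n$. Then $\hat\phi_n:\mathbb{R}^d\to(-\infty,+\infty]$ is $$\hat\phi_n(x)=\inf\Big\{\sum_{k=1}^n\theta^kZ_n^k:\ \sum_{k=1}^n\theta^k=1,\ \sum_{k=1}^n\theta^kX_k=x,\ \theta\in\mathbb{R}^n,\ \theta\ge0\Big\},\qquad \inf\emptyset=+\infty.$$ The subdifferential of a convex $f$ at $x$ is $\partial f(x)=\{\xi\in\mathbb{R}^d:\langle\xi,h\rangle\le f(x+h)-f(x)\ \forall h\in\mathbb{R}^d\}$. $\mathbf{P}_*$ denotes inner probability. *)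

theory Defs
  imports "HOL-Probability.Probability"
begin

text \<open>
  The space \<open>\<real>\<^sup>d\<close>, \<open>d \<ge> 1\<close>, is an arbitrary type of class \<^class>\<open>euclidean_space\<close>, and
  \<open>\<real>\<^sup>d\<^sup>+\<^sup>1\<close> is its product with \<^typ>\<open>real\<close>.
  Sequences \<open>(X\<^sub>n)\<close>, \<open>(Y\<^sub>n)\<close>, \<open>(\<epsilon>\<^sub>n)\<close> start at index 1; their value at index 0 is never used.
\<close>

subsection \<open>Convex functions with values in \<open>(-\<infinity>, +\<infinity>]\<close>\<close>

text \<open>Since \<open>0 * \<infinity> = 0\<close> in \<^typ>\<open>ereal\<close>, the inequality is harmless for \<open>u = 0\<close> or \<open>v = 0\<close>.\<close>

definition proper_convex :: "('a::real_vector \<Rightarrow> ereal) \<Rightarrow> bool" where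
  "proper_convex f \<longleftrightarrow> (\<forall>x. f x \<noteq> -\<infinity>) \<and>
     (\<forall>x y u v. u \<ge> 0 \<and> v \<ge> 0 \<and> u + v = 1 \<longrightarrow>
        f (u *\<^sub>R x + v *\<^sub>R y) \<le> ereal u * f x + ereal v * f y)"

definition eff_dom :: "('a \<Rightarrow> ereal) \<Rightarrow> 'a set" where
  "eff_dom f = {x. f x < \<infinity>}"

text \<open>
  In \<^typ>\<open>ereal\<close>, a finite number minus \<open>\<infinity>\<close> is \<open>-\<infinity>\<close>, so the subdifferential is empty at
  every point where \<open>f\<close> is \<open>\<infinity>\<close>, provided that \<open>f\<close> is finite somewhere.
\<close>

definition subdifferential :: "('a::real_inner \<Rightarrow> ereal) \<Rightarrow> 'a \<Rightarrow> 'a set" where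
  "subdifferential f x = {\<xi>. \<forall>h. ereal (\<xi> \<bullet> h) \<le> f (x + h) - f x}"

definition dir_deriv :: "('a::real_vector \<Rightarrow> ereal) \<Rightarrow> 'a \<Rightarrow> 'a \<Rightarrow> ereal" where
  "dir_deriv f x \<xi> = Lim (at_right 0) (\<lambda>h. (f (x + h *\<^sub>R \<xi>) - f x) / ereal h)"

subsection \<open>The convex least squares estimator\<close>

definition convex_interpolable :: "'a::real_vector set \<Rightarrow> nat \<Rightarrow> (nat \<Rightarrow> 'a) \<Rightarrow> (nat \<Rightarrow> real) set" where
  "convex_interpolable S n x = {z \<in> {1..n} \<rightarrow>\<^sub>E UNIV.
     \<exists>\<psi>. convex_on S \<psi> \<and> (\<forall>j\<in>{1..n}. x j \<in> S \<and> \<psi> (x j) = z j)}"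

definition lse_vector ::
    "'a::real_vector set \<Rightarrow> nat \<Rightarrow> (nat \<Rightarrow> 'a) \<Rightarrow> (nat \<Rightarrow> real) \<Rightarrow> (nat \<Rightarrow> real)" where
  "lse_vector S n x y =
     (THE z. is_arg_min (\<lambda>z. \<Sum>k=1..n. \<bar>y k - z k\<bar>\<^sup>2) (\<lambda>z. z \<in> convex_interpolable S n x) z)"

text \<open>The infimum of the empty set is \<open>\<infinity>\<close> in \<^typ>\<open>ereal\<close>.\<close>

definition convex_lse ::
    "'a::real_vector set \<Rightarrow> nat \<Rightarrow> (nat \<Rightarrow> 'a) \<Rightarrow> (nat \<Rightarrow> real) \<Rightarrow> 'a \<Rightarrow> ereal" where
  "convex_lse S n x y t =
     Inf {ereal (\<Sum>k=1..n. \<theta> k * lse_vector S n x y k) | \<theta>.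
            (\<Sum>k=1..n. \<theta> k) = 1 \<and> (\<Sum>k=1..n. \<theta> k *\<^sub>R x k) = t \<and> (\<forall>k\<in>{1..n}. 0 \<le> \<theta> k)}"

subsection \<open>The three settings\<close>

definition lebesgue_equivalent_on :: "'a::euclidean_space set \<Rightarrow> 'a measure \<Rightarrow> bool" where
  "lebesgue_equivalent_on S \<nu> \<longleftrightarrow> prob_space \<nu> \<and> sets \<nu> = sets borel \<and> emeasure \<nu> S = 1 \<and>
     (\<forall>A\<in>sets borel. A \<subseteq> S \<longrightarrow> (emeasure \<nu> A = 0 \<longleftrightarrow> emeasure lborel A = 0))"

definition count_in :: "(nat \<Rightarrow> 'a) \<Rightarrow> nat \<Rightarrow> 'a set \<Rightarrow> nat" where
  "count_in x n A = card {j \<in> {1..n}. x j \<in> A}"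

definition fixed_design :: "'a::euclidean_space set \<Rightarrow> (nat \<Rightarrow> 'a) \<Rightarrow> 'a measure \<Rightarrow> bool" where
  "fixed_design S x \<nu> \<longleftrightarrow> (\<forall>n\<ge>1. x n \<in> S) \<and> lebesgue_equivalent_on S \<nu> \<and>
     (\<forall>a b. box a b \<subseteq> interior S \<longrightarrow>
        (\<lambda>n. real (count_in x n (box a b)) / real n) \<longlonglongrightarrow> measure \<nu> (box a b))"

definition regression_domain :: "'a::euclidean_space set \<Rightarrow> ('a \<Rightarrow> ereal) \<Rightarrow> bool" where
  "regression_domain S \<phi> \<longleftrightarrow> closed S \<and> convex S \<and> interior S \<noteq> {} \<and>
     proper_convex \<phi> \<and> S \<subseteq> eff_dom \<phi>"

context prob_space
begin

text \<open>
  The design is a sequence of functions of the outcome in all settings; a fixed design is one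
  that agrees with a deterministic sequence \<open>x\<close> at every outcome.
\<close>

definition fixed_design_model ::
    "'b::euclidean_space set \<Rightarrow> ('b \<Rightarrow> ereal) \<Rightarrow> (nat \<Rightarrow> 'a \<Rightarrow> 'b) \<Rightarrow> (nat \<Rightarrow> 'a \<Rightarrow> real) \<Rightarrow>
     (nat \<Rightarrow> 'a \<Rightarrow> real) \<Rightarrow> bool" where
  "fixed_design_model S \<phi> X Y \<epsilon> \<longleftrightarrow>
     (\<exists>x \<nu>. fixed_design S x \<nu> \<and>
        (\<forall>n\<ge>1. \<forall>\<omega>\<in>space M. X n \<omega> = x n \<and> Y n \<omega> = real_of_ereal (\<phi> (x n)) + \<epsilon> n \<omega>))"

definition setting_iid_errors ::
    "'b::euclidean_space set \<Rightarrow> ('b \<Rightarrow> ereal) \<Rightarrow> (nat \<Rightarrow> 'a \<Rightarrow> 'b) \<Rightarrow> (nat \<Rightarrow> 'a \<Rightarrow> real) \<Rightarrow>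
     real \<Rightarrow> bool" where
  "setting_iid_errors S \<phi> X Y \<sigma> \<longleftrightarrow>
     (\<exists>\<epsilon>. fixed_design_model S \<phi> X Y \<epsilon> \<and>
        indep_vars (\<lambda>_. borel) \<epsilon> {1..} \<and>
        (\<forall>j\<ge>1. \<forall>k\<ge>1. distr M borel (\<epsilon> j) = distr M borel (\<epsilon> k)) \<and>
        (\<forall>k\<ge>1. integrable M (\<epsilon> k) \<and> expectation (\<epsilon> k) = 0 \<and>
           integrable M (\<lambda>\<omega>. (\<epsilon> k \<omega>)\<^sup>2) \<and> expectation (\<lambda>\<omega>. (\<epsilon> k \<omega>)\<^sup>2) = \<sigma>\<^sup>2))"

text \<open>
  Finiteness of the sum of the \<open>Var(\<epsilon>\<^sub>n\<^sup>2) / n\<^sup>2\<close> includes that every \<open>Var(\<epsilon>\<^sub>n\<^sup>2)\<close> is finite,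
  i.e. that \<open>\<epsilon>\<^sub>n\<^sup>2\<close> is square integrable. The last conjunct only fixes the meaning of \<open>\<sigma>\<^sup>2\<close>.
\<close>

definition setting_heteroscedastic ::
    "'b::euclidean_space set \<Rightarrow> ('b \<Rightarrow> ereal) \<Rightarrow> (nat \<Rightarrow> 'a \<Rightarrow> 'b) \<Rightarrow> (nat \<Rightarrow> 'a \<Rightarrow> real) \<Rightarrow>
     real \<Rightarrow> bool" where
  "setting_heteroscedastic S \<phi> X Y \<sigma> \<longleftrightarrow>
     (\<exists>\<epsilon>. fixed_design_model S \<phi> X Y \<epsilon> \<and>
        indep_vars (\<lambda>_. borel) \<epsilon> {1..} \<and>
        (\<forall>k\<ge>1. integrable M (\<epsilon> k) \<and> expectation (\<epsilon> k) = 0) \<and>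
        liminf (\<lambda>n. ereal ((\<Sum>k=1..n. expectation (\<lambda>\<omega>. \<bar>\<epsilon> k \<omega>\<bar>)) / real n)) > 0 \<and>
        (\<forall>k\<ge>1. integrable M (\<lambda>\<omega>. (\<epsilon> k \<omega>)\<^sup>2) \<and> integrable M (\<lambda>\<omega>. ((\<epsilon> k \<omega>)\<^sup>2)\<^sup>2)) \<and>
        summable (\<lambda>n. variance (\<lambda>\<omega>. (\<epsilon> (Suc n) \<omega>)\<^sup>2) / (real (Suc n))\<^sup>2) \<and>
        (SUP n\<in>{1..}. ereal (expectation (\<lambda>\<omega>. (\<epsilon> n \<omega>)\<^sup>2))) < \<infinity> \<and>
        ereal (\<sigma>\<^sup>2) =
          limsup (\<lambda>n. ereal ((\<Sum>j=1..n. expectation (\<lambda>\<omega>. (\<epsilon> j \<omega>)\<^sup>2)) / real n)))"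

text \<open>
  A convex \<open>\<phi>\<close> is continuous on the interior of \<open>S\<close> but can be non-Borel on its boundary, which is
  a null set of the marginal of \<open>\<mu>\<close>. Hence \<open>Y - \<phi>(X)\<close> is measurable for the completion of \<open>\<mu>\<close> but
  not always for \<open>\<mu>\<close>, where \<^const>\<open>real_cond_exp\<close> and the integral of a non-measurable function
  would be meaningless.
\<close>

definition setting_stochastic_design ::
    "'b::euclidean_space set \<Rightarrow> ('b \<Rightarrow> ereal) \<Rightarrow> (nat \<Rightarrow> 'a \<Rightarrow> 'b) \<Rightarrow> (nat \<Rightarrow> 'a \<Rightarrow> real) \<Rightarrow>
     real \<Rightarrow> bool" where
  "setting_stochastic_design S \<phi> X Y \<sigma> \<longleftrightarrow>
     (\<exists>\<mu> :: ('b \<times> real) measure.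
        prob_space \<mu> \<and> sets \<mu> = sets borel \<and>
        indep_vars (\<lambda>_. borel) (\<lambda>n \<omega>. (X n \<omega>, Y n \<omega>)) {1..} \<and>
        (\<forall>n\<ge>1. distr M borel (\<lambda>\<omega>. (X n \<omega>, Y n \<omega>)) = \<mu>) \<and>
        emeasure \<mu> (S \<times> UNIV) = 1 \<and>
        integrable \<mu> (\<lambda>(x, y). y\<^sup>2) \<and>
        (AE p in completion \<mu>.
           real_cond_exp (completion \<mu>) (vimage_algebra UNIV fst borel)
             (\<lambda>(x, y). y - real_of_ereal (\<phi> x)) p = 0) \<and>
        integrable (completion \<mu>) (\<lambda>(x, y). \<bar>y - real_of_ereal (\<phi> x)\<bar>\<^sup>2) \<and>
        (\<integral>p. (case p of (x, y) \<Rightarrow> \<bar>y - real_of_ereal (\<phi> x)\<bar>\<^sup>2) \<partial>completion \<mu>) = \<sigma>\<^sup>2 \<and>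
        lebesgue_equivalent_on S (distr \<mu> borel fst))"

subsection \<open>Inner probability\<close>

definition inner_prob :: "'a set \<Rightarrow> real" where
  "inner_prob A = (SUP B\<in>{B \<in> events. B \<subseteq> A}. prob B)"

end

end

theory Submission
  imports Defs
begin

text \<open>
  Comparing the estimator with the true function \<open>\<phi>\<close> in the least squares problem bounds the sum
  of the squared residuals \<open>Z\<^sub>k - \<phi>(X\<^sub>k)\<close> by twice the sum of the \<open>\<epsilon>\<^sub>k (Z\<^sub>k - \<phi>(X\<^sub>k))\<close>, and hence
  by a multiple of the sum of the \<open>\<epsilon>\<^sub>k\<^sup>2\<close>, which is \<open>O(n)\<close>. Since every open subset of the
  interior receives a positive fraction of the design, the estimators take bounded values near every
  interior point, so by convexity they are locally bounded and locally Lipschitz, uniformly in \<open>n\<close>.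
  The noise averages out on the cells of a fine partition of a compact core of the domain, where the
  estimators hardly vary, and its contribution outside of the core is small. So the mean squared
  residual tends to 0; as the estimators are equi-Lipschitz, this forces locally uniform convergence.
  The statements on derivatives and subdifferentials follow from it by convexity alone.

  The probabilistic input is a strong law of large numbers for independent nonnegative variables
  along geometric subsequences (Etemadi's method), which covers the three settings at once.
\<close>

section \<open>Locally bounded sequences of convex functions\<close>

text \<open>The fitted values depend on the whole noise, so no law of large numbers applies directly
  to the sum of the products of noise and residual. Two features of convexity replace independence.
  Bounds at a few points of a neighbourhood give Lipschitz bounds there, so the fit is almost
  constant on small cells and only the noise average of each cell matters; the cells come from a
  countable stock of deterministic partitions. Near the boundary no Lipschitz bound is available and
  the fit may be steep or large. There the products are split by the inequality between arithmetic
  and geometric means: half of the squared residuals is absorbed on the left, and what remains is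
  the noise energy outside of a compact core. The Lipschitz bounds rest on a first crude estimate of
  the residuals, so the basic inequality is used twice. All that is asked of the randomness is
  collected in \<open>regular_path\<close>, a property of one pair of sequences; behind it the
  argument is deterministic, and one null event serves all compact sets, points and directions. The
  strong law is stated for nonnegative summands, since it interpolates monotone partial
  sums.\<close>

lemma convex_proper_convex_sublevel:
  assumes "proper_convex f"
  shows "convex {x. f x \<le> ereal c}"
proof (rule convexI)
  fix x y and u v :: real
  assume xy: "x \<in> {x. f x \<le> ereal c}" "y \<in> {x. f x \<le> ereal c}" and uv: "0 \<le> u" "0 \<le> v" "u + v = 1"
  have "f (u *\<^sub>R x + v *\<^sub>R y) \<le> ereal u * f x + ereal v * f y"
    using assms uv by (auto simp: proper_convex_def)
  also have "\<dots> \<le> ereal u * ereal c + ereal v * ereal c"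
    using xy uv by (intro add_mono ereal_mult_left_mono) auto
  also have "\<dots> = ereal c"
    using uv by (simp flip: distrib_right)
  finally show "u *\<^sub>R x + v *\<^sub>R y \<in> {x. f x \<le> ereal c}" by simp
qed

lemma proper_convex_imp_convex_on:
  assumes f: "proper_convex f" and B: "convex B" "\<And>x. x \<in> B \<Longrightarrow> f x < \<infinity>"
  shows "convex_on B (\<lambda>x. real_of_ereal (f x))"
proof (intro convex_on_def[THEN iffD2] conjI B(1) ballI allI impI)
  fix x y and u v :: real
  assume xy: "x \<in> B" "y \<in> B" and uv: "0 \<le> u" "0 \<le> v" "u + v = 1"
  have fin: "\<exists>r. f z = ereal r" if "z \<in> B" for z
    using f B(2)[OF that] by (cases "f z") (auto simp: proper_convex_def)
  have "u *\<^sub>R x + v *\<^sub>R y \<in> B"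
    using B(1) xy uv by (auto simp: convex_def)
  then obtain a b c where "f x = ereal a" "f y = ereal b" "f (u *\<^sub>R x + v *\<^sub>R y) = ereal c"
    using fin xy by metis
  moreover have "f (u *\<^sub>R x + v *\<^sub>R y) \<le> ereal u * f x + ereal v * f y"
    using f uv by (auto simp: proper_convex_def)
  ultimately show "real_of_ereal (f (u *\<^sub>R x + v *\<^sub>R y))
      \<le> u * real_of_ereal (f x) + v * real_of_ereal (f y)"
    by simp
qed

text \<open>Prolong the segment from \<open>u\<close> through \<open>v\<close> by the length
  \<open>r\<close>. The end \<open>w\<close> stays in the ball of twice the radius, and by convexity
  the slope from \<open>u\<close> to \<open>v\<close> is at most the slope from \<open>u\<close> to
  \<open>w\<close>, which is at most \<open>2 * C\<close> over a length of at least
  \<open>r\<close>.\<close>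

lemma convex_on_cball_lipschitz:
  fixes g :: "'a::euclidean_space \<Rightarrow> real"
  assumes g: "convex_on (cball t (2 * r)) g" and r: "r > 0"
    and bd: "\<And>x. x \<in> cball t (2 * r) \<Longrightarrow> \<bar>g x\<bar> \<le> C"
    and u: "u \<in> cball t r" and v: "v \<in> cball t r"
  shows "\<bar>g u - g v\<bar> \<le> 2 * C / r * dist u v"
proof -
  have *: "g v - g u \<le> 2 * C / r * dist u v" if u: "u \<in> cball t r" and v: "v \<in> cball t r" for u v
  proof (cases "u = v")
    case False
    define \<delta> where "\<delta> = dist u v"
    have \<delta>: "\<delta> > 0" using False by (simp add: \<delta>_def)
    define w where "w = v + (r / \<delta>) *\<^sub>R (v - u)"
    have "dist v w = r"
      using \<delta> r by (simp add: w_def dist_norm \<delta>_def norm_minus_commute)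
    then have w: "w \<in> cball t (2 * r)"
      using v dist_triangle[of t w v] by (auto simp: mem_cball)
    \<comment> \<open>The weight of \<open>w\<close> when \<open>v\<close> is written as a convex
      combination of \<open>u\<close> and \<open>w\<close>; it is at most
      \<open>\<delta> / r\<close>.\<close>
    define l where "l = \<delta> / (r + \<delta>)"
    have l: "0 \<le> l" "l \<le> 1" using \<delta> r by (auto simp: l_def)
    have "l * (r / \<delta>) = 1 - l" using \<delta> r by (simp add: l_def field_simps)
    then have "l *\<^sub>R w = l *\<^sub>R v + (1 - l) *\<^sub>R (v - u)"
      by (simp add: w_def scaleR_right_distrib)
    then have "(1 - l) *\<^sub>R u + l *\<^sub>R w = v"
      by (simp add: algebra_simps)
    then have "g v \<le> (1 - l) * g u + l * g w"
      using convex_onD[OF g l, of u w] u w r by auto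
    then have "g v - g u \<le> l * (g w - g u)" by (simp add: algebra_simps)
    also have "\<dots> \<le> l * (2 * C)"
      using bd[OF w] bd[of u] u r l by (intro mult_left_mono) auto
    also have "\<dots> \<le> 2 * C / r * \<delta>"
    proof -
      have "C \<ge> 0" using bd[OF w] by linarith
      moreover have "l \<le> \<delta> / r" using \<delta> r by (simp add: l_def frac_le)
      ultimately have "l * (2 * C) \<le> \<delta> / r * (2 * C)" by (intro mult_right_mono) auto
      then show ?thesis by (simp add: ac_simps)
    qed
    finally show ?thesis by (simp add: \<delta>_def)
  qed simp
  show ?thesis using *[OF u v] *[OF v u] by (simp add: dist_commute abs_le_iff)
qed

text \<open>The cross polytope with radius \<open>\<rho>\<close> contains the ball of radius
  \<open>\<rho> / DIM('a)\<close>, and moving its vertices by \<open>\<eta>\<close> costs at most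
  \<open>\<eta>\<close>. A point of the ball outside of the hull would be separated by a functional
  \<open>a\<close> that is larger at all vertices, but some vertex lies far in the direction in
  which \<open>a\<close> decreases.\<close>

lemma cball_subset_perturbed_cross_polytope:
  fixes t :: "'a::euclidean_space"
  assumes p: "\<And>i. i \<in> Basis \<Longrightarrow> dist (p i) (t + \<rho> *\<^sub>R i) \<le> \<eta>"
    and q: "\<And>i. i \<in> Basis \<Longrightarrow> dist (q i) (t - \<rho> *\<^sub>R i) \<le> \<eta>"
    and less: "\<eta> + r < \<rho> / DIM('a)" and \<rho>: "\<rho> > 0"
  shows "cball t r \<subseteq> convex hull (p ` Basis \<union> q ` Basis)"
proof (rule ccontr)
  assume "\<not> ?thesis"
  then obtain s where s: "s \<in> cball t r" "s \<notin> convex hull (p ` Basis \<union> q ` Basis)" by (meson subsetI)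
  have "closed (convex hull (p ` Basis \<union> q ` Basis))"
    by (intro compact_imp_closed finite_imp_compact_convex_hull) auto
  then obtain a b where ab: "a \<bullet> s < b" "\<And>x. x \<in> convex hull (p ` Basis \<union> q ` Basis) \<Longrightarrow> a \<bullet> x > b"
    using separating_hyperplane_closed_point[OF convex_convex_hull _ s(2)] by metis
  have far: "a \<bullet> s < a \<bullet> x" if "x \<in> p ` Basis \<union> q ` Basis" for x
    using ab hull_inc[OF that, of convex] by force
  have a0: "a \<noteq> 0" using far SOME_Basis by force
  \<comment> \<open>The l1 norm dominates the Euclidean norm, so some coordinate of \<open>a\<close>
    carries at least the average share.\<close>
  have "\<exists>i\<in>Basis. norm a / DIM('a) \<le> \<bar>a \<bullet> i\<bar>"
  proof (rule ccontr)
    assume "\<not> ?thesis"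
    then have "(\<Sum>i\<in>Basis. \<bar>a \<bullet> i\<bar>) < (\<Sum>i\<in>(Basis::'a set). norm a / DIM('a))"
      by (intro sum_strict_mono) auto
    then show False using norm_le_l1[of a] by simp
  qed
  then obtain i where i: "i \<in> Basis" "norm a / DIM('a) \<le> \<bar>a \<bullet> i\<bar>" by auto
  \<comment> \<open>The sign \<open>\<tau>\<close> selects, of the two vertices on axis
    \<open>i\<close>, the one at which \<open>a\<close> is small.\<close>
  have "\<exists>x \<in> p ` Basis \<union> q ` Basis. \<exists>\<tau>\<in>{-1,1}. dist x (t + (\<tau> * \<rho>) *\<^sub>R i) \<le> \<eta> \<and> \<tau> * (a \<bullet> i) = - \<bar>a \<bullet> i\<bar>"
  proof (cases "a \<bullet> i \<le> 0")
    case True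
    then show ?thesis using p[OF i(1)] i(1) by (intro bexI[of _ "p i"] bexI[of _ 1]) auto
  next
    case False
    then show ?thesis using q[OF i(1)] i(1) by (intro bexI[of _ "q i"] bexI[of _ "-1"]) auto
  qed
  then obtain x \<tau> where x: "x \<in> p ` Basis \<union> q ` Basis" "dist x (t + (\<tau> * \<rho>) *\<^sub>R i) \<le> \<eta>" "\<tau> * (a \<bullet> i) = - \<bar>a \<bullet> i\<bar>"
    by blast
  have "a \<bullet> x - a \<bullet> (t + (\<tau> * \<rho>) *\<^sub>R i) \<le> norm a * \<eta>"
  proof -
    have "a \<bullet> (x - (t + (\<tau> * \<rho>) *\<^sub>R i)) \<le> norm a * norm (x - (t + (\<tau> * \<rho>) *\<^sub>R i))"
      by (rule norm_cauchy_schwarz)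
    also have "\<dots> \<le> norm a * \<eta>" using x(2) by (intro mult_left_mono) (auto simp: dist_norm)
    finally show ?thesis by (simp add: inner_diff_right)
  qed
  moreover have "a \<bullet> (t + (\<tau> * \<rho>) *\<^sub>R i) = a \<bullet> t - \<rho> * \<bar>a \<bullet> i\<bar>"
    using x(3) by (simp add: inner_add_right algebra_simps)
  moreover have "\<rho> * \<bar>a \<bullet> i\<bar> \<ge> \<rho> * (norm a / DIM('a))"
    using i(2) \<rho> by (intro mult_left_mono) auto
  moreover have "a \<bullet> t - a \<bullet> s \<le> norm a * r"
  proof -
    have "a \<bullet> (t - s) \<le> norm a * norm (t - s)" by (rule norm_cauchy_schwarz)
    also have "\<dots> \<le> norm a * r" using s(1) by (intro mult_left_mono) (auto simp: dist_norm)
    finally show ?thesis by (simp add: inner_diff_right)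
  qed
  moreover have "norm a * (\<eta> + r) < norm a * (\<rho> / DIM('a))"
    using less a0 by (intro mult_strict_left_mono) auto
  ultimately have "a \<bullet> x < a \<bullet> s" by (simp add: algebra_simps)
  with far[OF x(1)] show False by simp
qed

text \<open>The good points provided by \<open>pt\<close> move with \<open>n\<close>, so the upper
  bound comes from a perturbed cross polytope whose vertices are such points: its hull contains a
  fixed ball. The lower bound comes from reflection in a good point \<open>u\<close> near the
  centre: the value at \<open>u\<close> is at most the mean of the values at \<open>s\<close> and at
  its mirror image, and the latter is already bounded above.\<close>

lemma proper_convex_locally_bounded:
  fixes f :: "nat \<Rightarrow> 'a::euclidean_space \<Rightarrow> ereal"
  assumes f: "\<And>n. proper_convex (f n)" and G: "open G" "t \<in> G"
    and pt: "\<And>U. open U \<Longrightarrow> U \<noteq> {} \<Longrightarrow> U \<subseteq> G \<Longrightarrow> \<exists>C. \<forall>\<^sub>F n in sequentially. \<exists>u\<in>U. \<bar>f n u\<bar> \<le> ereal C"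
  obtains r C where "r > 0" "cball t r \<subseteq> G"
    "\<forall>\<^sub>F n in sequentially. \<forall>s\<in>cball t r. \<bar>f n s\<bar> \<le> ereal C"
proof -
  obtain \<rho>0 where \<rho>0: "\<rho>0 > 0" "cball t \<rho>0 \<subseteq> G"
    using G open_contains_cball by blast
  \<comment> \<open>Halving \<open>\<rho>0\<close> leaves room for the neighbourhoods of the
    vertices. With the next two constants, \<open>\<eta> + r\<close> is three quarters of
    \<open>\<rho> / DIM('a)\<close>.\<close>
  define \<rho> where "\<rho> = \<rho>0 / 2"
  define \<eta> where "\<eta> = \<rho> / (4 * DIM('a))"
  define r where "r = \<rho> / (2 * DIM('a))"
  have \<rho>: "\<rho> > 0" and \<eta>: "\<eta> > 0" and r: "r > 0"
    using \<rho>0 by (auto simp: \<rho>_def \<eta>_def r_def)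
  have "1 \<le> 4 * real DIM('a)" "1 \<le> 2 * real DIM('a)"
    using DIM_positive[where 'a = 'a] by linarith+
  then have le: "\<eta> \<le> \<rho>" "r \<le> \<rho>"
    using \<rho> by (auto simp: \<eta>_def r_def divide_le_eq mult_le_cancel_left1)
  have sum: "\<eta> + r < \<rho> / DIM('a)"
    using \<rho> by (simp add: \<eta>_def r_def field_simps)
  define V where "V = (\<lambda>i. t + \<rho> *\<^sub>R i) ` Basis \<union> (\<lambda>i. t - \<rho> *\<^sub>R i) ` (Basis :: 'a set)"
  have finV: "finite V" by (simp add: V_def)
  have "\<forall>v\<in>V. \<exists>C. \<forall>\<^sub>F n in sequentially. \<exists>u\<in>ball v \<eta>. \<bar>f n u\<bar> \<le> ereal C"
  proof (intro ballI pt)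
    fix v assume v: "v \<in> V"
    have v: "dist t v \<le> \<rho>" using v \<rho> by (auto simp: V_def dist_norm)
    have "ball v \<eta> \<subseteq> cball t \<rho>0"
    proof
      fix z assume "z \<in> ball v \<eta>"
      then show "z \<in> cball t \<rho>0" using v le(1) dist_triangle[of t z v] by (simp add: \<rho>_def)
    qed
    then show "ball v \<eta> \<subseteq> G" using \<rho>0(2) by blast
  qed (use \<eta> in auto)
  from bchoice[OF this] obtain C
    where C: "\<And>v. v \<in> V \<Longrightarrow> \<forall>\<^sub>F n in sequentially. \<exists>u\<in>ball v \<eta>. \<bar>f n u\<bar> \<le> ereal (C v)"
    by blast
  define C1 where "C1 = (\<Sum>v\<in>V. \<bar>C v\<bar>)"
  have C1: "C v \<le> C1" if "v \<in> V" for v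
    using member_le_sum[OF that, of "\<lambda>v. \<bar>C v\<bar>"] finV by (auto simp: C1_def)
  \<comment> \<open>A third of \<open>r\<close>: if \<open>u\<close> and \<open>s\<close> are within
    \<open>r / 3\<close> of \<open>t\<close>, the mirror image of \<open>s\<close> in
    \<open>u\<close> is within \<open>r\<close> of \<open>t\<close>.\<close>
  have "\<exists>C. \<forall>\<^sub>F n in sequentially. \<exists>u\<in>ball t (r/3). \<bar>f n u\<bar> \<le> ereal C"
  proof (rule pt)
    have "r / 3 \<le> \<rho>0" using le(2) \<rho> r by (simp add: \<rho>_def)
    then have "ball t (r/3) \<subseteq> cball t \<rho>0" by (auto simp: subset_iff)
    then show "ball t (r/3) \<subseteq> G" using \<rho>0(2) by blast
  qed (use r in auto)
  then obtain C2 where C2: "\<forall>\<^sub>F n in sequentially. \<exists>u\<in>ball t (r/3). \<bar>f n u\<bar> \<le> ereal C2" by auto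
  have "\<forall>\<^sub>F n in sequentially. \<forall>v\<in>V. \<exists>u\<in>ball v \<eta>. \<bar>f n u\<bar> \<le> ereal (C v)"
    using C finV by (simp add: eventually_ball_finite_distrib)
  with C2 have "\<forall>\<^sub>F n in sequentially. \<forall>s\<in>cball t (r/3). \<bar>f n s\<bar> \<le> ereal (\<bar>C1\<bar> + 2 * \<bar>C2\<bar>)"
  proof eventually_elim
    case (elim n)
    from elim(2) obtain h where h: "\<And>v. v \<in> V \<Longrightarrow> h v \<in> ball v \<eta> \<and> \<bar>f n (h v)\<bar> \<le> ereal (C v)"
      by metis
    have hull: "cball t r \<subseteq> convex hull ((\<lambda>i. h (t + \<rho> *\<^sub>R i)) ` Basis \<union> (\<lambda>i. h (t - \<rho> *\<^sub>R i)) ` Basis)"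
    proof (rule cball_subset_perturbed_cross_polytope[OF _ _ sum \<rho>])
      fix i :: 'a assume i: "i \<in> Basis"
      have V: "t + \<rho> *\<^sub>R i \<in> V" "t - \<rho> *\<^sub>R i \<in> V" using i by (auto simp: V_def)
      show "dist (h (t + \<rho> *\<^sub>R i)) (t + \<rho> *\<^sub>R i) \<le> \<eta>" "dist (h (t - \<rho> *\<^sub>R i)) (t - \<rho> *\<^sub>R i) \<le> \<eta>"
        using h[OF V(1)] h[OF V(2)] by (simp_all add: dist_commute less_imp_le)
    qed
    have "f n (h v) \<le> ereal C1" if "v \<in> V" for v
      using h[OF that] C1[OF that] by (cases "f n (h v)") auto
    then have "convex hull ((\<lambda>i. h (t + \<rho> *\<^sub>R i)) ` Basis \<union> (\<lambda>i. h (t - \<rho> *\<^sub>R i)) ` Basis) \<subseteq> {x. f n x \<le> ereal C1}"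
      by (intro hull_minimal convex_proper_convex_sublevel f) (auto simp: V_def)
    with hull have up: "f n s \<le> ereal C1" if "s \<in> cball t r" for s using that by auto
    from elim(1) obtain u where u: "u \<in> ball t (r/3)" "\<bar>f n u\<bar> \<le> ereal C2" by auto
    show ?case
    proof
      fix s assume s: "s \<in> cball t (r/3)"
      have "dist t (2 *\<^sub>R u - s) \<le> norm (t - u) + norm (t - u) + norm (t - s)"
      proof -
        have "t - (2 *\<^sub>R u - s) = (t - u) + (t - u) - (t - s)" by (simp add: scaleR_2)
        then show ?thesis unfolding dist_norm by (metis norm_triangle_ineq norm_triangle_le_diff add_mono_thms_linordered_semiring(3))
      qed
      then have "dist t (2 *\<^sub>R u - s) \<le> r" using u(1) s by (simp add: dist_norm)
      then have 1: "f n (2 *\<^sub>R u - s) \<le> ereal C1" by (intro up) simp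
      have 2: "f n s \<le> ereal C1" using s r by (intro up) auto
      have "f n ((1/2) *\<^sub>R s + (1/2) *\<^sub>R (2 *\<^sub>R u - s)) \<le> ereal (1/2) * f n s + ereal (1/2) * f n (2 *\<^sub>R u - s)"
        by (rule f[of n, unfolded proper_convex_def, THEN conjunct2, rule_format]) simp
      then have 3: "f n u \<le> ereal (1/2) * f n s + ereal (1/2) * f n (2 *\<^sub>R u - s)"
        by (simp add: scaleR_right_diff_distrib)
      have 4: "f n s \<noteq> -\<infinity>" "f n (2 *\<^sub>R u - s) \<noteq> -\<infinity>" using f[of n] by (auto simp: proper_convex_def)
      show "\<bar>f n s\<bar> \<le> ereal (\<bar>C1\<bar> + 2 * \<bar>C2\<bar>)"
        using 1 2 3 4 u(2)
        by (cases "f n s"; cases "f n (2 *\<^sub>R u - s)"; cases "f n u") (auto simp: abs_le_iff)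
    qed
  qed
  moreover have "cball t (r/3) \<subseteq> G" using \<rho>0(2) le(2) r \<rho> by (auto simp: \<rho>_def subset_iff)
  ultimately show ?thesis using that[of "r/3"] r by auto
qed

lemma proper_convex_locally_lipschitz:
  fixes f :: "nat \<Rightarrow> 'a::euclidean_space \<Rightarrow> ereal"
  assumes f: "\<And>n. proper_convex (f n)" and G: "open G" "t \<in> G"
    and pt: "\<And>U. open U \<Longrightarrow> U \<noteq> {} \<Longrightarrow> U \<subseteq> G \<Longrightarrow> \<exists>C. \<forall>\<^sub>F n in sequentially. \<exists>u\<in>U. \<bar>f n u\<bar> \<le> ereal C"
  obtains r C L where "r > 0" "L > 0" "cball t r \<subseteq> G"
    "\<forall>\<^sub>F n in sequentially. (\<forall>s\<in>cball t r. \<bar>f n s\<bar> \<le> ereal C) \<and>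
       (\<forall>u\<in>cball t r. \<forall>v\<in>cball t r. \<bar>real_of_ereal (f n u) - real_of_ereal (f n v)\<bar> \<le> L * dist u v)"
proof -
  obtain r C where r: "r > 0" "cball t r \<subseteq> G"
    and bd: "\<forall>\<^sub>F n in sequentially. \<forall>s\<in>cball t r. \<bar>f n s\<bar> \<le> ereal C"
    by (rule proper_convex_locally_bounded[of f, OF f G]) (use pt in blast)+
  \<comment> \<open>The added 1 makes the Lipschitz constant positive even for \<open>C = 0\<close>;
    radii are later obtained by dividing by it.\<close>
  from bd have "\<forall>\<^sub>F n in sequentially. (\<forall>s\<in>cball t (r/2). \<bar>f n s\<bar> \<le> ereal C) \<and>
       (\<forall>u\<in>cball t (r/2). \<forall>v\<in>cball t (r/2).
          \<bar>real_of_ereal (f n u) - real_of_ereal (f n v)\<bar> \<le> (2 * \<bar>C\<bar> / (r/2) + 1) * dist u v)"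
  proof eventually_elim
    case (elim n)
    have fin: "f n x < \<infinity>" "\<bar>real_of_ereal (f n x)\<bar> \<le> \<bar>C\<bar>" if "x \<in> cball t r" for x
      using elim that by (cases "f n x"; force)+
    have "convex_on (cball t (2 * (r/2))) (\<lambda>x. real_of_ereal (f n x))"
      using fin by (intro proper_convex_imp_convex_on f) auto
    then have "\<bar>real_of_ereal (f n u) - real_of_ereal (f n v)\<bar> \<le> 2 * \<bar>C\<bar> / (r/2) * dist u v"
      if "u \<in> cball t (r/2)" "v \<in> cball t (r/2)" for u v
      using r fin(2) that by (intro convex_on_cball_lipschitz) simp_all
    moreover have "2 * \<bar>C\<bar> / (r/2) * dist u v \<le> (2 * \<bar>C\<bar> / (r/2) + 1) * dist u v" for u v :: 'a
      by (intro mult_right_mono) auto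
    ultimately show ?case using elim r by (meson order_trans cball_divide_subset_numeral subsetD)
  qed
  moreover have "cball t (r/2) \<subseteq> G" using r by auto
  moreover have "2 * \<bar>C\<bar> / (r/2) + 1 > 0" using r by (simp add: add_nonneg_pos)
  ultimately show ?thesis using that[of "r/2" "2 * \<bar>C\<bar> / (r/2) + 1" C] r by auto
qed

text \<open>A closed ball inside \<open>U\<close> bounds the continuous \<open>g\<close>, and the
  point \<open>u\<close> is sought in that ball. This turns closeness to \<open>g\<close> into the
  boundedness hypothesis of the local estimates.\<close>

lemma bounded_near_points:
  fixes g :: "'a::euclidean_space \<Rightarrow> real"
  assumes g: "continuous_on G g" "open G"
    and near: "\<And>U. open U \<Longrightarrow> U \<noteq> {} \<Longrightarrow> U \<subseteq> G \<Longrightarrow>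
       \<exists>C. \<forall>\<^sub>F n in sequentially. \<exists>u\<in>U. \<bar>f n u - ereal (g u)\<bar> \<le> ereal C"
    and U: "open U" "U \<noteq> {}" "U \<subseteq> G"
  shows "\<exists>C. \<forall>\<^sub>F n in sequentially. \<exists>u\<in>U. \<bar>f n u\<bar> \<le> ereal C"
proof -
  obtain x r where x: "x \<in> U" "r > 0" "cball x r \<subseteq> U"
    using U open_contains_cball by blast
  have "compact (g ` cball x r)"
    using x U by (intro compact_continuous_image continuous_on_subset[OF g(1)]) auto
  then obtain B where B: "\<And>y. y \<in> cball x r \<Longrightarrow> \<bar>g y\<bar> \<le> B"
    using compact_imp_bounded[of "g ` cball x r"] unfolding bounded_iff by (metis imageI real_norm_def)
  obtain C where "\<forall>\<^sub>F n in sequentially. \<exists>u\<in>ball x r. \<bar>f n u - ereal (g u)\<bar> \<le> ereal C"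
    using near[of "ball x r"] x U by (auto simp: subset_iff)
  then have "\<forall>\<^sub>F n in sequentially. \<exists>u\<in>U. \<bar>f n u\<bar> \<le> ereal (B + C)"
  proof eventually_elim
    case (elim n)
    then obtain u where u: "u \<in> ball x r" "\<bar>f n u - ereal (g u)\<bar> \<le> ereal C" by auto
    moreover have "\<bar>g u\<bar> \<le> B" using B u by auto
    ultimately have "\<bar>f n u\<bar> \<le> ereal (B + C)" by (cases "f n u") auto
    then show ?case using u(1) x(3) by (intro bexI[of _ u]) (auto simp: subset_iff)
  qed
  then show ?thesis by auto
qed

text \<open>One good point per open set is enough: the Lipschitz constants hold for all large
  \<open>n\<close>, so an estimate at a single point spreads to a whole small ball, and a finite
  subcover of \<open>K\<close> makes it uniform.\<close>

theorem proper_convex_uniform_convergence: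
  fixes f :: "nat \<Rightarrow> 'a::euclidean_space \<Rightarrow> ereal"
  assumes f: "\<And>n. proper_convex (f n)" and G: "open G" and g: "continuous_on G g"
    and near: "\<And>U \<eta>. open U \<Longrightarrow> U \<noteq> {} \<Longrightarrow> U \<subseteq> G \<Longrightarrow> \<eta> > 0 \<Longrightarrow>
       \<forall>\<^sub>F n in sequentially. \<exists>u\<in>U. \<bar>f n u - ereal (g u)\<bar> \<le> ereal \<eta>"
    and K: "compact K" "K \<subseteq> G" and \<eta>: "\<eta> > 0"
  shows "\<forall>\<^sub>F n in sequentially. \<forall>s\<in>K. \<bar>f n s - ereal (g s)\<bar> \<le> ereal \<eta>"
proof -
  have pt: "\<exists>C. \<forall>\<^sub>F n in sequentially. \<exists>u\<in>U. \<bar>f n u\<bar> \<le> ereal C"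
    if "open U" "U \<noteq> {}" "U \<subseteq> G" for U
    by (rule bounded_near_points[OF g G _ that]) (rule exI[of _ 1], rule near, simp_all)
  have loc: "\<exists>\<rho>>0. \<forall>\<^sub>F n in sequentially. \<forall>s\<in>ball t \<rho>. \<bar>f n s - ereal (g s)\<bar> \<le> ereal \<eta>"
    if t: "t \<in> G" for t
  proof -
    obtain r C L where r: "r > 0" "L > 0" "cball t r \<subseteq> G" and lip: "\<forall>\<^sub>F n in sequentially. (\<forall>s\<in>cball t r. \<bar>f n s\<bar> \<le> ereal C) \<and>
       (\<forall>u\<in>cball t r. \<forall>v\<in>cball t r. \<bar>real_of_ereal (f n u) - real_of_ereal (f n v)\<bar> \<le> L * dist u v)"
      by (rule proper_convex_locally_lipschitz[of f, OF f G t]) (use pt in blast)+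
    have "isCont g t" using g G t by (simp add: continuous_on_eq_continuous_at)
    then obtain d where d: "d > 0" "\<And>y. dist y t < d \<Longrightarrow> dist (g y) (g t) < \<eta>/6"
      unfolding continuous_at_eps_delta using \<eta> by (metis dist_commute divide_pos_pos zero_less_numeral)
    \<comment> \<open>Budget of \<open>\<eta>\<close>: the Lipschitz bound over a distance
      \<open>2 * \<rho>\<close> costs a third, the oscillation of \<open>g\<close> two sixths, the
      good point one sixth.\<close>
    define \<rho> where "\<rho> = min (min r d) (\<eta> / (6 * L))"
    have \<rho>: "\<rho> > 0" "\<rho> \<le> r" "\<rho> \<le> d" "L * \<rho> \<le> \<eta>/6"
    proof -
      show "\<rho> > 0" using r d \<eta> by (auto simp: \<rho>_def)
      have "L * \<rho> \<le> L * (\<eta> / (6 * L))" using r by (intro mult_left_mono) (auto simp: \<rho>_def)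
      then show "L * \<rho> \<le> \<eta>/6" using r by simp
    qed (auto simp: \<rho>_def)
    have "\<forall>\<^sub>F n in sequentially. \<exists>u\<in>ball t \<rho>. \<bar>f n u - ereal (g u)\<bar> \<le> ereal (\<eta>/6)"
      using \<rho> r \<eta> by (intro near) (auto simp: subset_iff)
    with lip have "\<forall>\<^sub>F n in sequentially. \<forall>s\<in>ball t \<rho>. \<bar>f n s - ereal (g s)\<bar> \<le> ereal \<eta>"
    proof eventually_elim
      case (elim n)
      then obtain u where u: "u \<in> ball t \<rho>" "\<bar>f n u - ereal (g u)\<bar> \<le> ereal (\<eta>/6)" by auto
      show ?case
      proof
        fix s assume s: "s \<in> ball t \<rho>"
        have in_r: "s \<in> cball t r" "u \<in> cball t r" using s u \<rho> by auto
        have "\<bar>real_of_ereal (f n s) - real_of_ereal (f n u)\<bar> \<le> L * dist s u"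
          using elim in_r by auto
        also have "dist s u \<le> 2 * \<rho>" using s u dist_triangle[of s u t] by (auto simp: dist_commute)
        then have "L * dist s u \<le> L * (2 * \<rho>)" using r by (intro mult_left_mono) auto
        also have "\<dots> \<le> \<eta>/3" using \<rho> by simp
        finally have 1: "\<bar>real_of_ereal (f n s) - real_of_ereal (f n u)\<bar> \<le> \<eta>/3" .
        have 2: "dist (g s) (g t) < \<eta>/6" "dist (g u) (g t) < \<eta>/6"
          using s u \<rho> d(2)[of s] d(2)[of u] by (simp_all add: dist_commute)
        have "\<bar>f n s\<bar> \<le> ereal C" "\<bar>f n u\<bar> \<le> ereal C" using elim in_r by auto
        then obtain a b where ab: "f n s = ereal a" "f n u = ereal b"
          by (cases "f n s"; cases "f n u") auto
        have "\<bar>a - b\<bar> \<le> \<eta>/3" "\<bar>b - g u\<bar> \<le> \<eta>/6" "\<bar>g s - g t\<bar> < \<eta>/6" "\<bar>g u - g t\<bar> < \<eta>/6"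
          using 1 2 u(2) ab by (simp_all add: dist_real_def)
        then have "\<bar>a - g s\<bar> \<le> \<eta>" unfolding abs_le_iff abs_less_iff by linarith
        then show "\<bar>f n s - ereal (g s)\<bar> \<le> ereal \<eta>" using ab by simp
      qed
    qed
    then show ?thesis using \<rho>(1) by auto
  qed
  then have "\<forall>t\<in>G. \<exists>\<rho>>0. \<forall>\<^sub>F n in sequentially. \<forall>s\<in>ball t \<rho>. \<bar>f n s - ereal (g s)\<bar> \<le> ereal \<eta>"
    by blast
  from bchoice[OF this] obtain \<rho> where \<rho>: "\<And>t. t \<in> G \<Longrightarrow> \<rho> t > 0"
    "\<And>t. t \<in> G \<Longrightarrow> \<forall>\<^sub>F n in sequentially. \<forall>s\<in>ball t (\<rho> t). \<bar>f n s - ereal (g s)\<bar> \<le> ereal \<eta>"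
    by blast
  have "K \<subseteq> (\<Union>t\<in>K. ball t (\<rho> t))" using \<rho>(1) K by (auto intro!: centre_in_ball[THEN iffD2])
  then obtain T where T: "T \<subseteq> K" "finite T" "K \<subseteq> (\<Union>t\<in>T. ball t (\<rho> t))"
    using compactE_image[OF K(1), of K "\<lambda>t. ball t (\<rho> t)"] by auto
  have "\<forall>\<^sub>F n in sequentially. \<forall>t\<in>T. \<forall>s\<in>ball t (\<rho> t). \<bar>f n s - ereal (g s)\<bar> \<le> ereal \<eta>"
    using T K \<rho>(2) by (subst eventually_ball_finite_distrib) auto
  then show ?thesis by eventually_elim (use T in blast)
qed

section \<open>Directional derivatives and subdifferentials of limits\<close>

lemma difference_quotient_mono:
  assumes f: "proper_convex f" and fin: "\<bar>f x\<bar> \<noteq> \<infinity>" and ab: "0 < a" "a \<le> b"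
  shows "(f (x + a *\<^sub>R \<xi>) - f x) / ereal a \<le> (f (x + b *\<^sub>R \<xi>) - f x) / ereal b"
proof (cases "f (x + b *\<^sub>R \<xi>) = \<infinity>")
  case True
  then show ?thesis using fin ab by (cases "f x") auto
next
  case False
  have nm: "f y \<noteq> -\<infinity>" for y using f by (auto simp: proper_convex_def)
  have "x + a *\<^sub>R \<xi> = (1 - a / b) *\<^sub>R x + (a / b) *\<^sub>R (x + b *\<^sub>R \<xi>)"
    using ab by (simp add: algebra_simps)
  then have le: "f (x + a *\<^sub>R \<xi>) \<le> ereal (1 - a / b) * f x + ereal (a / b) * f (x + b *\<^sub>R \<xi>)"
    using f[unfolded proper_convex_def, THEN conjunct2, rule_format, of "1 - a / b" "a / b" x "x + b *\<^sub>R \<xi>"] ab by simp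
  obtain u v where uv: "f x = ereal u" "f (x + b *\<^sub>R \<xi>) = ereal v"
    using fin False nm[of "x + b *\<^sub>R \<xi>"] by (cases "f x"; cases "f (x + b *\<^sub>R \<xi>)") auto
  obtain w where w: "f (x + a *\<^sub>R \<xi>) = ereal w"
    using le nm[of "x + a *\<^sub>R \<xi>"] by (cases "f (x + a *\<^sub>R \<xi>)") (auto simp: uv)
  have "w \<le> (1 - a / b) * u + a / b * v" using le by (simp add: uv w)
  then have "w - u \<le> a * ((v - u) / b)" by (simp add: algebra_simps diff_divide_distrib)
  then have "(w - u) / a \<le> (v - u) / b" using ab by (simp add: divide_le_eq mult.commute)
  then show ?thesis using ab by (simp add: uv w)
qed

text \<open>The quotients decrease as \<open>h\<close> decreases, so their limit exists in the
  extended reals and is the infimum.\<close>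

lemma tendsto_difference_quotient:
  assumes f: "proper_convex f" and fin: "\<bar>f x\<bar> \<noteq> \<infinity>"
  shows "((\<lambda>h. (f (x + h *\<^sub>R \<xi>) - f x) / ereal h) \<longlongrightarrow> (INF h\<in>{0<..}. (f (x + h *\<^sub>R \<xi>) - f x) / ereal h)) (at_right 0)"
    (is "(?q \<longlongrightarrow> ?L) _")
proof (rule order_tendstoI)
  fix a assume "a < ?L"
  then have "a < ?q h" if "h > 0" for h
    using that by (meson INF_lower greaterThan_iff less_le_trans)
  then show "\<forall>\<^sub>F h in at_right 0. a < ?q h"
    by (auto intro: eventually_mono[OF eventually_at_right_less])
next
  fix a assume "?L < a"
  then obtain b where b: "b > 0" "?q b < a" by (auto simp: INF_less_iff)
  have "\<forall>\<^sub>F h in at_right 0. h \<in> {0<..<b}" using b(1) by (rule eventually_at_right_real)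
  then show "\<forall>\<^sub>F h in at_right 0. ?q h < a"
  proof eventually_elim
    case (elim h)
    then have "?q h \<le> ?q b" by (intro difference_quotient_mono f fin) auto
    then show ?case using b(2) by simp
  qed
qed

text \<open>An infimum is bounded above by the quotient at any single \<open>h\<close>; this lets
  \<open>n\<close> tend to infinity before \<open>h\<close> tends to 0.\<close>

lemma dir_deriv_eq_INF:
  assumes "proper_convex f" "\<bar>f x\<bar> \<noteq> \<infinity>"
  shows "dir_deriv f x \<xi> = (INF h\<in>{0<..}. (f (x + h *\<^sub>R \<xi>) - f x) / ereal h)"
  unfolding dir_deriv_def by (intro tendsto_Lim tendsto_difference_quotient assms trivial_limit_at_right_real)

text \<open>Each derivative of \<open>f n\<close> is at most its quotient at a fixed
  \<open>h\<close>, which converges with \<open>n\<close>; then \<open>h\<close> tends to 0. Only an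
  upper bound can result, since along the sequence the infimum over \<open>h\<close> may be strictly
  smaller than that of the limit.\<close>

lemma limsup_dir_deriv_le:
  fixes f :: "nat \<Rightarrow> 'a::euclidean_space \<Rightarrow> ereal"
  assumes f: "\<And>n. proper_convex (f n)" and f0: "proper_convex f0" and r: "r > 0"
    and lim: "\<And>s. s \<in> ball x r \<Longrightarrow> f0 s = ereal (g s) \<and> (\<lambda>n. f n s) \<longlonglongrightarrow> ereal (g s)"
  shows "limsup (\<lambda>n. dir_deriv (f n) x \<xi>) \<le> dir_deriv f0 x \<xi>"
proof -
  have x: "f0 x = ereal (g x)" "(\<lambda>n. f n x) \<longlonglongrightarrow> ereal (g x)" using lim[of x] r by auto
  have fin: "\<forall>\<^sub>F n in sequentially. \<bar>f n s\<bar> \<noteq> \<infinity>" if "s \<in> ball x r" for s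
  proof -
    have "\<forall>\<^sub>F n in sequentially. f n s < ereal (g s + 1)"
      using lim[OF that] by (intro order_tendstoD[of _ "ereal (g s)"]) auto
    then show ?thesis
      by eventually_elim (use f in \<open>auto simp: proper_convex_def\<close>)
  qed
  have le: "limsup (\<lambda>n. dir_deriv (f n) x \<xi>) \<le> (f0 (x + h *\<^sub>R \<xi>) - f0 x) / ereal h"
    if h: "h > 0" "x + h *\<^sub>R \<xi> \<in> ball x r" for h
  proof -
    let ?s = "x + h *\<^sub>R \<xi>"
    have fin2: "\<forall>\<^sub>F n in sequentially. \<bar>f n x\<bar> \<noteq> \<infinity> \<and> \<bar>f n ?s\<bar> \<noteq> \<infinity>"
      using fin[of x] fin[OF h(2)] r by (intro eventually_conj) auto
    have "limsup (\<lambda>n. dir_deriv (f n) x \<xi>) \<le> limsup (\<lambda>n. ereal ((real_of_ereal (f n ?s) - real_of_ereal (f n x)) / h))"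
    proof (rule Limsup_mono)
      show "\<forall>\<^sub>F n in sequentially. dir_deriv (f n) x \<xi> \<le> ereal ((real_of_ereal (f n ?s) - real_of_ereal (f n x)) / h)"
        using fin2
      proof eventually_elim
        case (elim n)
        then have "dir_deriv (f n) x \<xi> \<le> (f n ?s - f n x) / ereal h"
          using h(1) by (subst dir_deriv_eq_INF[OF f]) (auto intro!: INF_lower)
        then show ?case using elim h(1) by (cases "f n ?s"; cases "f n x") auto
      qed
    qed
    also have "\<dots> = ereal ((g ?s - g x) / h)"
    proof (rule lim_imp_Limsup)
      show "(\<lambda>n. ereal ((real_of_ereal (f n ?s) - real_of_ereal (f n x)) / h)) \<longlonglongrightarrow> ereal ((g ?s - g x) / h)"
        using lim[OF h(2)] x(2) h(1)
        by (intro tendsto_intros lim_real_of_ereal) auto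
    qed simp
    also have "\<dots> = (f0 ?s - f0 x) / ereal h" using lim[OF h(2)] x h(1) by simp
    finally show ?thesis .
  qed
  have "((\<lambda>h. (f0 (x + h *\<^sub>R \<xi>) - f0 x) / ereal h) \<longlongrightarrow> dir_deriv f0 x \<xi>) (at_right 0)"
  proof -
    have "\<bar>f0 x\<bar> \<noteq> \<infinity>" using x by simp
    then show ?thesis unfolding dir_deriv_eq_INF[OF f0 \<open>\<bar>f0 x\<bar> \<noteq> \<infinity>\<close>] by (rule tendsto_difference_quotient[OF f0])
  qed
  moreover have "\<forall>\<^sub>F h in at_right 0. limsup (\<lambda>n. dir_deriv (f n) x \<xi>) \<le> (f0 (x + h *\<^sub>R \<xi>) - f0 x) / ereal h"
  proof -
    \<comment> \<open>The added 1 covers \<open>\<xi> = 0\<close>; for these \<open>h\<close> the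
      shifted point stays in the ball.\<close>
    have "\<forall>\<^sub>F h in at_right 0. h \<in> {0<..<r / (norm \<xi> + 1)}"
      using r by (intro eventually_at_right_real divide_pos_pos) (auto simp: add_nonneg_pos)
    then show ?thesis
    proof eventually_elim
      case (elim h)
      have "h * norm \<xi> \<le> h * (norm \<xi> + 1)" using elim by (intro mult_left_mono) auto
      also have "\<dots> < r" using elim by (simp add: less_divide_eq add_nonneg_pos)
      finally show ?case using elim by (intro le) (auto simp: dist_norm)
    qed
  qed
  ultimately show ?thesis by (intro tendsto_lowerbound) auto
qed

text \<open>Shrink \<open>h\<close> by a factor \<open>t\<close> into the ball; monotonicity of the
  difference quotients carries the inequality from \<open>t\<close> back to 1.\<close>

lemma local_subgradient_imp_subdifferential:
  fixes x :: "'a::euclidean_space"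
  assumes f: "proper_convex f" and fin: "\<bar>f x\<bar> \<noteq> \<infinity>" and r: "r > 0"
    and loc: "\<And>h. norm h < r \<Longrightarrow> ereal (\<xi> \<bullet> h) \<le> f (x + h) - f x"
  shows "\<xi> \<in> subdifferential f x"
  unfolding subdifferential_def
proof (intro CollectI allI)
  fix h :: 'a
  define t where "t = min 1 (r / (norm h + 1))"
  have np: "norm h + 1 > 0" by (simp add: add_nonneg_pos)
  have t: "0 < t" "t \<le> 1" using r np by (auto simp: t_def)
  have "t * norm h < r"
  proof -
    have "t * norm h \<le> r / (norm h + 1) * norm h" by (intro mult_right_mono) (auto simp: t_def)
    also have "\<dots> < r" using r np by (simp add: divide_less_eq mult.commute)
    finally show ?thesis .
  qed
  then have "norm (t *\<^sub>R h) < r" using t by simp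
  from loc[OF this] have "ereal (t * (\<xi> \<bullet> h)) \<le> f (x + t *\<^sub>R h) - f x" by simp
  then have "ereal (t * (\<xi> \<bullet> h)) / ereal t \<le> (f (x + t *\<^sub>R h) - f x) / ereal t"
    using t by (intro ereal_divide_right_mono) auto
  also have "\<dots> \<le> (f (x + 1 *\<^sub>R h) - f x) / ereal 1"
    by (rule difference_quotient_mono[OF f fin t])
  finally show "ereal (\<xi> \<bullet> h) \<le> f (x + h) - f x"
    using t fin by (cases "f (x + h)"; cases "f x") auto
qed

text \<open>A supporting hyperplane: separate the point of the graph at \<open>x\<close> from the
  epigraph over the ball. The component \<open>c\<close> of the normal \<open>(u, c)\<close> is
  positive because \<open>x\<close> is an interior point, and \<open>- u / c\<close> is the
  subgradient.\<close>

lemma subdifferential_nonempty: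
  fixes x :: "'a::euclidean_space"
  assumes f: "proper_convex f" and r: "r > 0" and fin: "\<And>s. s \<in> ball x r \<Longrightarrow> f s < \<infinity>"
  shows "subdifferential f x \<noteq> {}"
proof -
  define g where "g s = real_of_ereal (f s)" for s
  have fg: "f s = ereal (g s)" if "s \<in> ball x r" for s
    using fin[OF that] f by (cases "f s") (auto simp: g_def proper_convex_def)
  have conv: "convex_on (ball x r) g"
    unfolding g_def using fin by (intro proper_convex_imp_convex_on f) auto
  \<comment> \<open>The strict epigraph is convex and misses the point of the graph, so two disjoint
    convex sets are to be separated.\<close>
  define A where "A = {p. fst p \<in> ball x r \<and> g (fst p) < snd p}"
  have "convex A"
    unfolding convex_def
  proof (intro ballI allI impI)
    fix p q :: "'a \<times> real" and u v :: real assume p: "p \<in> A" and q: "q \<in> A" and uv: "0 \<le> u" "0 \<le> v" "u + v = 1"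
    have 1: "u *\<^sub>R fst p + v *\<^sub>R fst q \<in> ball x r"
      using p q uv convex_ball[of x r] by (auto simp: A_def convex_def)
    have "g (u *\<^sub>R fst p + v *\<^sub>R fst q) \<le> u * g (fst p) + v * g (fst q)"
      using conv p q uv by (auto simp: convex_on_def A_def)
    also have "\<dots> < u * snd p + v * snd q"
    proof (cases "u = 0")
      case True
      then show ?thesis using uv q by (simp add: A_def)
    next
      case False
      then have "u * g (fst p) < u * snd p" "v * g (fst q) \<le> v * snd q"
        using uv p q by (auto simp: A_def intro!: mult_left_mono)
      then show ?thesis by simp
    qed
    finally show "u *\<^sub>R p + v *\<^sub>R q \<in> A" using 1 by (simp add: A_def)
  qed
  moreover have "(x, g x + 1) \<in> A" using r by (simp add: A_def)
  moreover have "{(x, g x)} \<inter> A = {}" by (simp add: A_def)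
  ultimately have "\<exists>a b. a \<noteq> 0 \<and> (\<forall>p\<in>{(x, g x)}. a \<bullet> p \<le> b) \<and> (\<forall>p\<in>A. a \<bullet> p \<ge> b)"
    by (intro separating_hyperplane_sets) auto
  then obtain a b where ab: "a \<noteq> 0" "a \<bullet> (x, g x) \<le> b" "\<And>p. p \<in> A \<Longrightarrow> a \<bullet> p \<ge> b"
    by blast
  obtain u c where a: "a = (u, c)" by (cases a)
  have sep: "u \<bullet> x + c * g x \<le> u \<bullet> s + c * y" if "s \<in> ball x r" "g s < y" for s y
    using ab(2) ab(3)[of "(s, y)"] that by (simp add: a A_def)
  have "c \<ge> 0" using sep[of x "g x + 1"] r by (simp add: algebra_simps)
  moreover have "c \<noteq> 0"
  proof
    assume c: "c = 0"
    then have u: "u \<noteq> 0" using ab(1) by (simp add: a zero_prod_def)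
    \<comment> \<open>A step against \<open>u\<close> inside of the ball; a vertical hyperplane
      through \<open>x\<close> would have this point on its wrong side.\<close>
    define s where "s = x - (r / (2 * norm u)) *\<^sub>R u"
    have "s \<in> ball x r" using r u by (simp add: s_def dist_norm)
    from sep[OF this, of "g s + 1"] have "(r / (2 * norm u)) * (u \<bullet> u) \<le> 0"
      by (simp add: c s_def inner_diff_right)
    moreover have "(r / (2 * norm u)) * (u \<bullet> u) > 0" using r u by simp
    ultimately show False by simp
  qed
  ultimately have c: "c > 0" by simp
  have "- (1 / c) *\<^sub>R u \<in> subdifferential f x"
  proof (rule local_subgradient_imp_subdifferential[OF f _ r])
    show "\<bar>f x\<bar> \<noteq> \<infinity>" using fg[of x] r by simp
    fix h :: 'a assume h: "norm h < r"
    then have s: "x + h \<in> ball x r" by (simp add: dist_norm)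
    \<comment> \<open>The separation only speaks of points strictly above the graph, so a margin
      \<open>e\<close> is added and sent to 0.\<close>
    have "- (u \<bullet> h) \<le> c * (g (x + h) - g x)"
    proof (rule field_le_epsilon)
      fix e :: real assume e: "e > 0"
      have "u \<bullet> x + c * g x \<le> u \<bullet> (x + h) + c * (g (x + h) + e / c)"
        using e c by (intro sep s) simp
      then show "- (u \<bullet> h) \<le> c * (g (x + h) - g x) + e"
        using c by (simp add: inner_add_right algebra_simps)
    qed
    then have "- (1 / c) * (u \<bullet> h) \<le> g (x + h) - g x"
      using c by (simp add: divide_le_eq field_simps)
    then show "ereal ((- (1 / c) *\<^sub>R u) \<bullet> h) \<le> f (x + h) - f x"
      using fg[OF s] fg[of x] r by simp
  qed
  then show ?thesis by blast
qed

text \<open>By contradiction and compactness: subgradients outside of the enlarged set at infinitely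
  many indices are bounded, a subsequence converges, and the limit is a subgradient of
  \<open>f0\<close> because the inequality on the ball passes to the limit.\<close>

lemma eventually_subdifferential_subset:
  fixes f :: "nat \<Rightarrow> 'a::euclidean_space \<Rightarrow> ereal"
  assumes f0: "proper_convex f0" and r: "r > 0"
    and f0g: "\<And>s. s \<in> cball x r \<Longrightarrow> f0 s = ereal (g s)" and g: "continuous_on (cball x r) g"
    and unif: "\<And>\<eta>. \<eta> > 0 \<Longrightarrow> \<forall>\<^sub>F n in sequentially. \<forall>s\<in>cball x r. \<bar>f n s - ereal (g s)\<bar> \<le> ereal \<eta>"
    and \<epsilon>: "\<epsilon> > 0"
  shows "\<forall>\<^sub>F n in sequentially. subdifferential (f n) x \<subseteq>
    {\<xi> + \<epsilon> *\<^sub>R b | \<xi> b. \<xi> \<in> subdifferential f0 x \<and> b \<in> cball 0 1}" (is "\<forall>\<^sub>F n in _. ?P n")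
proof (rule ccontr)
  assume "\<not> ?thesis"
  from not_eventually_sequentiallyD[OF this] obtain k :: "nat \<Rightarrow> nat" where k: "strict_mono k" "\<And>n. \<not> ?P (k n)"
    by blast
  obtain C where C: "\<And>s. s \<in> cball x r \<Longrightarrow> \<bar>g s\<bar> \<le> C"
    using compact_imp_bounded[OF compact_continuous_image[OF g compact_cball]] unfolding bounded_iff by (metis imageI real_norm_def)
  obtain N where N: "\<And>n s. n \<ge> N \<Longrightarrow> s \<in> cball x r \<Longrightarrow> \<bar>f n s - ereal (g s)\<bar> \<le> ereal 1"
    using unif[OF zero_less_one] unfolding eventually_sequentially by blast
  \<comment> \<open>Shifted so that every index used is beyond \<open>N\<close>, where the distance
    to \<open>g\<close> is at most 1.\<close>
  define k' where "k' n = k (n + N)" for n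
  have k': "k' n \<ge> n" "k' n \<ge> N" "\<not> ?P (k' n)" for n
    using seq_suble[OF k(1), of "n + N"] k(2) by (auto simp: k'_def)
  have k'lim: "filterlim k' at_top sequentially"
    using k'(1) by (intro filterlim_at_top_mono[OF filterlim_ident]) auto
  have "\<forall>n. \<exists>\<xi>. \<xi> \<in> subdifferential (f (k' n)) x \<and> \<xi> \<notin> {\<xi> + \<epsilon> *\<^sub>R b | \<xi> b. \<xi> \<in> subdifferential f0 x \<and> b \<in> cball 0 1}"
    using k'(3) by (meson subsetI)
  from choice[OF this] obtain \<xi> where \<xi>: "\<And>n. \<xi> n \<in> subdifferential (f (k' n)) x"
    "\<And>n. \<xi> n \<notin> {\<xi> + \<epsilon> *\<^sub>R b | \<xi> b. \<xi> \<in> subdifferential f0 x \<and> b \<in> cball 0 1}" by blast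
  have sub: "\<xi> n \<bullet> h \<le> real_of_ereal (f (k' n) (x + h)) - real_of_ereal (f (k' n) x)" if h: "norm h \<le> r" for n h
  proof -
    have "x \<in> cball x r" "x + h \<in> cball x r" using r h by (auto simp: dist_norm)
    then have "\<bar>f (k' n) x - ereal (g x)\<bar> \<le> ereal 1" "\<bar>f (k' n) (x + h) - ereal (g (x + h))\<bar> \<le> ereal 1"
      using N k'(2) by auto
    moreover have "ereal (\<xi> n \<bullet> h) \<le> f (k' n) (x + h) - f (k' n) x"
      using \<xi>(1)[of n] by (simp add: subdifferential_def)
    ultimately show ?thesis by (cases "f (k' n) x"; cases "f (k' n) (x + h)") auto
  qed
  have bound: "\<xi> n \<in> cball 0 ((2 * C + 2) / r)" for n
  proof (cases "\<xi> n = 0")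
    case False
    \<comment> \<open>Testing a subgradient in its own direction turns a bound on values into a
      bound on its norm.\<close>
    define h where "h = (r / norm (\<xi> n)) *\<^sub>R \<xi> n"
    have h: "norm h = r" using r False by (simp add: h_def)
    have x: "x \<in> cball x r" "x + h \<in> cball x r" using r h by (auto simp: dist_norm)
    have "r * norm (\<xi> n) = \<xi> n \<bullet> h" using False by (simp add: h_def power2_norm_eq_inner[symmetric] power2_eq_square)
    also have "\<dots> \<le> real_of_ereal (f (k' n) (x + h)) - real_of_ereal (f (k' n) x)" using sub h by simp
    also have "\<dots> \<le> 2 * C + 2"
      using N[OF k'(2)[of n] x(1)] N[OF k'(2)[of n] x(2)] C[OF x(1)] C[OF x(2)]
      by (cases "f (k' n) x"; cases "f (k' n) (x + h)") auto
    finally show ?thesis using r by (simp add: field_simps)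
  next
    case True
    have "C \<ge> 0" using C[of x] r by force
    then show ?thesis using r True by simp
  qed
  obtain l m where l: "strict_mono m" "(\<xi> \<circ> m) \<longlonglongrightarrow> l"
    using compact_cball[of 0 "(2 * C + 2) / r"] bound unfolding compact_def by metis
  have mlim: "filterlim (\<lambda>n. k' (m n)) at_top sequentially"
    using filterlim_compose[OF k'lim filterlim_subseq[OF l(1)]] .
  have flim: "(\<lambda>n. real_of_ereal (f (k' (m n)) s)) \<longlonglongrightarrow> g s" if s: "s \<in> cball x r" for s
  proof (rule LIMSEQ_I)
    fix e :: real assume e: "e > 0"
    then have "\<forall>\<^sub>F n in sequentially. \<bar>f n s - ereal (g s)\<bar> \<le> ereal (e / 2)"
      using unif[of "e / 2"] s by (auto elim!: eventually_mono)
    then have "\<forall>\<^sub>F n in sequentially. \<bar>f (k' (m n)) s - ereal (g s)\<bar> \<le> ereal (e / 2)"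
      using mlim by (rule eventually_compose_filterlim)
    then have "\<forall>\<^sub>F n in sequentially. norm (real_of_ereal (f (k' (m n)) s) - g s) < e"
    proof eventually_elim
      case (elim n)
      then show ?case using e by (cases "f (k' (m n)) s") auto
    qed
    then show "\<exists>no. \<forall>n\<ge>no. norm (real_of_ereal (f (k' (m n)) s) - g s) < e" by (simp add: eventually_sequentially)
  qed
  have "l \<in> subdifferential f0 x"
  proof (rule local_subgradient_imp_subdifferential[OF f0 _ r])
    show "\<bar>f0 x\<bar> \<noteq> \<infinity>" using f0g[of x] r by simp
    fix h :: 'a assume h: "norm h < r"
    have s: "x \<in> cball x r" "x + h \<in> cball x r" using r h by (auto simp: dist_norm)
    have "l \<bullet> h \<le> g (x + h) - g x"
    proof (rule LIMSEQ_le)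
      show "(\<lambda>n. \<xi> (m n) \<bullet> h) \<longlonglongrightarrow> l \<bullet> h" using l(2) by (intro tendsto_intros) (simp add: comp_def)
      show "(\<lambda>n. real_of_ereal (f (k' (m n)) (x + h)) - real_of_ereal (f (k' (m n)) x)) \<longlonglongrightarrow> g (x + h) - g x"
        by (intro tendsto_diff flim s)
    qed (use sub h in \<open>auto intro!: exI[of _ 0]\<close>)
    then show "ereal (l \<bullet> h) \<le> f0 (x + h) - f0 x" using f0g[OF s(1)] f0g[OF s(2)] by simp
  qed
  obtain n where "norm ((\<xi> \<circ> m) n - l) < \<epsilon>" using LIMSEQ_D[OF l(2) \<epsilon>] by blast
  then have "(1 / \<epsilon>) *\<^sub>R (\<xi> (m n) - l) \<in> cball 0 1"
    unfolding mem_cball_0 norm_scaleR using \<epsilon> by (simp add: field_simps)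
  moreover have "\<xi> (m n) = l + \<epsilon> *\<^sub>R ((1 / \<epsilon>) *\<^sub>R (\<xi> (m n) - l))" using \<epsilon> by simp
  ultimately show False using \<xi>(2)[of "m n"] \<open>l \<in> subdifferential f0 x\<close> by blast
qed

text \<open>Along the direction \<open>h = \<xi> - D\<close>, the function minus its subgradient
  line has a local minimum at 0 and the derivative \<open>- (h \<bullet> h)\<close> there, so
  \<open>h\<close> is 0.\<close>

lemma subdifferential_eq_gradient:
  fixes x :: "'a::euclidean_space"
  assumes \<xi>: "\<xi> \<in> subdifferential f x" and r: "r > 0" and fin: "\<And>s. s \<in> ball x r \<Longrightarrow> \<bar>f s\<bar> \<noteq> \<infinity>"
    and D: "GDERIV (\<lambda>y. real_of_ereal (f y)) x :> D"
  shows "\<xi> = D"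
proof -
  define h where "h = \<xi> - D"
  define p where "p t = real_of_ereal (f (x + t *\<^sub>R h)) - t * (\<xi> \<bullet> h)" for t :: real
  have "((\<lambda>y. real_of_ereal (f y)) has_derivative (\<lambda>h. h \<bullet> D)) (at (x + 0 *\<^sub>R h))"
    using D by (simp add: gderiv_def)
  then have "((\<lambda>t. real_of_ereal (f (x + t *\<^sub>R h))) has_derivative (\<lambda>t. (t *\<^sub>R h) \<bullet> D)) (at 0)"
    by (rule has_derivative_compose[rotated]) (auto intro!: derivative_eq_intros)
  then have "(p has_derivative (\<lambda>t. (t *\<^sub>R h) \<bullet> D - t * (\<xi> \<bullet> h))) (at 0)"
    unfolding p_def by (auto intro!: derivative_eq_intros)
  then have "DERIV p 0 :> h \<bullet> D - \<xi> \<bullet> h"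
    unfolding has_field_derivative_def by (rule has_derivative_eq_rhs) (auto simp: fun_eq_iff algebra_simps)
  moreover have "r / (norm h + 1) > 0" using r by (simp add: add_nonneg_pos)
  moreover have "\<forall>t. \<bar>0 - t\<bar> < r / (norm h + 1) \<longrightarrow> p 0 \<le> p t"
  proof (intro allI impI)
    fix t assume t: "\<bar>0 - t\<bar> < r / (norm h + 1)"
    have "\<bar>t\<bar> * norm h \<le> \<bar>t\<bar> * (norm h + 1)" by (intro mult_left_mono) auto
    also have "\<dots> < r" using t by (simp add: less_divide_eq add_nonneg_pos)
    finally have "x + t *\<^sub>R h \<in> ball x r" by (simp add: dist_norm)
    then have "\<bar>f (x + t *\<^sub>R h)\<bar> \<noteq> \<infinity>" "\<bar>f x\<bar> \<noteq> \<infinity>" using fin r by auto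
    moreover have "ereal (\<xi> \<bullet> (t *\<^sub>R h)) \<le> f (x + t *\<^sub>R h) - f x"
      using \<xi> unfolding subdifferential_def by blast
    ultimately show "p 0 \<le> p t"
      by (cases "f (x + t *\<^sub>R h)"; cases "f x") (auto simp: p_def)
  qed
  ultimately have "h \<bullet> D - \<xi> \<bullet> h = 0" by (rule DERIV_local_min)
  then have "h \<bullet> h = 0" by (simp add: h_def inner_diff_right inner_diff_left inner_commute)
  then show ?thesis by (simp add: h_def)
qed

section \<open>The least squares problem\<close>

text \<open>Tychonoff's theorem for the topology of the function type. Fitted vectors are total
  functions on \<open>nat\<close>, so every index has to be given a compact factor.\<close>

lemma compact_Pi_UNIV:
  fixes A :: "'i \<Rightarrow> 'b::topological_space set"
  assumes "\<And>i. compact (A i)"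
  shows "compact {z. \<forall>i. z i \<in> A i}"
proof -
  have "{z. \<forall>i. z i \<in> A i} = PiE UNIV A" by (auto simp: PiE_def Pi_def)
  then show ?thesis
    using assms compactin_PiE[of "\<lambda>i::'i. euclidean :: 'b topology" UNIV A]
    by (simp add: compactin_euclidean_iff euclidean_product_topology)
qed

lemma convex_interpolable_jensen:
  assumes z: "z \<in> convex_interpolable S n x" and j: "j \<in> {1..n}"
    and \<theta>: "(\<Sum>k=1..n. \<theta> k) = 1" "(\<Sum>k=1..n. \<theta> k *\<^sub>R x k) = x j" "\<forall>k\<in>{1..n}. 0 \<le> \<theta> k"
  shows "z j \<le> (\<Sum>k=1..n. \<theta> k * z k)"
proof -
  obtain \<psi> where \<psi>: "convex_on S \<psi>" "\<And>k. k \<in> {1..n} \<Longrightarrow> x k \<in> S \<and> \<psi> (x k) = z k"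
    using z by (auto simp: convex_interpolable_def)
  have "\<psi> (\<Sum>k=1..n. \<theta> k *\<^sub>R x k) \<le> (\<Sum>k=1..n. \<theta> k * \<psi> (x k))"
    using \<psi> \<theta> j by (intro convex_on_sum[of _ S]) auto
  also have "\<dots> = (\<Sum>k=1..n. \<theta> k * z k)" using \<psi> by (intro sum.cong) auto
  finally show ?thesis using \<theta>(2) \<psi>(2)[OF j] by simp
qed

text \<open>
  Farkas' lemma: the cone below is closed because it is finitely generated, and the Jensen
  inequality at \<open>x j\<close> says that it does not contain \<open>(0, -1)\<close>.
\<close>

lemma jensen_imp_subgradient:
  fixes x :: "nat \<Rightarrow> 'a::euclidean_space"
  assumes jensen: "\<And>\<theta>. (\<Sum>k=1..n. \<theta> k) = 1 \<Longrightarrow> (\<Sum>k=1..n. \<theta> k *\<^sub>R x k) = x j \<Longrightarrow>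
      \<forall>k\<in>{1..n}. 0 \<le> \<theta> k \<Longrightarrow> z j \<le> (\<Sum>k=1..n. \<theta> k * z k)"
  shows "\<exists>\<xi>. \<forall>k\<in>{1..n}. z j + \<xi> \<bullet> (x k - x j) \<le> z k"
proof -
  \<comment> \<open>The vector \<open>(0, 1)\<close> adds the upward direction; the others are the
    data points seen from point \<open>j\<close>.\<close>
  define G where "G = insert (0, 1) ((\<lambda>k. (x k - x j, z k - z j)) ` {1..n})"
  define C where "C = convex_cone hull G"
  \<comment> \<open>An explicit superset of the hull, on which Jensen's inequality can refute
    membership of \<open>(0, -1)\<close>.\<close>
  define D where "D = {(a, b) | a b. \<exists>c. (\<forall>k. 0 \<le> c k) \<and> a = (\<Sum>k=1..n. c k *\<^sub>R (x k - x j)) \<and>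
      b \<ge> (\<Sum>k=1..n. c k * (z k - z j))}"
  have "convex_cone D"
    unfolding convex_cone_iff
  proof (intro conjI ballI allI impI)
    show "0 \<in> D" unfolding D_def by (auto simp: zero_prod_def intro!: exI[of _ "\<lambda>_. 0"])
  next
    fix p q assume "p \<in> D" "q \<in> D"
    then obtain c c' where c: "\<forall>k. 0 \<le> c k" "fst p = (\<Sum>k=1..n. c k *\<^sub>R (x k - x j))" "snd p \<ge> (\<Sum>k=1..n. c k * (z k - z j))"
      "\<forall>k. 0 \<le> c' k" "fst q = (\<Sum>k=1..n. c' k *\<^sub>R (x k - x j))" "snd q \<ge> (\<Sum>k=1..n. c' k * (z k - z j))"
      unfolding D_def by force
    have "fst (p + q) = (\<Sum>k=1..n. (c k + c' k) *\<^sub>R (x k - x j))"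
      using c by (simp add: scaleR_left_distrib sum.distrib)
    moreover have "snd (p + q) \<ge> (\<Sum>k=1..n. (c k + c' k) * (z k - z j))"
      using c by (simp add: distrib_right sum.distrib)
    ultimately show "p + q \<in> D"
      unfolding D_def using c by (auto intro!: exI[of _ "\<lambda>k. c k + c' k"] simp: prod_eq_iff)
  next
    fix p and r :: real assume "p \<in> D" "0 \<le> r"
    then obtain c where c: "\<forall>k. 0 \<le> c k" "fst p = (\<Sum>k=1..n. c k *\<^sub>R (x k - x j))" "snd p \<ge> (\<Sum>k=1..n. c k * (z k - z j))"
      unfolding D_def by force
    have "fst (r *\<^sub>R p) = (\<Sum>k=1..n. (r * c k) *\<^sub>R (x k - x j))"
      using c by (simp add: scaleR_sum_right)
    moreover have "snd (r *\<^sub>R p) \<ge> (\<Sum>k=1..n. (r * c k) * (z k - z j))"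
      using mult_left_mono[OF c(3) \<open>0 \<le> r\<close>] by (simp add: sum_distrib_left mult.assoc)
    ultimately show "r *\<^sub>R p \<in> D"
      unfolding D_def using c \<open>0 \<le> r\<close> by (auto intro!: exI[of _ "\<lambda>k. r * c k"] simp: prod_eq_iff)
  qed
  moreover have "G \<subseteq> D"
  proof
    fix p assume "p \<in> G"
    then consider "p = (0, 1)" | k where "k \<in> {1..n}" "p = (x k - x j, z k - z j)" by (auto simp: G_def)
    then show "p \<in> D"
    proof cases
      case 1
      then show ?thesis unfolding D_def by (auto intro!: exI[of _ "\<lambda>_. 0"])
    next
      case 2
      then show ?thesis unfolding D_def
        by (auto intro!: exI[of _ "\<lambda>i. if i = k then 1 else 0"] simp: if_distrib[of "\<lambda>c. c *\<^sub>R _"] if_distrib[of "\<lambda>c. c * _"] cong: if_cong)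
    qed
  qed
  ultimately have CD: "C \<subseteq> D" unfolding C_def by (intro hull_minimal) auto
  have "(0, -1) \<notin> D"
  proof
    assume "(0, -1) \<in> D"
    then obtain c where c: "\<forall>k. 0 \<le> c k" "0 = (\<Sum>k=1..n. c k *\<^sub>R (x k - x j))" "-1 \<ge> (\<Sum>k=1..n. c k * (z k - z j))"
      by (auto simp: D_def)
    \<comment> \<open>Dividing by the total weight turns the coefficients into convex weights with
      barycentre \<open>x j\<close>; \<open>T = 0\<close> would make the second component at least 0
      instead of -1.\<close>
    define T where "T = (\<Sum>k=1..n. c k)"
    have "T \<noteq> 0"
    proof
      assume "T = 0"
      then have "c k = 0" if "k \<in> {1..n}" for k
        using c(1) that sum_nonneg_eq_0_iff[of "{1..n}" c] by (simp add: T_def)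
      then show False using c(3) by simp
    qed
    moreover have "T \<ge> 0" using c(1) by (simp add: T_def sum_nonneg)
    ultimately have T: "T > 0" by simp
    have "(\<Sum>k=1..n. c k *\<^sub>R x k) = T *\<^sub>R x j"
      using c(2) by (simp add: scaleR_right_diff_distrib sum_subtractf T_def scaleR_left.sum)
    moreover have "(\<Sum>k=1..n. (c k / T) *\<^sub>R x k) = (1 / T) *\<^sub>R (\<Sum>k=1..n. c k *\<^sub>R x k)"
      by (simp add: scaleR_sum_right)
    ultimately have "(\<Sum>k=1..n. (c k / T) *\<^sub>R x k) = x j"
      using T by simp
    then have "z j \<le> (\<Sum>k=1..n. c k / T * z k)"
      using c(1) T by (intro jensen) (auto simp: T_def simp flip: sum_divide_distrib)
    also have "\<dots> = (\<Sum>k=1..n. c k * z k) / T" by (simp add: sum_divide_distrib)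
    finally have "T * z j \<le> (\<Sum>k=1..n. c k * z k)" using T by (simp add: field_simps)
    moreover have "(\<Sum>k=1..n. c k * (z k - z j)) = (\<Sum>k=1..n. c k * z k) - T * z j"
      by (simp add: right_diff_distrib sum_subtractf T_def sum_distrib_right)
    ultimately show False using c(3) by simp
  qed
  with CD have "(0, -1) \<notin> C" by auto
  moreover have "closed C" "convex C"
    by (simp_all add: C_def G_def closed_convex_cone_hull convex_convex_cone_hull)
  ultimately obtain a b where ab: "a \<bullet> (0, -1) < b" "\<And>v. v \<in> C \<Longrightarrow> a \<bullet> v > b"
    using separating_hyperplane_closed_point by metis
  \<comment> \<open>A linear functional bounded below on a cone is nonnegative there: a negative
    value could be scaled to exactly \<open>b\<close>.\<close>
  have nonneg: "a \<bullet> v \<ge> 0" if v: "v \<in> C" for v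
  proof (rule ccontr)
    assume neg: "\<not> a \<bullet> v \<ge> 0"
    have "(b / (a \<bullet> v)) *\<^sub>R v \<in> C" if "b \<le> 0"
      using v neg that unfolding C_def by (intro convex_cone_hull_mul) (auto simp: divide_nonpos_neg)
    moreover have "b < 0" using ab(2)[of 0] by (simp add: C_def convex_cone_hull_contains_0)
    ultimately have "a \<bullet> ((b / (a \<bullet> v)) *\<^sub>R v) > b" by (intro ab) auto
    then show False using neg by simp
  qed
  have b: "b < 0" using ab(2)[of 0] by (simp add: C_def convex_cone_hull_contains_0)
  obtain a1 a2 where a: "a = (a1, a2)" by (cases a)
  \<comment> \<open>At \<open>(0, -1)\<close> the functional is \<open>- a2\<close>, which lies
    below the negative \<open>b\<close>. Dividing by this vertical component of the normal gives the
    slope.\<close>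
  have a2: "a2 > 0" using ab(1) b by (simp add: a)
  have "z j + (- (1 / a2) *\<^sub>R a1) \<bullet> (x k - x j) \<le> z k" if "k \<in> {1..n}" for k
  proof -
    have "(x k - x j, z k - z j) \<in> C" using that unfolding C_def G_def by (intro hull_inc) auto
    from nonneg[OF this] have "0 \<le> a1 \<bullet> (x k - x j) + a2 * (z k - z j)" by (simp add: a)
    then have "0 \<le> (a1 \<bullet> (x k - x j) + a2 * (z k - z j)) / a2" using a2 by simp
    then show ?thesis using a2 by (simp add: add_divide_distrib)
  qed
  then show ?thesis by blast
qed

text \<open>The maximum of the supporting affine functions is convex, and the inequalities say that
  at \<open>x k\<close> it is attained by the function of index \<open>k\<close>, with value
  \<open>z k\<close>.\<close>

lemma subgradients_imp_convex_interpolable: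
  fixes x :: "nat \<Rightarrow> 'a::euclidean_space"
  assumes S: "convex S" "\<forall>k\<in>{1..n}. x k \<in> S" and z: "z \<in> {1..n} \<rightarrow>\<^sub>E UNIV"
    and \<xi>: "\<forall>j\<in>{1..n}. \<forall>k\<in>{1..n}. z j + \<xi> j \<bullet> (x k - x j) \<le> z k"
  shows "z \<in> convex_interpolable S n x"
\<comment> \<open>\<open>Max\<close> of the empty set is unspecified, so \<open>n = 0\<close> is
  treated apart.\<close>
proof (cases "n = 0")
  case True
  then show ?thesis
    using z S by (auto simp: convex_interpolable_def simp: convex_on_const intro!: exI[of _ "\<lambda>_. 0"])
next
  case False
  define \<psi> where "\<psi> s = (MAX j\<in>{1..n}. z j + \<xi> j \<bullet> (s - x j))" for s
  have ge: "z j + \<xi> j \<bullet> (s - x j) \<le> \<psi> s" if "j \<in> {1..n}" for j s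
    unfolding \<psi>_def using that by (intro Max_ge) auto
  have le: "\<psi> s \<le> c" if "\<And>j. j \<in> {1..n} \<Longrightarrow> z j + \<xi> j \<bullet> (s - x j) \<le> c" for s c
    unfolding \<psi>_def using that False by (subst Max_le_iff) auto
  have "convex_on S \<psi>"
    unfolding convex_on_def
  proof (intro conjI S ballI allI impI le)
    fix s t and u v :: real and j assume uv: "0 \<le> u" "0 \<le> v" "u + v = 1" and j: "j \<in> {1..n}"
    have "z j + \<xi> j \<bullet> (u *\<^sub>R s + v *\<^sub>R t - x j)
        = (u + v) * z j + \<xi> j \<bullet> (u *\<^sub>R s + v *\<^sub>R t - (u + v) *\<^sub>R x j)"
      using uv by simp
    also have "\<dots> = u * (z j + \<xi> j \<bullet> (s - x j)) + v * (z j + \<xi> j \<bullet> (t - x j))"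
      by (simp only: inner_add_right inner_diff_right inner_scaleR_right) (simp add: algebra_simps)
    also have "\<dots> \<le> u * \<psi> s + v * \<psi> t"
      using uv j ge by (intro add_mono mult_left_mono) auto
    finally show "z j + \<xi> j \<bullet> (u *\<^sub>R s + v *\<^sub>R t - x j) \<le> u * \<psi> s + v * \<psi> t" .
  qed
  moreover have "\<psi> (x k) = z k" if "k \<in> {1..n}" for k
    using ge[OF that, of "x k"] that \<xi> by (intro antisym le) auto
  ultimately show ?thesis using z S by (auto simp: convex_interpolable_def)
qed

text \<open>Freed from the quantifier over functions, feasibility for a fixed design is an
  intersection of closed half-spaces in \<open>z\<close>; this makes least squares a minimisation
  over a compact set.\<close>

lemma convex_interpolable_iff_jensen:
  fixes x :: "nat \<Rightarrow> 'a::euclidean_space"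
  assumes "convex S" "\<forall>k\<in>{1..n}. x k \<in> S"
  shows "z \<in> convex_interpolable S n x \<longleftrightarrow> z \<in> {1..n} \<rightarrow>\<^sub>E UNIV \<and>
    (\<forall>j\<in>{1..n}. \<forall>\<theta>. (\<Sum>k=1..n. \<theta> k) = 1 \<longrightarrow> (\<Sum>k=1..n. \<theta> k *\<^sub>R x k) = x j \<longrightarrow>
      (\<forall>k\<in>{1..n}. 0 \<le> \<theta> k) \<longrightarrow> z j \<le> (\<Sum>k=1..n. \<theta> k * z k))" (is "_ \<longleftrightarrow> ?z \<and> ?J")
proof
  assume "z \<in> convex_interpolable S n x"
  then show "?z \<and> ?J"
    using convex_interpolable_jensen[of z S n x] by (auto simp: convex_interpolable_def)
next
  assume *: "?z \<and> ?J"
  have "\<exists>\<xi>. \<forall>k\<in>{1..n}. z j + \<xi> \<bullet> (x k - x j) \<le> z k" if "j \<in> {1..n}" for j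
    by (rule jensen_imp_subgradient) (use * that in blast)
  then obtain \<xi> where "\<forall>j\<in>{1..n}. \<forall>k\<in>{1..n}. z j + \<xi> j \<bullet> (x k - x j) \<le> z k" by metis
  then show "z \<in> convex_interpolable S n x"
    using * assms by (intro subgradients_imp_convex_interpolable) auto
qed

text \<open>The slopes are a finite dimensional witness of feasibility, and their inequalities are
  jointly continuous in design, values and slopes; the measurability proof rests on this
  form.\<close>

lemma convex_interpolable_iff_subgradients:
  fixes x :: "nat \<Rightarrow> 'a::euclidean_space"
  assumes "convex S" "\<forall>k\<in>{1..n}. x k \<in> S"
  shows "z \<in> convex_interpolable S n x \<longleftrightarrow> z \<in> {1..n} \<rightarrow>\<^sub>E UNIV \<and>
    (\<exists>\<xi>. \<forall>j\<in>{1..n}. \<forall>k\<in>{1..n}. z j + \<xi> j \<bullet> (x k - x j) \<le> z k)"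
proof
  assume z: "z \<in> convex_interpolable S n x"
  have "\<exists>\<xi>. \<forall>k\<in>{1..n}. z j + \<xi> \<bullet> (x k - x j) \<le> z k" if "j \<in> {1..n}" for j
    by (rule jensen_imp_subgradient) (use z that convex_interpolable_jensen in blast)
  then have "\<exists>\<xi>. \<forall>j\<in>{1..n}. \<forall>k\<in>{1..n}. z j + \<xi> j \<bullet> (x k - x j) \<le> z k" by metis
  then show "z \<in> {1..n} \<rightarrow>\<^sub>E UNIV \<and> (\<exists>\<xi>. \<forall>j\<in>{1..n}. \<forall>k\<in>{1..n}. z j + \<xi> j \<bullet> (x k - x j) \<le> z k)"
    using z by (auto simp: convex_interpolable_def)
qed (use assms subgradients_imp_convex_interpolable in blast)

section \<open>Existence and uniqueness of the fitted vector\<close>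

lemma convex_interpolable_midpoint:
  assumes "z \<in> convex_interpolable S n x" "w \<in> convex_interpolable S n x"
  shows "(\<lambda>k\<in>{1..n}. (z k + w k) / 2) \<in> convex_interpolable S n x"
proof -
  obtain \<psi> \<psi>' where \<psi>: "convex_on S \<psi>" "\<forall>j\<in>{1..n}. x j \<in> S \<and> \<psi> (x j) = z j"
    and \<psi>': "convex_on S \<psi>'" "\<forall>j\<in>{1..n}. x j \<in> S \<and> \<psi>' (x j) = w j"
    using assms by (auto simp: convex_interpolable_def)
  have "convex_on S (\<lambda>s. (1/2) * (\<psi> s + \<psi>' s))"
    using \<psi> \<psi>' by (intro convex_on_cmul convex_on_add) auto
  then show ?thesis
    using \<psi> \<psi>' by (auto simp: convex_interpolable_def intro!: exI[of _ "\<lambda>s. (1/2) * (\<psi> s + \<psi>' s)"])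
qed

text \<open>The parallelogram identity: the midpoint of two minimisers would lower the sum of
  squares by a quarter of their squared distance.\<close>

lemma convex_interpolable_minimizer_unique:
  assumes z: "z \<in> convex_interpolable S n x" and w: "w \<in> convex_interpolable S n x"
    and min: "\<And>u. u \<in> convex_interpolable S n x \<Longrightarrow> (\<Sum>k=1..n. \<bar>y k - z k\<bar>\<^sup>2) \<le> (\<Sum>k=1..n. \<bar>y k - u k\<bar>\<^sup>2)"
    and le: "(\<Sum>k=1..n. \<bar>y k - w k\<bar>\<^sup>2) \<le> (\<Sum>k=1..n. \<bar>y k - z k\<bar>\<^sup>2)"
  shows "w = z"
proof -
  have "(\<Sum>k=1..n. \<bar>y k - z k\<bar>\<^sup>2) \<le> (\<Sum>k=1..n. \<bar>y k - (\<lambda>k\<in>{1..n}. (z k + w k) / 2) k\<bar>\<^sup>2)"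
    using z w by (intro min convex_interpolable_midpoint)
  also have "\<dots> = (\<Sum>k=1..n. (1/2) * \<bar>y k - z k\<bar>\<^sup>2 + (1/2) * \<bar>y k - w k\<bar>\<^sup>2 - (1/4) * (z k - w k)\<^sup>2)"
    by (intro sum.cong) (auto simp: power2_eq_square field_simps)
  also have "\<dots> = (1/2) * (\<Sum>k=1..n. \<bar>y k - z k\<bar>\<^sup>2) + (1/2) * (\<Sum>k=1..n. \<bar>y k - w k\<bar>\<^sup>2)
      - (1/4) * (\<Sum>k=1..n. (z k - w k)\<^sup>2)"
    by (simp only: sum.distrib sum_subtractf sum_distrib_left)
  finally have "(\<Sum>k=1..n. (z k - w k)\<^sup>2) \<le> 0" using le by linarith
  then have "(\<Sum>k=1..n. (z k - w k)\<^sup>2) = 0" by (intro antisym sum_nonneg) auto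
  then have "z k = w k" if "k \<in> {1..n}" for k
    using that by (subst (asm) sum_nonneg_eq_0_iff) auto
  moreover have "z \<in> {1..n} \<rightarrow>\<^sub>E UNIV" "w \<in> {1..n} \<rightarrow>\<^sub>E UNIV"
    using z w by (auto simp: convex_interpolable_def)
  ultimately show ?thesis by (intro PiE_ext[of _ "{1..n}" "\<lambda>_. UNIV"]) auto
qed

text \<open>Competitors no worse than the zero vector \<open>z0\<close> have coordinates within
  \<open>sqrt (q z0)\<close> of the observations, so the search is confined to a compact
  product.\<close>

lemma convex_interpolable_minimizer_exists:
  fixes x :: "nat \<Rightarrow> 'a::euclidean_space"
  assumes S: "convex S" "\<forall>k\<in>{1..n}. x k \<in> S"
  shows "\<exists>z\<in>convex_interpolable S n x. \<forall>u\<in>convex_interpolable S n x.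
    (\<Sum>k=1..n. \<bar>y k - z k\<bar>\<^sup>2) \<le> (\<Sum>k=1..n. \<bar>y k - u k\<bar>\<^sup>2)"
proof -
  define q where "q z = (\<Sum>k=1..n. \<bar>y k - z k\<bar>\<^sup>2)" for z
  define z0 :: "nat \<Rightarrow> real" where "z0 = (\<lambda>k\<in>{1..n}. 0)"
  have z0: "z0 \<in> convex_interpolable S n x"
    using S by (auto simp: convex_interpolable_def z0_def simp: convex_on_const intro!: exI[of _ "\<lambda>_. 0"])
  \<comment> \<open>Indices outside of \<open>{1..n}\<close> are pinned to \<open>undefined\<close>,
    the value of extensional functions there, which keeps every factor compact.\<close>
  define A where "A k = (if k \<in> {1..n} then cball (y k) (sqrt (q z0)) else {undefined})" for k
  define B where "B = {z. \<forall>k. z k \<in> A k} \<inter> (\<Inter>j\<in>{1..n}.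
    \<Inter>\<theta>\<in>{\<theta>. (\<Sum>k=1..n. \<theta> k) = 1 \<and> (\<Sum>k=1..n. \<theta> k *\<^sub>R x k) = x j \<and> (\<forall>k\<in>{1..n}. 0 \<le> \<theta> k)}.
      {z. z j \<le> (\<Sum>k=1..n. \<theta> k * z k)})"
  have in_B: "u \<in> B" if u: "u \<in> convex_interpolable S n x" "q u \<le> q z0" for u
  proof -
    have "u k \<in> A k" for k
    proof (cases "k \<in> {1..n}")
      case True
      have "(y k - u k)\<^sup>2 \<le> q u" 
        using True member_le_sum[of k "{1..n}" "\<lambda>k. \<bar>y k - u k\<bar>\<^sup>2"] by (simp add: q_def)
      then have "\<bar>y k - u k\<bar> \<le> sqrt (q z0)" using u(2) by (intro real_le_rsqrt) auto
      then show ?thesis using True by (simp add: A_def dist_real_def)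
    qed (use u in \<open>auto simp: A_def convex_interpolable_def\<close>)
    then show ?thesis
      using u convex_interpolable_iff_jensen[OF S] by (auto simp: B_def)
  qed
  have B_sub: "u \<in> convex_interpolable S n x" if "u \<in> B" for u
  proof -
    have "u k = undefined" if "k \<notin> {1..n}" for k
      using \<open>u \<in> B\<close> that by (auto simp: B_def A_def split: if_splits)
    then show ?thesis
      using \<open>u \<in> B\<close> unfolding convex_interpolable_iff_jensen[OF S] by (auto simp: B_def)
  qed
  have "compact B"
    unfolding B_def
    by (intro compact_Int_closed compact_Pi_UNIV closed_INT ballI closed_Collect_le continuous_intros)
      (auto simp: A_def)
  moreover have "B \<noteq> {}" using in_B[OF z0] by auto
  moreover have "continuous_on B q"
    unfolding q_def by (intro continuous_intros continuous_on_subset[OF continuous_on_product_coordinates]) auto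
  ultimately obtain z where z: "z \<in> B" "\<And>u. u \<in> B \<Longrightarrow> q z \<le> q u"
    using continuous_attains_inf by metis
  have "q z \<le> q u" if "u \<in> convex_interpolable S n x" for u
    using z(2)[OF in_B[OF that]] z(2)[OF in_B[OF z0]] by (cases "q u \<le> q z0") auto
  with z B_sub show ?thesis unfolding q_def by blast
qed

lemma lse_vector:
  fixes x :: "nat \<Rightarrow> 'a::euclidean_space"
  assumes S: "convex S" "\<forall>k\<in>{1..n}. x k \<in> S"
  shows lse_vector_in: "lse_vector S n x y \<in> convex_interpolable S n x"
    and lse_vector_min: "\<And>u. u \<in> convex_interpolable S n x \<Longrightarrow>
      (\<Sum>k=1..n. \<bar>y k - lse_vector S n x y k\<bar>\<^sup>2) \<le> (\<Sum>k=1..n. \<bar>y k - u k\<bar>\<^sup>2)"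
proof -
  obtain z where z: "z \<in> convex_interpolable S n x"
    "\<And>u. u \<in> convex_interpolable S n x \<Longrightarrow> (\<Sum>k=1..n. \<bar>y k - z k\<bar>\<^sup>2) \<le> (\<Sum>k=1..n. \<bar>y k - u k\<bar>\<^sup>2)"
    using convex_interpolable_minimizer_exists[OF S] by blast
  have "lse_vector S n x y = z"
    unfolding lse_vector_def
  proof (rule the_equality)
    show "is_arg_min (\<lambda>z. \<Sum>k=1..n. \<bar>y k - z k\<bar>\<^sup>2) (\<lambda>z. z \<in> convex_interpolable S n x) z"
      using z by (auto simp: is_arg_min_linorder)
    fix w assume "is_arg_min (\<lambda>z. \<Sum>k=1..n. \<bar>y k - z k\<bar>\<^sup>2) (\<lambda>z. z \<in> convex_interpolable S n x) w"
    then show "w = z"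
      using z by (intro convex_interpolable_minimizer_unique[OF z(1) _ z(2)]) (auto simp: is_arg_min_linorder)
  qed
  with z show "lse_vector S n x y \<in> convex_interpolable S n x"
    "\<And>u. u \<in> convex_interpolable S n x \<Longrightarrow>
      (\<Sum>k=1..n. \<bar>y k - lse_vector S n x y k\<bar>\<^sup>2) \<le> (\<Sum>k=1..n. \<bar>y k - u k\<bar>\<^sup>2)"
    by auto
qed

section \<open>The estimator as a convex function through the fitted values\<close>

lemma convex_lse_le:
  assumes "(\<Sum>k=1..n. \<theta> k) = 1" "(\<Sum>k=1..n. \<theta> k *\<^sub>R x k) = t" "\<forall>k\<in>{1..n}. 0 \<le> \<theta> k"
  shows "convex_lse S n x y t \<le> ereal (\<Sum>k=1..n. \<theta> k * lse_vector S n x y k)"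
  unfolding convex_lse_def using assms by (intro Inf_lower) auto

lemma convex_lse_less_iff:
  "convex_lse S n x y t < c \<longleftrightarrow> (\<exists>\<theta>. (\<Sum>k=1..n. \<theta> k) = 1 \<and> (\<Sum>k=1..n. \<theta> k *\<^sub>R x k) = t \<and>
     (\<forall>k\<in>{1..n}. 0 \<le> \<theta> k) \<and> ereal (\<Sum>k=1..n. \<theta> k * lse_vector S n x y k) < c)"
  unfolding convex_lse_def by (auto simp: Inf_less_iff)

text \<open>Convex weights lie between 0 and 1; the crude bound serves to exclude the value
  -\<infinity>.\<close>

lemma convex_lse_ge: "ereal (- (\<Sum>k=1..n. \<bar>lse_vector S n x y k\<bar>)) \<le> convex_lse S n x y t"
  unfolding convex_lse_def
proof (rule Inf_greatest, clarify)
  let ?z = "lse_vector S n x y"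
  fix \<theta> :: "nat \<Rightarrow> real" assume \<theta>: "(\<Sum>k=1..n. \<theta> k) = 1" "\<forall>k\<in>{1..n}. 0 \<le> \<theta> k"
  have "- \<bar>?z k\<bar> \<le> \<theta> k * ?z k" if "k \<in> {1..n}" for k
  proof -
    have "\<theta> k \<le> 1" using \<theta> that member_le_sum[of k "{1..n}" \<theta>] by auto
    then have "\<bar>\<theta> k * ?z k\<bar> \<le> 1 * \<bar>?z k\<bar>"
      unfolding abs_mult using \<theta> that by (intro mult_right_mono) auto
    then show ?thesis by linarith
  qed
  then have "(\<Sum>k=1..n. - \<bar>?z k\<bar>) \<le> (\<Sum>k=1..n. \<theta> k * ?z k)" by (intro sum_mono) auto
  then show "ereal (- (\<Sum>k=1..n. \<bar>?z k\<bar>)) \<le> ereal (\<Sum>k=1..n. \<theta> k * ?z k)" by (simp add: sum_negf)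
qed

text \<open>Mixing nearly optimal weights for \<open>s\<close> and \<open>t\<close> gives admissible
  weights at the mixed point; the margin \<open>e\<close> stands in for optimal weights.\<close>

lemma proper_convex_convex_lse: "proper_convex (convex_lse S n x y)"
  unfolding proper_convex_def
proof (intro conjI allI impI)
  let ?z = "lse_vector S n x y" and ?F = "convex_lse S n x y"
  show nm: "?F t \<noteq> - \<infinity>" for t
    using convex_lse_ge[where S = S and n = n and x = x and y = y and t = t] by auto
  fix s t and u v :: real assume uv: "0 \<le> u \<and> 0 \<le> v \<and> u + v = 1"
  show "?F (u *\<^sub>R s + v *\<^sub>R t) \<le> ereal u * ?F s + ereal v * ?F t"
  \<comment> \<open>Degenerate weights and infinite values are settled by the conventions of
    \<open>ereal\<close>, in particular that 0 times \<infinity> is 0.\<close>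
  proof (cases "u = 0 \<or> v = 0 \<or> ?F s = \<infinity> \<or> ?F t = \<infinity>")
    case True
    then show ?thesis using uv nm[of s] nm[of t]
      by (cases "?F s"; cases "?F t") (auto simp flip: zero_ereal_def one_ereal_def)
  next
    case False
    then obtain a b where ab: "?F s = ereal a" "?F t = ereal b"
      using nm[of s] nm[of t] by (cases "?F s"; cases "?F t") auto
    have "?F (u *\<^sub>R s + v *\<^sub>R t) \<le> ereal (u * a + v * b) + ereal e" if "e > 0" for e
    proof -
      obtain \<theta> where \<theta>: "(\<Sum>k=1..n. \<theta> k) = 1" "(\<Sum>k=1..n. \<theta> k *\<^sub>R x k) = s"
        "\<forall>k\<in>{1..n}. 0 \<le> \<theta> k" "(\<Sum>k=1..n. \<theta> k * ?z k) < a + e"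
        using convex_lse_less_iff[of S n x y s "ereal (a + e)"] ab \<open>e > 0\<close> by auto
      obtain \<theta>' where \<theta>': "(\<Sum>k=1..n. \<theta>' k) = 1" "(\<Sum>k=1..n. \<theta>' k *\<^sub>R x k) = t"
        "\<forall>k\<in>{1..n}. 0 \<le> \<theta>' k" "(\<Sum>k=1..n. \<theta>' k * ?z k) < b + e"
        using convex_lse_less_iff[of S n x y t "ereal (b + e)"] ab \<open>e > 0\<close> by auto
      have sums: "(\<Sum>k=1..n. u * \<theta> k + v * \<theta>' k) = 1"
        "(\<Sum>k=1..n. (u * \<theta> k + v * \<theta>' k) *\<^sub>R x k) = u *\<^sub>R s + v *\<^sub>R t"
        "(\<Sum>k=1..n. (u * \<theta> k + v * \<theta>' k) * ?z k) = u * (\<Sum>k=1..n. \<theta> k * ?z k) + v * (\<Sum>k=1..n. \<theta>' k * ?z k)"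
        using \<theta>(1) \<theta>'(1) uv unfolding \<theta>(2)[symmetric] \<theta>'(2)[symmetric]
        by (simp_all add: sum.distrib scaleR_left_distrib distrib_right scaleR_sum_right sum_distrib_left mult.assoc
            flip: sum_distrib_left[of u \<theta>] sum_distrib_left[of v \<theta>'])
      have "?F (u *\<^sub>R s + v *\<^sub>R t) \<le> ereal (\<Sum>k=1..n. (u * \<theta> k + v * \<theta>' k) * ?z k)"
        using \<theta>(3) \<theta>'(3) uv by (intro convex_lse_le sums) auto
      also have "\<dots> \<le> ereal (u * (a + e) + v * (b + e))"
        unfolding sums(3) using \<theta>(4) \<theta>'(4) uv by (auto intro!: add_mono mult_left_mono)
      also have "u * (a + e) + v * (b + e) = u * a + v * b + (u + v) * e" by (simp add: algebra_simps)
      finally show ?thesis using uv by simp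
    qed
    then show ?thesis using ab by (auto intro: ereal_le_epsilon2)
  qed
qed

text \<open>Jensen's inequality for the fitted vector gives the lower bound, a unit weight at
  \<open>j\<close> the upper one. Residuals thus become differences of function values at design
  points.\<close>

lemma convex_lse_design_point:
  fixes x :: "nat \<Rightarrow> 'a::euclidean_space"
  assumes S: "convex S" "\<forall>k\<in>{1..n}. x k \<in> S" and j: "j \<in> {1..n}"
  shows "convex_lse S n x y (x j) = ereal (lse_vector S n x y j)"
proof (rule antisym)
  show "ereal (lse_vector S n x y j) \<le> convex_lse S n x y (x j)"
    unfolding convex_lse_def
  proof (rule Inf_greatest, clarify)
    fix \<theta> :: "nat \<Rightarrow> real"
    assume "(\<Sum>k=1..n. \<theta> k) = 1" "(\<Sum>k=1..n. \<theta> k *\<^sub>R x k) = x j" "\<forall>k\<in>{1..n}. 0 \<le> \<theta> k"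
    then show "ereal (lse_vector S n x y j) \<le> ereal (\<Sum>k=1..n. \<theta> k * lse_vector S n x y k)"
      using convex_interpolable_jensen[OF lse_vector_in[OF S] j] by simp
  qed
  have "convex_lse S n x y (x j) \<le> ereal (\<Sum>k=1..n. (if k = j then 1 else 0) * lse_vector S n x y k)"
    using j by (intro convex_lse_le) (auto simp: if_distrib[of "\<lambda>c. c *\<^sub>R _"] cong: if_cong)
  then show "convex_lse S n x y (x j) \<le> ereal (lse_vector S n x y j)"
    using j by (simp add: if_distrib[of "\<lambda>c. c * _"] cong: if_cong)
qed

lemma lse_vector_basic_inequality:
  fixes x :: "nat \<Rightarrow> 'a::euclidean_space"
  assumes S: "convex S" "\<forall>k\<in>{1..n}. x k \<in> S" and g: "convex_on S g"
    and y: "\<And>k. k \<in> {1..n} \<Longrightarrow> y k = g (x k) + e k"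
  shows "(\<Sum>k=1..n. (lse_vector S n x y k - g (x k))\<^sup>2)
    \<le> 2 * (\<Sum>k=1..n. e k * (lse_vector S n x y k - g (x k)))"
proof -
  let ?z = "lse_vector S n x y"
  have "(\<lambda>k\<in>{1..n}. g (x k)) \<in> convex_interpolable S n x"
    using S g by (auto simp: convex_interpolable_def)
  from lse_vector_min[OF S this, of y]
  have "(\<Sum>k=1..n. \<bar>y k - ?z k\<bar>\<^sup>2) \<le> (\<Sum>k=1..n. \<bar>y k - g (x k)\<bar>\<^sup>2)" by simp
  moreover have "(\<Sum>k=1..n. \<bar>y k - ?z k\<bar>\<^sup>2) = (\<Sum>k=1..n. \<bar>y k - g (x k)\<bar>\<^sup>2
      - 2 * (e k * (?z k - g (x k))) + (?z k - g (x k))\<^sup>2)"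
    by (intro sum.cong) (auto simp: y power2_eq_square algebra_simps)
  ultimately show ?thesis
    by (simp add: sum.distrib sum_subtractf sum_distrib_left)
qed

section \<open>Measurability of the estimator\<close>

text \<open>Witnesses in a compact set converge along a subsequence. Existential quantifiers over
  compact sets therefore keep closedness, which spares a measurable selection of witnesses.\<close>

lemma closed_projection_compact:
  fixes F :: "('p::metric_space \<times> 'c::metric_space) set"
  assumes F: "closed F" and K: "compact K"
  shows "closed {p. \<exists>c\<in>K. (p, c) \<in> F}"
  unfolding closed_sequential_limits
proof (intro allI impI, elim conjE)
  fix p l assume p: "\<forall>n. p n \<in> {p. \<exists>c\<in>K. (p, c) \<in> F}" "p \<longlonglongrightarrow> l"
  then have "\<forall>n. \<exists>c. c \<in> K \<and> (p n, c) \<in> F" by blast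
  from choice[OF this] obtain c where c: "\<And>n. c n \<in> K" "\<And>n. (p n, c n) \<in> F" by blast
  obtain k and r :: "nat \<Rightarrow> nat" where k: "k \<in> K" "strict_mono r" "(c \<circ> r) \<longlonglongrightarrow> k"
    using K c(1) unfolding compact_def by metis
  have "(\<lambda>n. ((p \<circ> r) n, (c \<circ> r) n)) \<longlonglongrightarrow> (l, k)"
    using k(3) LIMSEQ_subseq_LIMSEQ[OF p(2) k(2)] by (rule tendsto_Pair[rotated])
  moreover have "((p \<circ> r) n, (c \<circ> r) n) \<in> F" for n using c(2) by simp
  ultimately have "(l, k) \<in> F" using closed_sequentially[OF F, of "\<lambda>n. ((p \<circ> r) n, (c \<circ> r) n)" "(l, k)"] by blast
  then show "l \<in> {p. \<exists>c\<in>K. (p, c) \<in> F}" using k(1) by blast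
qed

text \<open>
  The pairs of a design and of interpolable values do not form a closed set, but those with
  subgradients bounded by \<open>L\<close> do, and they exhaust the interpolable values as \<open>L\<close> grows.
\<close>

lemma closed_bounded_subgradients:
  fixes Z :: "nat \<Rightarrow> real set"
  assumes Z: "\<And>i. compact (Z i)" and A: "closed A"
  shows "closed {(x :: nat \<Rightarrow> 'a::euclidean_space, y, v). \<exists>z \<xi>. (\<forall>i. z i \<in> Z i) \<and> (\<forall>i. \<xi> i \<in> cball 0 L) \<and> z \<in> A \<and>
    (\<Sum>k=1..n. \<bar>y k - z k\<bar>\<^sup>2) \<le> v \<and> (\<forall>j\<in>{1..n}. \<forall>k\<in>{1..n}. z j + \<xi> j \<bullet> (x k - x j) \<le> z k)}"
    (is "closed ?S")
proof -
  define F where "F = {q :: ((nat \<Rightarrow> 'a) \<times> (nat \<Rightarrow> real) \<times> real) \<times> (nat \<Rightarrow> real) \<times> (nat \<Rightarrow> 'a).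
    (\<Sum>k=1..n. \<bar>fst (snd (fst q)) k - fst (snd q) k\<bar>\<^sup>2) \<le> snd (snd (fst q))} \<inter>
    (\<Inter>j\<in>{1..n}. \<Inter>k\<in>{1..n}. {q. fst (snd q) j + snd (snd q) j \<bullet> (fst (fst q) k - fst (fst q) j) \<le> fst (snd q) k})"
  define K where "K = ({z. \<forall>i. z i \<in> Z i} \<inter> A) \<times> {\<xi> :: nat \<Rightarrow> 'a. \<forall>i. \<xi> i \<in> cball 0 L}"
  have "closed F"
    unfolding F_def by (intro closed_Int closed_INT ballI closed_Collect_le continuous_intros
      continuous_on_product_then_coordinatewise)
  moreover have "compact K"
    unfolding K_def by (intro compact_Times compact_Int_closed compact_Pi_UNIV Z A compact_cball)
  ultimately have "closed {p. \<exists>c\<in>K. (p, c) \<in> F}" by (rule closed_projection_compact)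
  also have "{p. \<exists>c\<in>K. (p, c) \<in> F} = ?S"
    unfolding F_def K_def by (auto simp: Bex_def) blast+
  finally show ?thesis .
qed

text \<open>Weights are confined to \<open>{0..1}\<close> at all indices, also those outside of the
  sum, so that they range over a compact cube.\<close>

lemma closed_convex_combinations:
  fixes t :: "'a::euclidean_space"
  shows "closed {(x :: nat \<Rightarrow> 'a, z). \<exists>\<theta>. (\<forall>k. \<theta> k \<in> {0..1}) \<and> (\<Sum>k=1..n. \<theta> k) = 1 \<and>
    (\<Sum>k=1..n. \<theta> k *\<^sub>R x k) = t \<and> (\<Sum>k=1..n. \<theta> k * z k) \<le> c}" (is "closed ?S")
proof -
  define F where "F = {q :: ((nat \<Rightarrow> 'a) \<times> (nat \<Rightarrow> real)) \<times> (nat \<Rightarrow> real). (\<Sum>k=1..n. snd q k) = 1} \<inter>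
    {q. (\<Sum>k=1..n. snd q k *\<^sub>R fst (fst q) k) = t} \<inter> {q. (\<Sum>k=1..n. snd q k * snd (fst q) k) \<le> c}"
  have "closed F"
    unfolding F_def by (intro closed_Int closed_Collect_le closed_Collect_eq continuous_intros
      continuous_on_product_then_coordinatewise)
  moreover have "compact {\<theta> :: nat \<Rightarrow> real. \<forall>k. \<theta> k \<in> {0..1}}" by (intro compact_Pi_UNIV compact_Icc)
  ultimately have "closed {p. \<exists>c\<in>{\<theta>. \<forall>k. \<theta> k \<in> {0..1}}. (p, c) \<in> F}" by (rule closed_projection_compact)
  also have "{p. \<exists>c\<in>{\<theta>. \<forall>k. \<theta> k \<in> {0..1}}. (p, c) \<in> F} = ?S"
    unfolding F_def by auto
  finally show ?thesis .
qed

lemma convex_interpolable_cong: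
  "(\<And>k. k \<in> {1..n} \<Longrightarrow> x k = x' k) \<Longrightarrow> convex_interpolable S n x = convex_interpolable S n x'"
  unfolding convex_interpolable_def by auto

lemma lse_vector_cong:
  assumes "\<And>k. k \<in> {1..n} \<Longrightarrow> x k = x' k \<and> y k = y' k"
  shows "lse_vector S n x y = lse_vector S n x' y'"
proof -
  have "convex_interpolable S n x = convex_interpolable S n x'"
    using assms by (intro convex_interpolable_cong) auto
  moreover have "(\<lambda>z. \<Sum>k=1..n. \<bar>y k - z k\<bar>\<^sup>2) = (\<lambda>z. \<Sum>k=1..n. \<bar>y' k - z k\<bar>\<^sup>2)"
    using assms by (intro ext sum.cong) auto
  ultimately show ?thesis unfolding lse_vector_def by simp
qed

text \<open>Only the indices from 1 to \<open>n\<close> enter, so the measurability proof may reset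
  the data at index 0.\<close>

lemma convex_lse_cong:
  assumes eq: "\<And>k. k \<in> {1..n} \<Longrightarrow> x k = x' k \<and> y k = y' k"
  shows "convex_lse S n x y t = convex_lse S n x' y' t"
proof -
  have "(\<Sum>k=1..n. \<theta> k *\<^sub>R x k) = (\<Sum>k=1..n. \<theta> k *\<^sub>R x' k)" for \<theta>
    using eq by (intro sum.cong) auto
  moreover have "lse_vector S n x y = lse_vector S n x' y'" by (rule lse_vector_cong) (rule eq)
  ultimately show ?thesis unfolding convex_lse_def by simp
qed

text \<open>Finitely many values and slopes have a common bound, taken in \<open>nat\<close> so that
  the bounded cases form a countable union.\<close>

lemma exists_bounded_subgradients:
  fixes x :: "nat \<Rightarrow> 'a::euclidean_space"
  assumes S: "convex S" "\<forall>k\<in>{1..n}. x k \<in> S" and z: "z \<in> convex_interpolable S n x"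
  shows "\<exists>L::nat. \<exists>\<xi>. (\<forall>i. z i \<in> (if i \<in> {1..n} then cball 0 (real L) else {undefined})) \<and>
    (\<forall>i. \<xi> i \<in> cball 0 (real L)) \<and> (\<forall>j\<in>{1..n}. \<forall>k\<in>{1..n}. z j + \<xi> j \<bullet> (x k - x j) \<le> z k)"
proof -
  obtain \<xi> where \<xi>: "\<forall>j\<in>{1..n}. \<forall>k\<in>{1..n}. z j + \<xi> j \<bullet> (x k - x j) \<le> z k"
    using z convex_interpolable_iff_subgradients[OF S] by blast
  define \<xi>' where "\<xi>' i = (if i \<in> {1..n} then \<xi> i else 0)" for i
  obtain L where L: "(\<Sum>k=1..n. \<bar>z k\<bar>) + (\<Sum>k=1..n. norm (\<xi> k)) \<le> real L" using real_arch_simple by blast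
  have nn: "0 \<le> (\<Sum>k=1..n. \<bar>z k\<bar>)" "0 \<le> (\<Sum>k=1..n. norm (\<xi> k))" by (intro sum_nonneg; simp)+
  have zk: "\<bar>z k\<bar> \<le> real L" "norm (\<xi> k) \<le> real L" if "k \<in> {1..n}" for k
  proof -
    have "\<bar>z k\<bar> \<le> (\<Sum>k=1..n. \<bar>z k\<bar>)" by (rule member_le_sum[OF that]) auto
    then show "\<bar>z k\<bar> \<le> real L" using L nn by linarith
    have "norm (\<xi> k) \<le> (\<Sum>k=1..n. norm (\<xi> k))" by (rule member_le_sum[OF that]) auto
    then show "norm (\<xi> k) \<le> real L" using L nn by linarith
  qed
  have "z i = undefined" if "i \<notin> {1..n}" for i using z that by (auto simp: convex_interpolable_def)
  then show ?thesis
    using zk \<xi> by (intro exI[of _ L] exI[of _ \<xi>']) (auto simp: \<xi>'_def)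
qed

text \<open>There are three stages: the minimal value \<open>r\<close>, the coordinates of the fit,
  the infimum over weights. At each of them a sublevel set is, up to a trivial event, a countable
  union of preimages of closed sets. The coordinates use uniqueness: a feasible vector whose
  objective is at most \<open>r\<close> is the fit.\<close>

theorem borel_measurable_convex_lse:
  fixes S :: "'a::euclidean_space set"
  assumes S: "closed S" "convex S"
    and X: "\<And>k. k \<ge> 1 \<Longrightarrow> X k \<in> borel_measurable M" and Y: "\<And>k. k \<ge> 1 \<Longrightarrow> Y k \<in> borel_measurable M"
  shows "(\<lambda>\<omega>. convex_lse S n (\<lambda>k. X k \<omega>) (\<lambda>k. Y k \<omega>) t) \<in> borel_measurable M"
proof -
  define x where "x \<omega> k = (if k \<ge> 1 then X k \<omega> else 0)" for \<omega> k
  define y where "y \<omega> k = (if k \<ge> 1 then Y k \<omega> else 0)" for \<omega> k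
  have xk[measurable]: "(\<lambda>\<omega>. x \<omega> k) \<in> borel_measurable M" for k
    using X[of k] by (cases "k \<ge> 1") (auto simp: x_def)
  have yk[measurable]: "(\<lambda>\<omega>. y \<omega> k) \<in> borel_measurable M" for k
    using Y[of k] by (cases "k \<ge> 1") (auto simp: y_def)
  have x[measurable]: "x \<in> borel_measurable M" by (rule measurable_coordinatewise_then_product) simp
  have y[measurable]: "y \<in> borel_measurable M" by (rule measurable_coordinatewise_then_product) simp
  \<comment> \<open>Off this event no vector is feasible, and \<open>THE\<close> denotes the same
    unspecified vector for all outcomes.\<close>
  define G where "G = {\<omega> \<in> space M. \<forall>k\<in>{1..n}. x \<omega> k \<in> S}"
  have G[measurable]: "G \<in> sets M" unfolding G_def using borel_closed[OF S(1)] by measurable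
  define r where "r \<omega> = (if \<omega> \<in> G then (\<Sum>k=1..n. \<bar>y \<omega> k - lse_vector S n (x \<omega>) (y \<omega>) k\<bar>\<^sup>2) else 0)" for \<omega>
  define Z where "Z L i = (if i \<in> {1..n} then cball (0::real) (real L) else {undefined})" for L i :: nat
  define T where "T L A = {(x :: nat \<Rightarrow> 'a, y, v). \<exists>z \<xi>. (\<forall>i. z i \<in> Z L i) \<and> (\<forall>i. \<xi> i \<in> cball 0 (real L)) \<and> z \<in> A \<and>
    (\<Sum>k=1..n. \<bar>y k - z k\<bar>\<^sup>2) \<le> v \<and> (\<forall>j\<in>{1..n}. \<forall>k\<in>{1..n}. z j + \<xi> j \<bullet> (x k - x j) \<le> z k)}" for L A
  have T_closed: "closed (T L A)" if "closed A" for L A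
    unfolding T_def using that by (intro closed_bounded_subgradients) (auto simp: Z_def)
  have xS: "\<forall>k\<in>{1..n}. x \<omega> k \<in> S" if "\<omega> \<in> G" for \<omega> using that by (simp add: G_def)
  have T_iff: "(\<exists>L. (x \<omega>, y \<omega>, v) \<in> T L A) \<longleftrightarrow> (\<exists>z\<in>convex_interpolable S n (x \<omega>). z \<in> A \<and> (\<Sum>k=1..n. \<bar>y \<omega> k - z k\<bar>\<^sup>2) \<le> v)"
    if \<omega>: "\<omega> \<in> G" for \<omega> v A
  proof
    assume "\<exists>L. (x \<omega>, y \<omega>, v) \<in> T L A"
    then obtain L z \<xi> where z: "\<forall>i. z i \<in> Z L i" "z \<in> A" "(\<Sum>k=1..n. \<bar>y \<omega> k - z k\<bar>\<^sup>2) \<le> v"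
      "\<forall>j\<in>{1..n}. \<forall>k\<in>{1..n}. z j + \<xi> j \<bullet> (x \<omega> k - x \<omega> j) \<le> z k"
      unfolding T_def by blast
    have "z i = undefined" if "i \<notin> {1..n}" for i using z(1)[rule_format, of i] that unfolding Z_def by (simp split: if_splits)
    then have "z \<in> {1..n} \<rightarrow>\<^sub>E UNIV" by (auto simp: PiE_def extensional_def)
    then have "z \<in> convex_interpolable S n (x \<omega>)"
      by (rule subgradients_imp_convex_interpolable[OF S(2) xS[OF \<omega>] _ z(4)])
    then show "\<exists>z\<in>convex_interpolable S n (x \<omega>). z \<in> A \<and> (\<Sum>k=1..n. \<bar>y \<omega> k - z k\<bar>\<^sup>2) \<le> v" using z by blast
  next
    assume "\<exists>z\<in>convex_interpolable S n (x \<omega>). z \<in> A \<and> (\<Sum>k=1..n. \<bar>y \<omega> k - z k\<bar>\<^sup>2) \<le> v"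
    then obtain z where z: "z \<in> convex_interpolable S n (x \<omega>)" "z \<in> A" "(\<Sum>k=1..n. \<bar>y \<omega> k - z k\<bar>\<^sup>2) \<le> v" by blast
    from exists_bounded_subgradients[OF S(2) xS[OF \<omega>] z(1)] z(2,3)
    show "\<exists>L. (x \<omega>, y \<omega>, v) \<in> T L A" unfolding T_def Z_def by blast
  qed
  have T_meas: "{\<omega> \<in> G. \<exists>L. (x \<omega>, y \<omega>, v \<omega>) \<in> T L A} \<in> sets M"
    if A: "closed A" and v[measurable]: "v \<in> borel_measurable M" for v :: "_ \<Rightarrow> real" and A
  proof -
    have "(\<lambda>\<omega>. (x \<omega>, y \<omega>, v \<omega>)) \<in> borel_measurable M" by measurable
    then have "(\<lambda>\<omega>. (x \<omega>, y \<omega>, v \<omega>)) -` T L A \<inter> space M \<in> sets M" for L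
      using T_closed[OF A] by (intro measurable_sets[of _ _ borel]) auto
    then have "(\<Union>L. (\<lambda>\<omega>. (x \<omega>, y \<omega>, v \<omega>)) -` T L A \<inter> space M) \<inter> G \<in> sets M"
      by (intro sets.Int G sets.countable_UN') auto
    also have "(\<Union>L. (\<lambda>\<omega>. (x \<omega>, y \<omega>, v \<omega>)) -` T L A \<inter> space M) \<inter> G = {\<omega> \<in> G. \<exists>L. (x \<omega>, y \<omega>, v \<omega>) \<in> T L A}"
      by (auto simp: G_def)
    finally show ?thesis .
  qed
  have r[measurable]: "r \<in> borel_measurable M"
    unfolding borel_measurable_iff_le
  proof
    fix a
    have *: "r \<omega> \<le> a \<longleftrightarrow> (\<exists>L. (x \<omega>, y \<omega>, a) \<in> T L UNIV)" if "\<omega> \<in> G" for \<omega>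
    proof -
      note lse = lse_vector[OF S(2) xS[OF that], where y = "y \<omega>"]
      have "r \<omega> = (\<Sum>k=1..n. \<bar>y \<omega> k - lse_vector S n (x \<omega>) (y \<omega>) k\<bar>\<^sup>2)" using that by (simp add: r_def)
      moreover have "\<exists>z\<in>convex_interpolable S n (x \<omega>). z \<in> UNIV \<and> (\<Sum>k=1..n. \<bar>y \<omega> k - z k\<bar>\<^sup>2) \<le> a" if "r \<omega> \<le> a"
        using lse(1) that calculation by auto
      moreover have "r \<omega> \<le> (\<Sum>k=1..n. \<bar>y \<omega> k - z k\<bar>\<^sup>2)" if "z \<in> convex_interpolable S n (x \<omega>)" for z
        using lse(2)[OF that] calculation(1) by simp
      ultimately show ?thesis
        unfolding T_iff[OF that] by (meson order_trans)
    qed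
    then have "{\<omega> \<in> space M. r \<omega> \<le> a} = {\<omega> \<in> G. \<exists>L. (x \<omega>, y \<omega>, a) \<in> T L UNIV} \<union> (if 0 \<le> a then space M - G else {})"
      by (auto simp: r_def G_def)
    also have "\<dots> \<in> sets M" by (intro sets.Un T_meas) auto
    finally show "{\<omega> \<in> space M. r \<omega> \<le> a} \<in> sets M" .
  qed
  have "(\<lambda>\<omega>. lse_vector S n (x \<omega>) (y \<omega>) k) \<in> borel_measurable M" for k
    unfolding borel_measurable_iff_le
  proof
    fix a
    let ?c = "(THE z :: nat \<Rightarrow> real. False) k"
    have in_G: "lse_vector S n (x \<omega>) (y \<omega>) k \<le> a \<longleftrightarrow> (\<exists>L. (x \<omega>, y \<omega>, r \<omega>) \<in> T L {z. z k \<le> a})" if "\<omega> \<in> G" for \<omega>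
    proof -
      note lse = lse_vector[OF S(2) xS[OF that], where y = "y \<omega>"]
      have "z = lse_vector S n (x \<omega>) (y \<omega>)" if "z \<in> convex_interpolable S n (x \<omega>)" "(\<Sum>k=1..n. \<bar>y \<omega> k - z k\<bar>\<^sup>2) \<le> r \<omega>" for z
        using that \<open>\<omega> \<in> G\<close> by (intro convex_interpolable_minimizer_unique[OF lse(1) that(1) lse(2)]) (auto simp: r_def)
      then show ?thesis
        unfolding T_iff[OF that] using lse(1) that by (auto simp: r_def)
    qed
    have out_G: "lse_vector S n (x \<omega>) (y \<omega>) k = ?c" if "\<omega> \<in> space M - G" for \<omega>
    proof -
      have "convex_interpolable S n (x \<omega>) = {}" using that by (auto simp: G_def convex_interpolable_def)
      then show ?thesis by (simp add: lse_vector_def is_arg_min_def)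
    qed
    have "{\<omega> \<in> space M. lse_vector S n (x \<omega>) (y \<omega>) k \<le> a}
        = {\<omega> \<in> G. lse_vector S n (x \<omega>) (y \<omega>) k \<le> a} \<union> {\<omega> \<in> space M - G. lse_vector S n (x \<omega>) (y \<omega>) k \<le> a}"
      by (auto simp: G_def)
    also have "{\<omega> \<in> G. lse_vector S n (x \<omega>) (y \<omega>) k \<le> a} = {\<omega> \<in> G. \<exists>L. (x \<omega>, y \<omega>, r \<omega>) \<in> T L {z. z k \<le> a}}"
      using in_G by blast
    also have "{\<omega> \<in> space M - G. lse_vector S n (x \<omega>) (y \<omega>) k \<le> a} = (if ?c \<le> a then space M - G else {})"
      using out_G by auto
    also have "{\<omega> \<in> G. \<exists>L. (x \<omega>, y \<omega>, r \<omega>) \<in> T L {z. z k \<le> a}} \<union> (if ?c \<le> a then space M - G else {}) \<in> sets M"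
      by (intro sets.Un T_meas closed_Collect_le continuous_intros
        continuous_on_product_then_coordinatewise) auto
    finally show "{\<omega> \<in> space M. lse_vector S n (x \<omega>) (y \<omega>) k \<le> a} \<in> sets M" .
  qed
  then have lse[measurable]: "(\<lambda>\<omega>. lse_vector S n (x \<omega>) (y \<omega>)) \<in> borel_measurable M"
    by (intro measurable_coordinatewise_then_product)
  define Q where "Q c = {(x :: nat \<Rightarrow> 'a, z). \<exists>\<theta>. (\<forall>k. \<theta> k \<in> {0..1}) \<and> (\<Sum>k=1..n. \<theta> k) = 1 \<and>
    (\<Sum>k=1..n. \<theta> k *\<^sub>R x k) = t \<and> (\<Sum>k=1..n. \<theta> k * z k) \<le> c}" for c :: real
  have "(\<lambda>\<omega>. convex_lse S n (x \<omega>) (y \<omega>) t) \<in> borel_measurable M"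
    unfolding borel_measurable_ereal_iff_Iio
  proof
    fix a :: ereal
    let ?p = "\<lambda>\<omega>. (x \<omega>, lse_vector S n (x \<omega>) (y \<omega>))"
    \<comment> \<open>A rational between the value of a weighted sum and \<open>a\<close> turns the
      infimum over uncountably many weights into a countable union of closed conditions.\<close>
    have iff: "convex_lse S n (x \<omega>) (y \<omega>) t < a \<longleftrightarrow> (\<exists>q\<in>{q::rat. ereal (of_rat q) < a}. ?p \<omega> \<in> Q (of_rat q))" for \<omega>
    proof
      assume "convex_lse S n (x \<omega>) (y \<omega>) t < a"
      then obtain \<theta> where \<theta>: "(\<Sum>k=1..n. \<theta> k) = 1" "(\<Sum>k=1..n. \<theta> k *\<^sub>R x \<omega> k) = t" "\<forall>k\<in>{1..n}. 0 \<le> \<theta> k"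
        "ereal (\<Sum>k=1..n. \<theta> k * lse_vector S n (x \<omega>) (y \<omega>) k) < a" unfolding convex_lse_less_iff by blast
      obtain b where b: "(\<Sum>k=1..n. \<theta> k * lse_vector S n (x \<omega>) (y \<omega>) k) < b" "ereal b < a"
        using ereal_dense2[OF \<theta>(4)] by auto
      obtain q where q: "(\<Sum>k=1..n. \<theta> k * lse_vector S n (x \<omega>) (y \<omega>) k) < of_rat q" "of_rat q < b"
        using of_rat_dense[OF b(1)] by blast
      have le1: "\<theta> k \<le> 1" if "k \<in> {1..n}" for k
        using member_le_sum[of k "{1..n}" \<theta>] \<theta>(1,3) that by auto
      \<comment> \<open>Weights outside of \<open>{1..n}\<close> are set to 0 to land in the compact
        cube.\<close>
      define \<theta>' where "\<theta>' k = (if k \<in> {1..n} then \<theta> k else 0)" for k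
      have sums: "(\<Sum>k=1..n. \<theta>' k) = (\<Sum>k=1..n. \<theta> k)" "(\<Sum>k=1..n. \<theta>' k *\<^sub>R x \<omega> k) = (\<Sum>k=1..n. \<theta> k *\<^sub>R x \<omega> k)"
        "(\<Sum>k=1..n. \<theta>' k * lse_vector S n (x \<omega>) (y \<omega>) k) = (\<Sum>k=1..n. \<theta> k * lse_vector S n (x \<omega>) (y \<omega>) k)"
        by (intro sum.cong; simp add: \<theta>'_def)+
      have "\<forall>k. \<theta>' k \<in> {0..1}" using le1 \<theta>(3) by (simp add: \<theta>'_def)
      then have "?p \<omega> \<in> Q (of_rat q)"
        unfolding Q_def mem_Collect_eq prod.case using \<theta>(1,2) q(1)
        by (intro exI[of _ \<theta>'] conjI) (assumption | simp only: sums less_imp_le)+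
      moreover have "ereal (of_rat q) < a" using q(2) b(2) by (meson ereal_less_eq(3) le_less_trans less_imp_le)
      ultimately show "\<exists>q\<in>{q. ereal (of_rat q) < a}. ?p \<omega> \<in> Q (of_rat q)" by blast
    next
      assume "\<exists>q\<in>{q. ereal (of_rat q) < a}. ?p \<omega> \<in> Q (of_rat q)"
      then obtain q \<theta> where q: "ereal (of_rat q) < a" "\<forall>k. \<theta> k \<in> {0..1}" "(\<Sum>k=1..n. \<theta> k) = 1"
        "(\<Sum>k=1..n. \<theta> k *\<^sub>R x \<omega> k) = t" "(\<Sum>k=1..n. \<theta> k * lse_vector S n (x \<omega>) (y \<omega>) k) \<le> of_rat q"
        unfolding Q_def by blast
      then show "convex_lse S n (x \<omega>) (y \<omega>) t < a"
        unfolding convex_lse_less_iff by (intro exI[of _ \<theta>]) (auto intro: le_less_trans[of _ "ereal (of_rat q)"])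
    qed
    have "?p \<in> borel_measurable M" by measurable
    then have "?p -` Q c \<inter> space M \<in> sets M" for c
      unfolding Q_def by (intro measurable_sets[of _ _ borel] borel_closed closed_convex_combinations)
    then have "(\<Union>q\<in>{q::rat. ereal (of_rat q) < a}. ?p -` Q (of_rat q) \<inter> space M) \<in> sets M"
      by (intro sets.countable_UN') auto
    also have "(\<Union>q\<in>{q::rat. ereal (of_rat q) < a}. ?p -` Q (of_rat q) \<inter> space M)
        = (\<lambda>\<omega>. convex_lse S n (x \<omega>) (y \<omega>) t) -` {..<a} \<inter> space M"
      using iff by auto
    finally show "(\<lambda>\<omega>. convex_lse S n (x \<omega>) (y \<omega>) t) -` {..<a} \<inter> space M \<in> sets M" .
  qed
  moreover have "convex_lse S n (x \<omega>) (y \<omega>) t = convex_lse S n (\<lambda>k. X k \<omega>) (\<lambda>k. Y k \<omega>) t" for \<omega>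
    by (rule convex_lse_cong) (simp add: x_def y_def)
  ultimately show ?thesis by simp
qed

section \<open>Consistency along a regular path\<close>

text \<open>For closed \<open>S\<close>, a compact exhaustion of its interior: the margin
  \<open>1 / real (Suc l)\<close> keeps away from the boundary, the ball of radius \<open>l\<close>
  gives boundedness.\<close>

definition core :: "'a::euclidean_space set \<Rightarrow> nat \<Rightarrow> 'a set" where
  "core S l = {x. cball x (1 / real (Suc l)) \<subseteq> S} \<inter> cball 0 (real l)"

lemma compact_core:
  fixes S :: "'a::euclidean_space set"
  assumes "closed S"
  shows "compact (core S l)"
proof -
  \<comment> \<open>Erosion by a ball is an intersection of translates of \<open>S\<close>, hence
    closed.\<close>
  have "{x. cball x (1 / real (Suc l)) \<subseteq> S} = (\<Inter>h\<in>cball 0 (1 / real (Suc l)). (\<lambda>x. x + h) -` S)"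
  proof (rule set_eqI)
    fix x
    have "cball x (1 / real (Suc l)) \<subseteq> S \<longleftrightarrow> (\<forall>h\<in>cball 0 (1 / real (Suc l)). x + h \<in> S)"
    proof
      assume sub: "cball x (1 / real (Suc l)) \<subseteq> S"
      show "\<forall>h\<in>cball 0 (1 / real (Suc l)). x + h \<in> S"
      proof
        fix h :: 'a assume "h \<in> cball 0 (1 / real (Suc l))"
        then have "x + h \<in> cball x (1 / real (Suc l))" by (simp add: dist_norm)
        with sub show "x + h \<in> S" ..
      qed
    next
      assume all: "\<forall>h\<in>cball 0 (1 / real (Suc l)). x + h \<in> S"
      show "cball x (1 / real (Suc l)) \<subseteq> S"
      proof
        fix y assume "y \<in> cball x (1 / real (Suc l))"
        then have "y - x \<in> cball 0 (1 / real (Suc l))" by (simp add: dist_norm norm_minus_commute)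
        with all have "x + (y - x) \<in> S" ..
        then show "y \<in> S" by simp
      qed
    qed
    then show "x \<in> {x. cball x (1 / real (Suc l)) \<subseteq> S} \<longleftrightarrow> x \<in> (\<Inter>h\<in>cball 0 (1 / real (Suc l)). (\<lambda>x. x + h) -` S)"
      by (simp only: mem_Collect_eq INT_iff vimage_eq)
  qed
  moreover have "closed (\<Inter>h\<in>cball 0 (1 / real (Suc l)). (\<lambda>x::'a. x + h) -` S)"
    by (intro closed_INT ballI closed_vimage assms continuous_intros)
  ultimately have "closed {x. cball x (1 / real (Suc l)) \<subseteq> S}" by simp
  then show ?thesis unfolding core_def by (intro closed_Int_compact) auto
qed

lemma core_subset_interior: "core S l \<subseteq> interior S"
proof
  fix x assume "x \<in> core S l"
  then have "ball x (1 / real (Suc l)) \<subseteq> S" using ball_subset_cball by (force simp: core_def)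
  then show "x \<in> interior S" by (auto simp: mem_interior intro!: exI[of _ "1 / real (Suc l)"])
qed

lemma core_mono: "l \<le> m \<Longrightarrow> core S l \<subseteq> core S m"
proof -
  assume lm: "l \<le> m"
  then have "1 / real (Suc m) \<le> 1 / real (Suc l)" by (intro divide_left_mono) auto
  then have "cball x (1 / real (Suc m)) \<subseteq> cball x (1 / real (Suc l))" for x by (rule subset_cball)
  then show ?thesis using lm by (fastforce simp: core_def)
qed

lemma interior_subset_interior_core:
  fixes S :: "'a::euclidean_space set"
  assumes "x \<in> interior S"
  shows "\<exists>l. x \<in> interior (core S l)"
proof -
  obtain e where e: "e > 0" "cball x e \<subseteq> S" using assms by (auto simp: mem_interior_cball)
  \<comment> \<open>The term \<open>2 / e\<close> makes the margin at most half of \<open>e\<close>;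
    \<open>norm x + 1\<close> covers the ball of radius 1 around \<open>x\<close>.\<close>
  obtain l where l: "real l > 2 / e + norm x + 1" using reals_Archimedean2 by blast
  have le: "1 / real (Suc l) \<le> e / 2"
  proof -
    have "2 / e < real (Suc l)" using l norm_ge_zero[of x] unfolding of_nat_Suc by linarith
    then show ?thesis using e by (simp add: field_simps)
  qed
  have "ball x (min (e/2) 1) \<subseteq> core S l"
  proof
    fix y assume y: "y \<in> ball x (min (e/2) 1)"
    have "cball y (1 / real (Suc l)) \<subseteq> cball x e"
    proof
      fix z assume "z \<in> cball y (1 / real (Suc l))"
      then show "z \<in> cball x e" using y le dist_triangle[of x z y] by auto
    qed
    moreover have "norm y \<le> real l"
    proof -
      have "norm y \<le> norm x + dist x y"
        using norm_triangle_ineq[of x "y - x"] by (simp add: dist_norm norm_minus_commute)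
      moreover have "dist x y < 1" using y by simp
      moreover have "2 / e > 0" using e by simp
      ultimately show ?thesis using l by linarith
    qed
    ultimately show "y \<in> core S l" using e(2) by (auto simp: core_def)
  qed
  then have "x \<in> interior (core S l)" using e by (auto simp: mem_interior intro!: exI[of _ "min (e/2) 1"])
  then show ?thesis ..
qed

lemma Union_interior_core: "(\<Union>l. interior (core S l)) = interior S"
proof
  show "(\<Union>l. interior (core S l)) \<subseteq> interior S"
    using interior_mono[OF core_subset_interior] by (auto simp: subset_iff)
  show "interior S \<subseteq> (\<Union>l. interior (core S l))"
    by (intro subsetI UN_iff[THEN iffD2]) (simp add: interior_subset_interior_core)
qed

text \<open>Making a finite cover by balls of radius \<open>\<delta> / 2\<close> disjoint does not
  enlarge diameters. Borel cells are wanted because a law of large numbers is applied to each of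
  them.\<close>

lemma finite_borel_partition:
  fixes A :: "'a::euclidean_space set"
  assumes A: "compact A" and \<delta>: "\<delta> > 0"
  shows "\<exists>P. finite P \<and> disjoint P \<and> \<Union>P = A \<and> P \<subseteq> sets borel \<and> (\<forall>W\<in>P. \<forall>u\<in>W. \<forall>v\<in>W. dist u v \<le> \<delta>)"
proof -
  have cover: "A \<subseteq> (\<Union>t\<in>A. ball t (\<delta>/2))" using \<delta> by auto
  obtain T where T: "finite T" "A \<subseteq> (\<Union>t\<in>T. ball t (\<delta>/2))"
    by (rule compactE_image[OF A open_ball cover]) blast
  obtain d :: "nat \<Rightarrow> 'a" and N where d: "T = d ` {..<N}"
    using T(1) finite_imp_nat_seg_image_inj_on[of T] by (auto simp: lessThan_def)
  define W where "W i = disjointed (\<lambda>i. ball (d i) (\<delta>/2)) i \<inter> A" for i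
  have disj: "disjoint_family W"
    using disjoint_family_disjointed[of "\<lambda>i. ball (d i) (\<delta>/2)"] by (auto simp: disjoint_family_on_def W_def)
  have "\<Union>(W ` {..<N}) = A"
    using T(2) finite_UN_disjointed_eq[of "\<lambda>i. ball (d i) (\<delta>/2)" N] by (auto simp: W_def d atLeast0LessThan)
  moreover have "disjoint (W ` {..<N})"
    by (rule disjoint_family_on_disjoint_image[OF disjoint_family_on_mono[OF subset_UNIV disj]])
  moreover have "W i \<in> sets borel" for i
  proof -
    have "range (disjointed (\<lambda>i. ball (d i) (\<delta>/2))) \<subseteq> sets borel"
      by (rule sets.range_disjointed_sets) auto
    then have "disjointed (\<lambda>i. ball (d i) (\<delta>/2)) i \<in> sets borel" by blast
    then show ?thesis using A by (auto simp: W_def borel_compact)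
  qed
  moreover have "dist u v \<le> \<delta>" if "u \<in> W i" "v \<in> W i" for u v i
  proof -
    have "u \<in> ball (d i) (\<delta>/2)" "v \<in> ball (d i) (\<delta>/2)"
      using that disjointed_subset[of "\<lambda>i. ball (d i) (\<delta>/2)" i] unfolding W_def by blast+
    then show ?thesis using dist_triangle3[of u v "d i"] by simp
  qed
  ultimately show ?thesis
    by (intro exI[of _ "W ` {..<N}"]) auto
qed

text \<open>The deterministic content of the probabilistic hypotheses, in four clauses: positive
  density of the design in open sets; noise that averages out on the cells of fine partitions of
  each core; noise energy of order \<open>n\<close>; a small share of it outside of a large core.
  Since the partition is existential, countably many cells suffice to verify the second clause
  almost surely.\<close>

definition regular_path :: "'a::euclidean_space set \<Rightarrow> (nat \<Rightarrow> 'a) \<Rightarrow> (nat \<Rightarrow> real) \<Rightarrow> bool" where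
  "regular_path S x e \<longleftrightarrow>
     (\<forall>U. open U \<longrightarrow> U \<noteq> {} \<longrightarrow> U \<subseteq> interior S \<longrightarrow>
        (\<exists>p>0. \<forall>\<^sub>F n in sequentially. p * real n \<le> real (count_in x n U))) \<and>
     (\<forall>l. \<forall>\<delta>>0. \<exists>P. finite P \<and> disjoint P \<and> \<Union>P = core S l \<and>
        (\<forall>W\<in>P. (\<forall>u\<in>W. \<forall>v\<in>W. dist u v \<le> \<delta>) \<and>
           (\<lambda>n. (\<Sum>k=1..n. indicator W (x k) * e k) / real n) \<longlonglongrightarrow> 0)) \<and>
     (\<exists>C. \<forall>\<^sub>F n in sequentially. (\<Sum>k=1..n. (e k)\<^sup>2) \<le> C * real n) \<and>
     (\<forall>\<delta>>0. \<exists>l. \<forall>\<^sub>F n in sequentially. (\<Sum>k=1..n. indicator (- core S l) (x k) * (e k)\<^sup>2) \<le> \<delta> * real n)"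

text \<open>At least \<open>p * real n\<close> design points fall into \<open>U\<close>; if all
  residuals there were above \<open>c\<close>, their squares would exceed the given bound.\<close>

lemma exists_small_residual:
  fixes r :: "nat \<Rightarrow> real"
  assumes p: "p > 0" "p * real n \<le> real (count_in x n U)" "n > 0"
    and le: "(\<Sum>k=1..n. (r k)\<^sup>2) \<le> p * c\<^sup>2 * real n" and c: "c \<ge> 0"
  shows "\<exists>k\<in>{1..n}. x k \<in> U \<and> \<bar>r k\<bar> \<le> c"
proof (rule ccontr)
  assume "\<not> ?thesis"
  then have big: "c < \<bar>r k\<bar>" if "k \<in> {1..n}" "x k \<in> U" for k using that by force
  define I where "I = {k \<in> {1..n}. x k \<in> U}"
  have I: "finite I" "I \<subseteq> {1..n}" "real (card I) \<ge> p * real n"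
    using p by (auto simp: I_def count_in_def)
  moreover have "p * real n > 0" using p by simp
  ultimately have "I \<noteq> {}" by fastforce
  have "real (card I) * c\<^sup>2 = (\<Sum>k\<in>I. c\<^sup>2)" by simp
  also have "\<dots> < (\<Sum>k\<in>I. (r k)\<^sup>2)"
  proof (intro sum_strict_mono I \<open>I \<noteq> {}\<close>)
    fix k assume "k \<in> I"
    then have "c\<^sup>2 < \<bar>r k\<bar>\<^sup>2" using big c by (intro power_strict_mono) (auto simp: I_def)
    then show "c\<^sup>2 < (r k)\<^sup>2" by simp
  qed
  also have "\<dots> \<le> (\<Sum>k=1..n. (r k)\<^sup>2)" using I by (intro sum_mono2) auto
  also have "\<dots> \<le> p * real n * c\<^sup>2" using le by (simp add: ac_simps)
  also have "\<dots> \<le> real (card I) * c\<^sup>2" using I by (intro mult_right_mono) auto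
  finally show False by simp
qed

text \<open>Local constants become uniform on a compact set by a finite subcover. The cover uses
  balls of half the radius, so that two points at distance at most \<open>\<rho>\<close> share one
  of the local balls.\<close>

lemma proper_convex_equilipschitz_compact:
  fixes f :: "nat \<Rightarrow> 'a::euclidean_space \<Rightarrow> ereal"
  assumes f: "\<And>n. proper_convex (f n)" and G: "open G" and A: "compact A" "A \<subseteq> G"
    and pt: "\<And>U. open U \<Longrightarrow> U \<noteq> {} \<Longrightarrow> U \<subseteq> G \<Longrightarrow> \<exists>C. \<forall>\<^sub>F n in sequentially. \<exists>u\<in>U. \<bar>f n u\<bar> \<le> ereal C"
  obtains \<rho> C L where "\<rho> > 0" "L > 0"
    "\<forall>\<^sub>F n in sequentially. (\<forall>s\<in>A. \<bar>f n s\<bar> \<le> ereal C) \<and>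
       (\<forall>u\<in>A. \<forall>v\<in>A. dist u v \<le> \<rho> \<longrightarrow> \<bar>real_of_ereal (f n u) - real_of_ereal (f n v)\<bar> \<le> L * dist u v)"
proof -
  have loc: "\<exists>r C L. r > 0 \<and> L > 0 \<and> (\<forall>\<^sub>F n in sequentially. (\<forall>s\<in>cball t r. \<bar>f n s\<bar> \<le> ereal C) \<and>
       (\<forall>u\<in>cball t r. \<forall>v\<in>cball t r. \<bar>real_of_ereal (f n u) - real_of_ereal (f n v)\<bar> \<le> L * dist u v))"
    if "t \<in> G" for t
    by (rule proper_convex_locally_lipschitz[of f, OF f G that]) (use pt in blast)+
  have "\<forall>t\<in>A. \<exists>q. fst q > 0 \<and> snd (snd q) > 0 \<and> (\<forall>\<^sub>F n in sequentially. (\<forall>s\<in>cball t (fst q). \<bar>f n s\<bar> \<le> ereal (fst (snd q))) \<and>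
       (\<forall>u\<in>cball t (fst q). \<forall>v\<in>cball t (fst q). \<bar>real_of_ereal (f n u) - real_of_ereal (f n v)\<bar> \<le> snd (snd q) * dist u v))"
  proof (intro ballI, goal_cases)
    case (1 t)
    then have "t \<in> G" using A(2) by blast
    from loc[OF this] obtain r C L where "r > 0 \<and> L > 0 \<and> (\<forall>\<^sub>F n in sequentially. (\<forall>s\<in>cball t r. \<bar>f n s\<bar> \<le> ereal C) \<and>
       (\<forall>u\<in>cball t r. \<forall>v\<in>cball t r. \<bar>real_of_ereal (f n u) - real_of_ereal (f n v)\<bar> \<le> L * dist u v))"
      by blast
    then show ?case by (intro exI[of _ "(r, C, L)"]) simp
  qed
  from bchoice[OF this] obtain q where q: "\<And>t. t \<in> A \<Longrightarrow> fst (q t) > 0 \<and> snd (snd (q t)) > 0"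
    "\<And>t. t \<in> A \<Longrightarrow> \<forall>\<^sub>F n in sequentially. (\<forall>s\<in>cball t (fst (q t)). \<bar>f n s\<bar> \<le> ereal (fst (snd (q t)))) \<and>
       (\<forall>u\<in>cball t (fst (q t)). \<forall>v\<in>cball t (fst (q t)). \<bar>real_of_ereal (f n u) - real_of_ereal (f n v)\<bar> \<le> snd (snd (q t)) * dist u v)"
    by blast
  have "A \<subseteq> (\<Union>t\<in>A. ball t (fst (q t) / 2))" using q(1) by (auto intro!: centre_in_ball[THEN iffD2])
  then obtain T where T: "T \<subseteq> A" "finite T" "A \<subseteq> (\<Union>t\<in>T. ball t (fst (q t) / 2))"
    using compactE_image[OF A(1), of A "\<lambda>t. ball t (fst (q t) / 2)"] by auto
  define \<rho> where "\<rho> = Min (insert 1 ((\<lambda>t. fst (q t) / 2) ` T))"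
  define C where "C = Max (insert 1 ((\<lambda>t. fst (snd (q t))) ` T))"
  define L where "L = Max (insert 1 ((\<lambda>t. snd (snd (q t))) ` T))"
  have \<rho>: "\<rho> > 0" using T q(1) by (auto simp: \<rho>_def)
  have "1 \<le> L" unfolding L_def using T(2) by (intro Max_ge) auto
  then have L: "L > 0" by simp
  have bounds: "\<rho> \<le> fst (q t) / 2" "fst (snd (q t)) \<le> C" "snd (snd (q t)) \<le> L" if "t \<in> T" for t
    unfolding \<rho>_def C_def L_def using T(2) that by (intro Min_le Max_ge; simp)+
  have "\<forall>\<^sub>F n in sequentially. \<forall>t\<in>T. (\<forall>s\<in>cball t (fst (q t)). \<bar>f n s\<bar> \<le> ereal (fst (snd (q t)))) \<and>
       (\<forall>u\<in>cball t (fst (q t)). \<forall>v\<in>cball t (fst (q t)). \<bar>real_of_ereal (f n u) - real_of_ereal (f n v)\<bar> \<le> snd (snd (q t)) * dist u v)"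
    using T q(2) by (subst eventually_ball_finite_distrib) auto
  then have "\<forall>\<^sub>F n in sequentially. (\<forall>s\<in>A. \<bar>f n s\<bar> \<le> ereal C) \<and>
       (\<forall>u\<in>A. \<forall>v\<in>A. dist u v \<le> \<rho> \<longrightarrow> \<bar>real_of_ereal (f n u) - real_of_ereal (f n v)\<bar> \<le> L * dist u v)"
  proof eventually_elim
    case (elim n)
    show ?case
    proof (intro conjI ballI impI)
      fix u assume "u \<in> A"
      then obtain t where t: "t \<in> T" "u \<in> ball t (fst (q t) / 2)" using T by blast
      have qt: "fst (q t) > 0" using t T q(1) by blast
      then have u: "u \<in> cball t (fst (q t))" using t by auto
      have "\<bar>f n u\<bar> \<le> ereal (fst (snd (q t)))" using elim t u by blast
      also have "\<dots> \<le> ereal C" using bounds t by simp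
      finally show "\<bar>f n u\<bar> \<le> ereal C" .
      fix v assume v: "v \<in> A" "dist u v \<le> \<rho>"
      have "v \<in> cball t (fst (q t))" using t v bounds(1)[OF t(1)] dist_triangle[of t v u] by auto
      then have "\<bar>real_of_ereal (f n u) - real_of_ereal (f n v)\<bar> \<le> snd (snd (q t)) * dist u v"
        using elim t u by blast
      also have "\<dots> \<le> L * dist u v" using bounds t by (intro mult_right_mono) auto
      finally show "\<bar>real_of_ereal (f n u) - real_of_ereal (f n v)\<bar> \<le> L * dist u v" .
    qed
  qed
  with \<rho> L that show ?thesis by blast
qed

text \<open>On each cell \<open>h\<close> is frozen at one representative, which pulls it out of the
  sum over the noise; the error is at most \<open>\<tau>\<close> times the absolute noise. The
  inequality is meant for an \<open>h\<close> that itself depends on the noise, namely fit minus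
  truth.\<close>

lemma partition_noise_bound:
  fixes h :: "'a::euclidean_space \<Rightarrow> real"
  assumes P: "finite P" "disjoint P" "\<Union>P = A"
    and h: "\<And>u. u \<in> A \<Longrightarrow> \<bar>h u\<bar> \<le> C"
    and osc: "\<And>W u v. W \<in> P \<Longrightarrow> u \<in> W \<Longrightarrow> v \<in> W \<Longrightarrow> \<bar>h u - h v\<bar> \<le> \<tau>" and \<tau>: "\<tau> \<ge> 0"
  shows "(\<Sum>k=1..n. indicator A (x k) * (e k * h (x k)))
    \<le> \<bar>C\<bar> * (\<Sum>W\<in>P. \<bar>\<Sum>k=1..n. indicator W (x k) * e k\<bar>) + \<tau> * (\<Sum>k=1..n. \<bar>e k\<bar>)"
proof -
  have ind: "indicator A y = (\<Sum>W\<in>P. indicator W y :: real)" for y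
  proof -
    have "(indicator (\<Union>W\<in>P. W) y :: real) = (\<Sum>W\<in>P. indicator W y)"
      using P by (intro indicator_UN_disjoint) (auto simp: disjoint_def disjoint_family_on_def)
    then show ?thesis using P(3) by simp
  qed
  have "\<exists>w. (W \<noteq> {} \<longrightarrow> w \<in> W)" for W :: "'a set" by auto
  then obtain w where w: "\<And>W :: 'a set. W \<noteq> {} \<Longrightarrow> w W \<in> W" by metis
  define a where "a W = (if W = {} then 0 else h (w W))" for W
  have a: "\<bar>a W\<bar> \<le> \<bar>C\<bar>" if "W \<in> P" for W
  proof (cases "W = {}")
    case False
    then have "w W \<in> A" using w[of W] that P(3) by blast
    from h[OF this] show ?thesis using False by (simp add: a_def)
  qed (simp add: a_def)
  have "(\<Sum>k=1..n. indicator A (x k) * (e k * h (x k)))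
      = (\<Sum>k=1..n. \<Sum>W\<in>P. indicator W (x k) * (e k * h (x k)))"
    by (simp add: ind sum_distrib_right)
  also have "\<dots> \<le> (\<Sum>k=1..n. \<Sum>W\<in>P. a W * (indicator W (x k) * e k) + \<tau> * (\<bar>e k\<bar> * indicator W (x k)))"
  proof (intro sum_mono)
    fix k W assume W: "W \<in> P"
    show "indicator W (x k) * (e k * h (x k)) \<le> a W * (indicator W (x k) * e k) + \<tau> * (\<bar>e k\<bar> * indicator W (x k))"
    proof (cases "x k \<in> W")
      case True
      then have "\<bar>h (x k) - a W\<bar> \<le> \<tau>" using osc[OF W True w[of W]] by (auto simp: a_def)
      then have "\<bar>e k * (h (x k) - a W)\<bar> \<le> \<bar>e k\<bar> * \<tau>"
        unfolding abs_mult by (intro mult_left_mono) auto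
      then have "e k * h (x k) - e k * a W \<le> \<bar>e k\<bar> * \<tau>" by (simp add: right_diff_distrib)
      then show ?thesis using True by (simp add: mult.commute)
    qed simp
  qed
  also have "\<dots> = (\<Sum>W\<in>P. a W * (\<Sum>k=1..n. indicator W (x k) * e k)) + \<tau> * (\<Sum>k=1..n. \<bar>e k\<bar> * indicator A (x k))"
    unfolding ind sum_distrib_left sum.distrib by (subst sum.swap) simp
  also have "\<dots> \<le> (\<Sum>W\<in>P. \<bar>C\<bar> * \<bar>\<Sum>k=1..n. indicator W (x k) * e k\<bar>) + \<tau> * (\<Sum>k=1..n. \<bar>e k\<bar>)"
  proof (intro add_mono sum_mono mult_left_mono \<tau>)
    fix W assume W: "W \<in> P"
    have "\<bar>a W * (\<Sum>k=1..n. indicator W (x k) * e k)\<bar> \<le> \<bar>C\<bar> * \<bar>\<Sum>k=1..n. indicator W (x k) * e k\<bar>"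
      unfolding abs_mult using a[OF W] by (intro mult_right_mono) auto
    then show "a W * (\<Sum>k=1..n. indicator W (x k) * e k) \<le> \<bar>C\<bar> * \<bar>\<Sum>k=1..n. indicator W (x k) * e k\<bar>" by linarith
  qed (auto simp: indicator_def)
  finally show ?thesis by (simp add: sum_distrib_left)
qed

theorem convex_lse_consistent_on_path:
  fixes S :: "'a::euclidean_space set"
  assumes S: "closed S" "convex S" and g: "convex_on S g"
    and data: "\<And>k. k \<ge> 1 \<Longrightarrow> x k \<in> S \<and> y k = g (x k) + e k"
    and reg: "regular_path S x e"
    and K: "compact K" "K \<subseteq> interior S" and \<eta>: "\<eta> > 0"
  shows "\<forall>\<^sub>F n in sequentially. \<forall>s\<in>K. \<bar>convex_lse S n x y s - ereal (g s)\<bar> \<le> ereal \<eta>"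
proof -
  define F where "F n = convex_lse S n x y" for n
  define r where "r n k = lse_vector S n x y k - g (x k)" for n k
  define B where "B n = (\<Sum>k=1..n. (r n k)\<^sup>2)" for n
  have F: "proper_convex (F n)" for n by (simp add: F_def proper_convex_convex_lse)
  have Fx: "F n (x k) = ereal (r n k + g (x k))" if "k \<in> {1..n}" for n k
    unfolding F_def r_def using that data S(2) by (subst convex_lse_design_point) auto
  have gcont: "continuous_on (interior S) g"
    using convex_on_continuous[OF open_interior convex_on_subset[OF g interior_subset]]
    by (simp add: convex_interior S)
  have basic: "B n \<le> 2 * (\<Sum>k=1..n. e k * r n k)" for n
    unfolding B_def r_def using data S(2) g by (intro lse_vector_basic_inequality) auto
  \<comment> \<open>Absorbs half of the residuals: used with the whole noise first, then with the noise outside of the core.\<close>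
  have amgm: "2 * (a * b) \<le> 2 * a\<^sup>2 + b\<^sup>2 / 2" for a b :: real
    using zero_le_power2[of "2 * a - b"] by (simp add: power2_eq_square algebra_simps)
  obtain C where C: "\<forall>\<^sub>F n in sequentially. (\<Sum>k=1..n. (e k)\<^sup>2) \<le> C * real n"
    using reg by (auto simp: regular_path_def)
  have B1: "\<forall>\<^sub>F n in sequentially. B n \<le> 4 * \<bar>C\<bar> * real n"
    using C
  proof eventually_elim
    case (elim n)
    have "2 * (\<Sum>k=1..n. e k * r n k) \<le> (\<Sum>k=1..n. 2 * (e k)\<^sup>2 + (r n k)\<^sup>2 / 2)"
      unfolding sum_distrib_left using amgm by (intro sum_mono) auto
    also have "\<dots> = 2 * (\<Sum>k=1..n. (e k)\<^sup>2) + B n / 2"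
      by (simp add: sum.distrib sum_distrib_left B_def sum_divide_distrib)
    finally have "B n \<le> 4 * (\<Sum>k=1..n. (e k)\<^sup>2)" using basic[of n] by simp
    also have "\<dots> \<le> 4 * (C * real n)" using elim by simp
    also have "\<dots> \<le> 4 * \<bar>C\<bar> * real n" by (simp add: mult_right_mono)
    finally show ?case .
  qed
  \<comment> \<open>Converts a rate for \<open>B n\<close> into a point of \<open>U\<close> with
    controlled residual: with a fixed \<open>c\<close> for the rate O(n), with arbitrary
    \<open>c\<close> once the rate is o(n).\<close>
  have near: "\<forall>\<^sub>F n in sequentially. \<exists>u\<in>U. \<bar>F n u - ereal (g u)\<bar> \<le> ereal c"
    if "p > 0" "\<forall>\<^sub>F n in sequentially. p * real n \<le> real (count_in x n U)"
      "\<forall>\<^sub>F n in sequentially. B n \<le> p * c\<^sup>2 * real n" "c \<ge> 0" for p U c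
    using that(2,3) eventually_gt_at_top[of 0]
  proof eventually_elim
    case (elim n)
    have "\<exists>k\<in>{1..n}. x k \<in> U \<and> \<bar>r n k\<bar> \<le> c"
      by (rule exists_small_residual[where p = p]) (use elim that in \<open>auto simp: B_def\<close>)
    then obtain k where k: "k \<in> {1..n}" "x k \<in> U" "\<bar>r n k\<bar> \<le> c" by blast
    then show ?case using Fx[of k n] by (intro bexI[of _ "x k"]) auto
  qed
  have dense: "\<exists>p>0. \<forall>\<^sub>F n in sequentially. p * real n \<le> real (count_in x n U)"
    if "open U" "U \<noteq> {}" "U \<subseteq> interior S" for U
    using reg that by (simp add: regular_path_def)
  have pt: "\<exists>C. \<forall>\<^sub>F n in sequentially. \<exists>u\<in>U. \<bar>F n u\<bar> \<le> ereal C"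
    if U: "open U" "U \<noteq> {}" "U \<subseteq> interior S" for U
  proof (rule bounded_near_points[OF gcont open_interior _ U])
    fix V assume "open V" "V \<noteq> {}" "V \<subseteq> interior S"
    then obtain p where p: "p > 0" "\<forall>\<^sub>F n in sequentially. p * real n \<le> real (count_in x n V)"
      using dense by blast
    \<comment> \<open>This value of \<open>c\<close> makes \<open>p * c\<^sup>2\<close> equal to the
      crude constant \<open>4 * \<bar>C\<bar>\<close>.\<close>
    have peq: "p * (sqrt (4 * \<bar>C\<bar> / p))\<^sup>2 = 4 * \<bar>C\<bar>" using p by simp
    have Bp: "\<forall>\<^sub>F n in sequentially. B n \<le> p * (sqrt (4 * \<bar>C\<bar> / p))\<^sup>2 * real n" unfolding peq by (rule B1)
    have "\<forall>\<^sub>F n in sequentially. \<exists>u\<in>V. \<bar>F n u - ereal (g u)\<bar> \<le> ereal (sqrt (4 * \<bar>C\<bar> / p))"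
      by (rule near[OF p Bp]) (use p in simp)
    then show "\<exists>C. \<forall>\<^sub>F n in sequentially. \<exists>u\<in>V. \<bar>F n u - ereal (g u)\<bar> \<le> ereal C" by blast
  qed
  have B0: "\<forall>\<^sub>F n in sequentially. B n \<le> \<delta> * real n" if \<delta>: "\<delta> > 0" for \<delta>
  proof -
    \<comment> \<open>The bound \<open>\<delta> / 8\<close> is doubled once by \<open>amgm\<close>
      and once by absorbing \<open>B n / 2\<close>, and the basic inequality is doubled with it, so
      the outside costs \<open>\<delta> / 2\<close> in the end.\<close>
    obtain l where l: "\<forall>\<^sub>F n in sequentially. (\<Sum>k=1..n. indicator (- core S l) (x k) * (e k)\<^sup>2) \<le> \<delta> / 8 * real n"
      using reg[unfolded regular_path_def, THEN conjunct2, THEN conjunct2, THEN conjunct2, rule_format, of "\<delta> / 8"] \<delta> by auto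
    define A where "A = core S l"
    have A: "compact A" "A \<subseteq> interior S" using S by (auto simp: A_def compact_core core_subset_interior[THEN subsetD])
    obtain \<rho> D L where \<rho>: "\<rho> > 0" "L > 0" and lip: "\<forall>\<^sub>F n in sequentially. (\<forall>s\<in>A. \<bar>F n s\<bar> \<le> ereal D) \<and>
       (\<forall>u\<in>A. \<forall>v\<in>A. dist u v \<le> \<rho> \<longrightarrow> \<bar>real_of_ereal (F n u) - real_of_ereal (F n v)\<bar> \<le> L * dist u v)"
      by (rule proper_convex_equilipschitz_compact[of F, OF F open_interior A]) (use pt in blast)+
    have gA: "continuous_on A g" using gcont A continuous_on_subset by blast
    obtain D' where D': "\<And>u. u \<in> A \<Longrightarrow> \<bar>g u\<bar> \<le> D'"
      using compact_imp_bounded[OF compact_continuous_image[OF gA A(1)]] unfolding bounded_iff by auto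
    \<comment> \<open>Chosen so that the contribution of the core, at most
      \<open>(4 * \<tau> + 4 * \<tau> * (1 + \<bar>C\<bar>)) * real n\<close>, is the other half of
      \<open>\<delta> * real n\<close>.\<close>
    define \<tau> where "\<tau> = \<delta> / (8 * (2 + \<bar>C\<bar>))"
    have \<tau>: "\<tau> > 0" "4 * \<tau> + 4 * \<tau> * (1 + \<bar>C\<bar>) = \<delta> / 2"
    proof -
      show "\<tau> > 0" using \<delta> by (simp add: \<tau>_def add_pos_nonneg)
      have "\<tau> * (8 * (2 + \<bar>C\<bar>)) = \<delta>" using add_pos_nonneg[of 2 "\<bar>C\<bar>"] by (simp add: \<tau>_def)
      then show "4 * \<tau> + 4 * \<tau> * (1 + \<bar>C\<bar>) = \<delta> / 2" by (simp add: algebra_simps)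
    qed
    obtain d where d: "d > 0" "\<And>u v. u \<in> A \<Longrightarrow> v \<in> A \<Longrightarrow> dist u v < d \<Longrightarrow> dist (g u) (g v) < \<tau> / 2"
      using compact_uniformly_continuous[OF gA A(1)] \<tau> unfolding uniformly_continuous_on_def
      by (metis half_gt_zero dist_commute)
    \<comment> \<open>Cells so small that the fit and \<open>g\<close> each vary by at most
      \<open>\<tau> / 2\<close> on them; \<open>d / 2\<close> gives the strict inequality that
      uniform continuity asks for.\<close>
    define \<delta>' where "\<delta>' = min (min \<rho> (d / 2)) (\<tau> / (2 * L))"
    have \<delta>': "\<delta>' > 0" "\<delta>' \<le> \<rho>" "\<delta>' < d" "L * \<delta>' \<le> \<tau> / 2"
    proof -
      show "\<delta>' > 0" "\<delta>' \<le> \<rho>" "\<delta>' < d" using \<rho> d \<tau> by (auto simp: \<delta>'_def)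
      have "L * \<delta>' \<le> L * (\<tau> / (2 * L))" using \<rho> by (intro mult_left_mono) (auto simp: \<delta>'_def)
      then show "L * \<delta>' \<le> \<tau> / 2" using \<rho> by simp
    qed
    obtain P where P: "finite P" "disjoint P" "\<Union>P = A"
      "\<And>W u v. W \<in> P \<Longrightarrow> u \<in> W \<Longrightarrow> v \<in> W \<Longrightarrow> dist u v \<le> \<delta>'"
      "\<And>W. W \<in> P \<Longrightarrow> (\<lambda>n. (\<Sum>k=1..n. indicator W (x k) * e k) / real n) \<longlonglongrightarrow> 0"
      using reg \<delta>'(1) unfolding regular_path_def A_def by meson
    have "(\<lambda>n. (\<bar>D\<bar> + \<bar>D'\<bar>) * (\<Sum>W\<in>P. \<bar>(\<Sum>k=1..n. indicator W (x k) * e k) / real n\<bar>)) \<longlonglongrightarrow> (\<bar>D\<bar> + \<bar>D'\<bar>) * (\<Sum>W\<in>P. \<bar>0\<bar>)"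
      by (intro tendsto_intros P(5))
    then have "\<forall>\<^sub>F n in sequentially. (\<bar>D\<bar> + \<bar>D'\<bar>) * (\<Sum>W\<in>P. \<bar>(\<Sum>k=1..n. indicator W (x k) * e k) / real n\<bar>) < \<tau>"
      using \<tau> by (intro order_tendstoD(2)) auto
    then show ?thesis
      using lip l C eventually_gt_at_top[of 0]
    proof eventually_elim
      case (elim n)
      define h where "h u = real_of_ereal (F n u) - g u" for u
      have hr: "h (x k) = r n k" if "k \<in> {1..n}" for k using Fx[OF that] by (simp add: h_def)
      have hb: "\<bar>h u\<bar> \<le> \<bar>D\<bar> + \<bar>D'\<bar>" if "u \<in> A" for u
      proof -
        have "\<bar>F n u\<bar> \<le> ereal D" using elim(2) that by blast
        then have "\<bar>real_of_ereal (F n u)\<bar> \<le> D" by (cases "F n u") auto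
        then show ?thesis using D'[OF that] unfolding h_def by linarith
      qed
      have osc: "\<bar>h u - h v\<bar> \<le> \<tau>" if W: "W \<in> P" "u \<in> W" "v \<in> W" for W u v
      proof -
        have A': "u \<in> A" "v \<in> A" using W P(3) by auto
        have dist: "dist u v \<le> \<delta>'" using P(4) W by blast
        then have "\<bar>real_of_ereal (F n u) - real_of_ereal (F n v)\<bar> \<le> L * dist u v"
          using elim(2) A' \<delta>'(2) by (meson order_trans)
        also have "\<dots> \<le> L * \<delta>'" using dist \<rho> by (intro mult_left_mono) auto
        also have "\<dots> \<le> \<tau> / 2" by (rule \<delta>'(4))
        finally have 1: "\<bar>real_of_ereal (F n u) - real_of_ereal (F n v)\<bar> \<le> \<tau> / 2" .
        have "dist (g u) (g v) < \<tau> / 2" using dist \<delta>' by (intro d(2) A') auto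
        then show ?thesis using 1 unfolding h_def dist_real_def by linarith
      qed
      have n: "real n > 0" using elim by simp
      \<comment> \<open>The noise energy also controls the absolute noise, by comparing each term
        with \<open>1 + (e k)\<^sup>2\<close>.\<close>
      have abs_e: "(\<Sum>k=1..n. \<bar>e k\<bar>) \<le> (1 + \<bar>C\<bar>) * real n"
      proof -
        have "(\<Sum>k=1..n. \<bar>e k\<bar>) \<le> (\<Sum>k=1..n. 1 + (e k)\<^sup>2)"
        proof (intro sum_mono)
          fix k show "\<bar>e k\<bar> \<le> 1 + (e k)\<^sup>2"
            using zero_le_power2[of "\<bar>e k\<bar> - 1"] abs_ge_zero[of "e k"]
            by (simp add: power2_eq_square algebra_simps del: abs_ge_zero)
        qed
        also have "\<dots> = real n + (\<Sum>k=1..n. (e k)\<^sup>2)" by (simp add: sum.distrib)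
        also have "\<dots> \<le> real n + C * real n" using elim by simp
        also have "C * real n \<le> \<bar>C\<bar> * real n" by (simp add: mult_right_mono)
        finally show ?thesis by (simp add: algebra_simps)
      qed
      have in_A: "(\<Sum>k=1..n. indicator A (x k) * (e k * r n k)) \<le> \<tau> * real n + \<tau> * ((1 + \<bar>C\<bar>) * real n)"
      proof -
        have "(\<Sum>k=1..n. indicator A (x k) * (e k * r n k)) = (\<Sum>k=1..n. indicator A (x k) * (e k * h (x k)))"
          by (intro sum.cong) (simp_all add: hr)
        also have "\<dots> \<le> \<bar>\<bar>D\<bar> + \<bar>D'\<bar>\<bar> * (\<Sum>W\<in>P. \<bar>\<Sum>k=1..n. indicator W (x k) * e k\<bar>) + \<tau> * (\<Sum>k=1..n. \<bar>e k\<bar>)"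
          using hb osc \<tau> by (intro partition_noise_bound P(1-3)) auto
        also have "(\<Sum>W\<in>P. \<bar>\<Sum>k=1..n. indicator W (x k) * e k\<bar>) = (\<Sum>W\<in>P. \<bar>(\<Sum>k=1..n. indicator W (x k) * e k) / real n\<bar>) * real n"
          using n by (simp add: sum_distrib_right abs_divide)
        also have "\<bar>\<bar>D\<bar> + \<bar>D'\<bar>\<bar> * ((\<Sum>W\<in>P. \<bar>(\<Sum>k=1..n. indicator W (x k) * e k) / real n\<bar>) * real n) \<le> \<tau> * real n"
          using elim(1) n unfolding mult.assoc[symmetric] by (intro mult_right_mono) auto
        also have "\<tau> * (\<Sum>k=1..n. \<bar>e k\<bar>) \<le> \<tau> * ((1 + \<bar>C\<bar>) * real n)"
          using abs_e \<tau> by (intro mult_left_mono) auto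
        finally show ?thesis by simp
      qed
      have out_A: "2 * (\<Sum>k=1..n. indicator (- A) (x k) * (e k * r n k)) \<le> \<delta> / 4 * real n + B n / 2"
      proof -
        have "2 * (\<Sum>k=1..n. indicator (- A) (x k) * (e k * r n k))
            \<le> (\<Sum>k=1..n. 2 * (indicator (- A) (x k) * (e k)\<^sup>2) + (r n k)\<^sup>2 / 2)"
          unfolding sum_distrib_left
        proof (intro sum_mono)
          fix k show "2 * (indicator (- A) (x k) * (e k * r n k)) \<le> 2 * (indicator (- A) (x k) * (e k)\<^sup>2) + (r n k)\<^sup>2 / 2"
            using amgm[of "e k" "r n k"] by (cases "x k \<in> A") auto
        qed
        also have "\<dots> = 2 * (\<Sum>k=1..n. indicator (- A) (x k) * (e k)\<^sup>2) + B n / 2"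
          unfolding sum.distrib sum_distrib_left[symmetric] sum_divide_distrib[symmetric] B_def ..
        finally show ?thesis using elim(3) by (simp add: A_def)
      qed
      have "(\<Sum>k=1..n. e k * r n k) = (\<Sum>k=1..n. indicator A (x k) * (e k * r n k)) + (\<Sum>k=1..n. indicator (- A) (x k) * (e k * r n k))"
        unfolding sum.distrib[symmetric] by (intro sum.cong) (auto simp: indicator_def)
      \<comment> \<open>The term \<open>B n / 2\<close> of \<open>out_A\<close> moves to the left,
        which doubles the other terms.\<close>
      then have "B n \<le> 4 * (\<Sum>k=1..n. indicator A (x k) * (e k * r n k)) + 2 * (\<delta> / 4 * real n)"
        using basic[of n] out_A by linarith
      also have "\<dots> \<le> 4 * (\<tau> * real n + \<tau> * ((1 + \<bar>C\<bar>) * real n)) + \<delta> / 2 * real n"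
        using in_A by simp
      also have "\<dots> = (4 * \<tau> + 4 * \<tau> * (1 + \<bar>C\<bar>)) * real n + \<delta> / 2 * real n" by (simp add: algebra_simps)
      also have "\<dots> = \<delta> * real n" by (simp add: \<tau>(2))
      finally show ?case .
    qed
  qed
  have "\<forall>\<^sub>F n in sequentially. \<exists>u\<in>U. \<bar>F n u - ereal (g u)\<bar> \<le> ereal c"
    if U: "open U" "U \<noteq> {}" "U \<subseteq> interior S" and c: "c > 0" for U c
  proof -
    obtain p where p: "p > 0" "\<forall>\<^sub>F n in sequentially. p * real n \<le> real (count_in x n U)"
      using dense[OF U] by blast
    show ?thesis using p c B0[of "p * c\<^sup>2"] by (intro near) auto
  qed
  then show ?thesis
    unfolding F_def[symmetric] by (intro proper_convex_uniform_convergence[OF F open_interior gcont _ K \<eta>])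
qed

section \<open>Strong laws of large numbers\<close>

text \<open>The sum starts at the first power below \<open>c\<close>, so it is at most
  \<open>c\<close> times a full geometric series.\<close>

lemma sum_geometric_below_le:
  fixes q c :: real
  assumes q: "0 < q" "q < 1" and c: "c \<ge> 0"
  shows "(\<Sum>i<N. if q ^ i \<le> c then q ^ i else 0) \<le> c / (1 - q)"
proof (cases "\<exists>i. q ^ i \<le> c")
  case False
  then show ?thesis using q c by simp
next
  case True
  define i0 where "i0 = (LEAST i. q ^ i \<le> c)"
  have i0: "q ^ i0 \<le> c" and least: "\<And>i. q ^ i \<le> c \<Longrightarrow> i0 \<le> i"
    using True LeastI_ex[of "\<lambda>i. q ^ i \<le> c"] Least_le[of "\<lambda>i. q ^ i \<le> c"] by (auto simp: i0_def)
  have "(\<Sum>i<N. if q ^ i \<le> c then q ^ i else 0) \<le> (\<Sum>i<N. if i0 \<le> i then q ^ i else 0)"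
    using q least by (intro sum_mono) auto
  also have "\<dots> = (\<Sum>i\<in>{i0..<N}. q ^ i)"
    by (subst sum.inter_filter[symmetric]) (auto intro!: sum.cong)
  also have "\<dots> \<le> (\<Sum>i\<in>{i0..<N + i0}. q ^ i)"
    using q by (intro sum_mono2) auto
  also have "\<dots> = q ^ i0 * (\<Sum>i<N. q ^ i)"
    by (simp add: sum.shift_bounds_nat_ivl[of _ 0 i0 N, simplified] power_add sum_distrib_left atLeast0LessThan mult.commute)
  also have "(\<Sum>i<N. q ^ i) \<le> 1 / (1 - q)"
    using q by (simp add: sum_gp_strict divide_right_mono)
  then have "q ^ i0 * (\<Sum>i<N. q ^ i) \<le> c * (1 / (1 - q))"
    using i0 q c by (intro mult_mono) (auto intro!: sum_nonneg)
  finally show ?thesis by simp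
qed

lemma floor_power_bounds:
  fixes \<alpha> :: real
  assumes "\<alpha> > 1"
  shows "real (nat \<lfloor>\<alpha> ^ i\<rfloor>) \<le> \<alpha> ^ i" "\<alpha> ^ i / 2 \<le> real (nat \<lfloor>\<alpha> ^ i\<rfloor>)" "\<alpha> ^ i < real (nat \<lfloor>\<alpha> ^ i\<rfloor>) + 1"
    "1 \<le> nat \<lfloor>\<alpha> ^ i\<rfloor>"
proof -
  have "\<alpha> ^ i \<ge> 1" using assms by simp
  then have "\<lfloor>\<alpha> ^ i\<rfloor> \<ge> 1" by (simp add: le_floor_iff)
  then have eq: "real (nat \<lfloor>\<alpha> ^ i\<rfloor>) = of_int \<lfloor>\<alpha> ^ i\<rfloor>" "real_of_int \<lfloor>\<alpha> ^ i\<rfloor> \<ge> 1" by simp_all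
  show "real (nat \<lfloor>\<alpha> ^ i\<rfloor>) \<le> \<alpha> ^ i" "\<alpha> ^ i < real (nat \<lfloor>\<alpha> ^ i\<rfloor>) + 1" unfolding eq(1) by linarith+
  show "\<alpha> ^ i / 2 \<le> real (nat \<lfloor>\<alpha> ^ i\<rfloor>)" using eq(2) unfolding eq(1) by linarith
  show "1 \<le> nat \<lfloor>\<alpha> ^ i\<rfloor>" using \<open>\<lfloor>\<alpha> ^ i\<rfloor> \<ge> 1\<close> by linarith
qed

text \<open>The kernel that arises when variances along a geometric subsequence are rearranged:
  variable \<open>k\<close> enters every partial sum of length at least \<open>k\<close>. The factor
  4 pays for rounding, which loses at most half before squaring; the ratio of the series is
  \<open>1 / \<alpha>\<^sup>2\<close>.\<close>

lemma sum_inverse_floor_powers_le: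
  fixes \<alpha> :: real
  assumes \<alpha>: "\<alpha> > 1" and k: "k \<ge> 1"
  shows "(\<Sum>i<N. if k \<le> nat \<lfloor>\<alpha> ^ i\<rfloor> then 1 / (real (nat \<lfloor>\<alpha> ^ i\<rfloor>))\<^sup>2 else 0)
    \<le> 4 / (1 - 1 / \<alpha>\<^sup>2) * (1 / (real k)\<^sup>2)"
proof -
  define q where "q = 1 / \<alpha>\<^sup>2"
  have q: "0 < q" "q < 1" using \<alpha> by (auto simp: q_def)
  have "(if k \<le> nat \<lfloor>\<alpha> ^ i\<rfloor> then 1 / (real (nat \<lfloor>\<alpha> ^ i\<rfloor>))\<^sup>2 else 0)
      \<le> 4 * (if q ^ i \<le> 1 / (real k)\<^sup>2 then q ^ i else 0)" for i
  proof (cases "k \<le> nat \<lfloor>\<alpha> ^ i\<rfloor>")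
    case True
    have qi: "q ^ i = 1 / (\<alpha> ^ i)\<^sup>2" by (simp add: q_def power_one_over power_mult[symmetric] mult.commute)
    have "real k \<le> \<alpha> ^ i" using True floor_power_bounds(1)[OF \<alpha>, of i] by linarith
    then have "(real k)\<^sup>2 \<le> (\<alpha> ^ i)\<^sup>2" by (intro power_mono) auto
    then have 1: "q ^ i \<le> 1 / (real k)\<^sup>2" unfolding qi using k \<alpha> by (intro divide_left_mono) auto
    have "(\<alpha> ^ i / 2)\<^sup>2 \<le> (real (nat \<lfloor>\<alpha> ^ i\<rfloor>))\<^sup>2"
      using floor_power_bounds(2)[OF \<alpha>, of i] \<alpha> by (intro power_mono) auto
    then have "1 / (real (nat \<lfloor>\<alpha> ^ i\<rfloor>))\<^sup>2 \<le> 1 / (\<alpha> ^ i / 2)\<^sup>2"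
      using \<alpha> floor_power_bounds(4)[OF \<alpha>, of i] by (intro divide_left_mono) auto
    also have "\<dots> = 4 * q ^ i" unfolding qi by (simp add: power_divide)
    finally show ?thesis using 1 True by simp
  qed (use q in auto)
  then have "(\<Sum>i<N. if k \<le> nat \<lfloor>\<alpha> ^ i\<rfloor> then 1 / (real (nat \<lfloor>\<alpha> ^ i\<rfloor>))\<^sup>2 else 0)
      \<le> (\<Sum>i<N. 4 * (if q ^ i \<le> 1 / (real k)\<^sup>2 then q ^ i else 0))"
    by (intro sum_mono)
  also have "\<dots> \<le> 4 * ((1 / (real k)\<^sup>2) / (1 - q))"
    unfolding sum_distrib_left[symmetric] using q by (intro mult_left_mono sum_geometric_below_le) auto
  finally show ?thesis by (simp add: q_def mult.commute)
qed

text \<open>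
  Monotonicity of \<open>s\<close> bridges the gap between consecutive terms of a geometric subsequence: this
  costs a factor \<open>\<alpha>\<close>, which is then sent to 1.
\<close>

lemma tendsto_from_geometric_subsequences:
  fixes s m :: "nat \<Rightarrow> real"
  assumes s: "\<And>i j. i \<le> j \<Longrightarrow> s i \<le> s j"
    and m: "\<And>i j. i \<le> j \<Longrightarrow> m i \<le> m j" "\<And>i j. i \<le> j \<Longrightarrow> m j - m i \<le> C * real (j - i)"
    and sub: "\<And>l. (\<lambda>i. (s (nat \<lfloor>(1 + 1 / real (Suc l)) ^ i\<rfloor>) - m (nat \<lfloor>(1 + 1 / real (Suc l)) ^ i\<rfloor>))
        / real (nat \<lfloor>(1 + 1 / real (Suc l)) ^ i\<rfloor>)) \<longlonglongrightarrow> 0"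
  shows "(\<lambda>n. (s n - m n) / real n) \<longlonglongrightarrow> 0"
proof (rule LIMSEQ_I)
  fix e :: real assume e: "e > 0"
  have C: "C \<ge> 0" using m(1)[of 0 1] m(2)[of 0 1] by simp
  \<comment> \<open>\<open>C / real (Suc l)\<close> is the relative growth of the means between
    consecutive terms, as \<open>\<alpha> - 1\<close> is \<open>1 / real (Suc l)\<close>.\<close>
  obtain l where l: "C / real (Suc l) < e / 4"
  proof -
    obtain l where "real l > 4 * C / e" using reals_Archimedean2 by blast
    then have "4 * C / e < real (Suc l)" by simp
    then have "C / real (Suc l) < e / 4" using e by (simp add: field_simps)
    then show ?thesis by (rule that)
  qed
  define \<alpha> where "\<alpha> = 1 + 1 / real (Suc l)"
  have \<alpha>: "\<alpha> > 1" "\<alpha> \<le> 2" by (auto simp: \<alpha>_def field_simps)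
  define k where "k i = nat \<lfloor>\<alpha> ^ i\<rfloor>" for i
  have k1: "k i \<ge> 1" for i unfolding k_def by (rule floor_power_bounds(4)[OF \<alpha>(1)])
  have kmono: "k i \<le> k j" if "i \<le> j" for i j
    unfolding k_def using \<alpha> that by (intro nat_mono floor_mono power_increasing) auto
  have "(\<lambda>i. (s (k i) - m (k i)) / real (k i)) \<longlonglongrightarrow> 0" using sub[of l] by (simp add: k_def \<alpha>_def)
  \<comment> \<open>A twelfth, because the next term of the subsequence may be three times as long,
    which makes it a quarter relative to \<open>k i\<close>.\<close>
  from LIMSEQ_D[OF this, of "e / 12"] e
  obtain I1 where I1: "\<And>i. i \<ge> I1 \<Longrightarrow> \<bar>(s (k i) - m (k i)) / real (k i)\<bar> < e / 12"
    unfolding real_norm_def diff_zero by (meson divide_pos_pos zero_less_numeral)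
  \<comment> \<open>Beyond \<open>I2\<close> the rounding of the powers, which adds
    \<open>2 * C\<close> to the gap of the means, is small relative to \<open>k i\<close>.\<close>
  obtain I2 where "16 * (C + 1) / e + 1 < \<alpha> ^ I2" using real_arch_pow[OF \<alpha>(1)] by blast
  then have I2: "\<alpha> ^ i \<ge> 16 * (C + 1) / e + 1" if "i \<ge> I2" for i
    using power_increasing[OF that, of \<alpha>] \<alpha>(1) by linarith
  have kbig: "C * 4 / real (k i) \<le> e / 4" if "i \<ge> I2" for i
  proof -
    have "16 * (C + 1) / e < real (k i)" using I2[OF that] floor_power_bounds(3)[OF \<alpha>(1), of i] by (simp add: k_def)
    then have "16 * (C + 1) < real (k i) * e" using e by (simp add: field_simps)
    then show ?thesis using k1[of i] C by (simp add: field_simps)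
  qed
  have bound: "\<bar>(s n - m n) / real n\<bar> < e" if n: "n \<ge> k (max I1 I2)" for n
  proof -
    have ex: "\<exists>i. n < k i"
    proof -
      obtain i where "real n + 2 < \<alpha> ^ i" using real_arch_pow[OF \<alpha>(1)] by blast
      then have "real n < real (k i)" using floor_power_bounds(3)[OF \<alpha>(1), of i] unfolding k_def by linarith
      then show ?thesis by auto
    qed
    \<comment> \<open>The first term beyond \<open>n\<close>; its predecessor exists by the choice
      of \<open>n\<close> and is at most \<open>n\<close>.\<close>
    define j where "j = (LEAST i. n < k i)"
    have j: "n < k j" using ex LeastI_ex[of "\<lambda>i. n < k i"] by (simp add: j_def)
    have jmin: "k i \<le> n" if "i < j" for i using not_less_Least[of i "\<lambda>i. n < k i"] that by (auto simp: j_def)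
    have jgt: "max I1 I2 < j" using n j kmono[of j "max I1 I2"] by (meson leD leI order_trans)
    define i where "i = j - 1"
    have ji: "j = Suc i" "i \<ge> I1" "i \<ge> I2" using jgt by (auto simp: i_def)
    have kn: "k i \<le> n" "n \<le> k (Suc i)" using jmin[of i] j ji by auto
    have gap: "real (k (Suc i)) - real (k i) \<le> (\<alpha> - 1) * real (k i) + 2"
    proof -
      have "real (k (Suc i)) \<le> \<alpha> * \<alpha> ^ i" using floor_power_bounds(1)[OF \<alpha>(1), of "Suc i"] by (simp add: k_def)
      also have "\<dots> \<le> \<alpha> * (real (k i) + 1)"
        using floor_power_bounds(3)[OF \<alpha>(1), of i] \<alpha> by (intro mult_left_mono) (auto simp: k_def)
      finally show ?thesis using \<alpha> by (simp add: algebra_simps)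
    qed
    have mgap: "m (k (Suc i)) - m (k i) \<le> C * ((\<alpha> - 1) * real (k i) + 2)"
    proof -
      have "m (k (Suc i)) - m (k i) \<le> C * real (k (Suc i) - k i)" by (intro m(2) kmono) auto
      also have "\<dots> \<le> C * ((\<alpha> - 1) * real (k i) + 2)"
        using gap C kmono[of i "Suc i"] by (intro mult_left_mono) (auto simp: of_nat_diff)
      finally show ?thesis .
    qed
    have ki0: "real (k i) > 0" using k1[of i] by simp
    have "real (k (Suc i)) \<le> 3 * real (k i)"
    proof -
      have "(\<alpha> - 1) * real (k i) \<le> 1 * real (k i)" using \<alpha> by (intro mult_right_mono) auto
      moreover have "\<alpha> * \<alpha> ^ i < 2 * (real (k i) + 1)"
        using floor_power_bounds(3)[OF \<alpha>(1), of i] \<alpha> by (intro mult_le_less_imp_less) (auto simp: k_def)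
      moreover have "real (k (Suc i)) \<le> \<alpha> * \<alpha> ^ i" using floor_power_bounds(1)[OF \<alpha>(1), of "Suc i"] by (simp add: k_def)
      ultimately have "real (k (Suc i)) < 2 * (real (k i) + 1)" by linarith
      then have "real (k (Suc i)) < real (2 * (k i + 1))" by simp
      then have "k (Suc i) < 2 * (k i + 1)" by (simp only: of_nat_less_iff)
      then have "k (Suc i) \<le> 3 * k i" using k1[of i] by simp
      then have "real (k (Suc i)) \<le> real (3 * k i)" by (simp only: of_nat_le_iff)
      then show ?thesis by simp
    qed
    then have "e / 12 * real (k (Suc i)) \<le> e / 12 * (3 * real (k i))" using e by (intro mult_left_mono) auto
    moreover have "\<bar>s (k (Suc i)) - m (k (Suc i))\<bar> < e / 12 * real (k (Suc i))" "\<bar>s (k i) - m (k i)\<bar> < e / 12 * real (k i)"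
      using I1[of i] I1[of "Suc i"] ji k1[of i] k1[of "Suc i"] by (auto simp: abs_divide divide_less_eq)
    ultimately have dev: "\<bar>s (k (Suc i)) - m (k (Suc i))\<bar> < e / 4 * real (k i)" "\<bar>s (k i) - m (k i)\<bar> < e / 4 * real (k i)"
      using mult_pos_pos[OF e ki0] by auto
    have small: "C * ((\<alpha> - 1) * real (k i) + 2) \<le> e / 4 * real (k i) + e / 4 * real (k i)"
    proof -
      have "C * (\<alpha> - 1) * real (k i) \<le> e / 4 * real (k i)"
        using l by (intro mult_right_mono) (auto simp: \<alpha>_def)
      moreover have "C * 2 \<le> e / 4 * real (k i)"
      proof -
        have "C * 4 \<le> e / 4 * real (k i)" using kbig[OF ji(3)] ki0 by (simp add: divide_le_eq)
        then show ?thesis using C by linarith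
      qed
      ultimately show ?thesis by (simp add: algebra_simps)
    qed
    \<comment> \<open>By monotonicity \<open>s n\<close> is compared with the term above and
      \<open>m n\<close> with the term below, and the other way round for the lower bound.\<close>
    have "s n - m n \<le> (s (k (Suc i)) - m (k (Suc i))) + (m (k (Suc i)) - m (k i))"
      using s[OF kn(2)] m(1)[OF kn(1)] by linarith
    moreover have "s n - m n \<ge> (s (k i) - m (k i)) - (m (k (Suc i)) - m (k i))"
      using s[OF kn(1)] m(1)[OF kn(2)] by linarith
    ultimately have "\<bar>s n - m n\<bar> < 3 * (e / 4) * real (k i)"
      using dev mgap small by (simp add: abs_if split: if_splits)
    also have "\<dots> \<le> e * real n" using kn(1) e by (intro mult_mono) auto
    finally show ?thesis using kn(1) ki0 by (simp add: abs_divide divide_less_eq)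
  qed
  then show "\<exists>no. \<forall>n\<ge>no. norm ((s n - m n) / real n - 0) < e" by (intro exI[of _ "k (max I1 I2)"]) auto
qed

lemma cesaro_mean_tendsto_0:
  fixes a :: "nat \<Rightarrow> real"
  assumes "a \<longlonglongrightarrow> 0"
  shows "(\<lambda>n. (\<Sum>k=1..n. a k) / real n) \<longlonglongrightarrow> 0"
proof (rule LIMSEQ_I)
  fix e :: real assume e: "e > 0"
  obtain N where N: "\<And>k. k \<ge> N \<Longrightarrow> \<bar>a k\<bar> < e / 2"
    using LIMSEQ_D[OF assms, of "e / 2"] e by auto
  define c where "c = (\<Sum>k=1..N. \<bar>a k\<bar>)"
  obtain N' where N': "real N' > 2 * c / e" using reals_Archimedean2 by blast
  have "norm ((\<Sum>k=1..n. a k) / real n - 0) < e" if n: "n \<ge> max 1 (max N N')" for n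
  proof -
    have n0: "real n > 0" using n by simp
    have "\<bar>\<Sum>k=1..n. a k\<bar> \<le> (\<Sum>k=1..n. \<bar>a k\<bar>)" by (rule sum_abs)
    also have "\<dots> \<le> (\<Sum>k=1..n. (if k \<le> N then \<bar>a k\<bar> else 0) + e / 2)"
      using N e by (intro sum_mono) (auto simp: less_imp_le)
    also have "\<dots> = c + e / 2 * real n"
    proof -
      have "(\<Sum>k=1..n. (if k \<le> N then \<bar>a k\<bar> else 0)) = c"
        unfolding c_def using n by (subst sum.inter_filter[symmetric]) (auto intro!: sum.cong)
      then show ?thesis by (simp add: sum.distrib)
    qed
    also have "c < e / 2 * real n"
    proof -
      have "2 * c / e < real n" using N' n by linarith
      then show ?thesis using e by (simp add: field_simps)
    qed
    finally have "\<bar>\<Sum>k=1..n. a k\<bar> < e * real n" by simp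
    then show ?thesis using n0 by (simp add: abs_divide divide_less_eq)
  qed
  then show "\<exists>no. \<forall>n\<ge>no. norm ((\<Sum>k=1..n. a k) / real n - 0) < e" by blast
qed

section \<open>Strong laws for independent nonnegative variables\<close>

context prob_space
begin

lemma variance_sum_indep:
  fixes W :: "'i \<Rightarrow> 'a \<Rightarrow> real"
  assumes ind: "indep_vars (\<lambda>_. borel) W I" and fin: "finite J" "J \<subseteq> I"
    and sq: "\<And>i. i \<in> J \<Longrightarrow> integrable M (\<lambda>\<omega>. (W i \<omega>)\<^sup>2)"
  shows "integrable M (\<lambda>\<omega>. ((\<Sum>i\<in>J. W i \<omega>) - (\<Sum>i\<in>J. expectation (W i)))\<^sup>2)"
    and "expectation (\<lambda>\<omega>. ((\<Sum>i\<in>J. W i \<omega>) - (\<Sum>i\<in>J. expectation (W i)))\<^sup>2) = (\<Sum>i\<in>J. variance (W i))"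
proof -
  have rv: "random_variable borel (W i)" if "i \<in> J" for i
    using ind that fin(2) by (auto simp: indep_vars_def)
  have int: "integrable M (W i)" if "i \<in> J" for i
    using square_integrable_imp_integrable[OF rv sq] that by auto
  define D where "D i \<omega> = W i \<omega> - expectation (W i)" for i \<omega>
  have D2: "integrable M (\<lambda>\<omega>. (D i \<omega>)\<^sup>2)" if "i \<in> J" for i
    unfolding D_def power2_diff using that sq int by (intro Bochner_Integration.integrable_add Bochner_Integration.integrable_diff) auto
  have prod: "integrable M (\<lambda>\<omega>. D i \<omega> * D j \<omega>) \<and>
      expectation (\<lambda>\<omega>. D i \<omega> * D j \<omega>) = (if i = j then variance (W i) else 0)" if ij: "i \<in> J" "j \<in> J" for i j
  proof (cases "i = j")
    case True
    then show ?thesis using D2[OF ij(1)] by (simp add: D_def power2_eq_square)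
  next
    case False
    have "indep_vars (\<lambda>_. borel) (\<lambda>i \<omega>. W i \<omega> - expectation (W i)) {i, j}"
      by (rule indep_vars_compose2[OF indep_vars_subset[OF ind]]) (use ij fin(2) in auto)
    then have ind2: "indep_vars (\<lambda>_. borel) D {i, j}" by (simp add: D_def[abs_def])
    have Dint: "integrable M (D k)" if "k \<in> {i, j}" for k
      using int ij that by (auto simp: D_def[abs_def])
    have "expectation (D i) = 0" using int ij by (simp add: D_def[abs_def] prob_space)
    then show ?thesis
      using False indep_vars_integrable[OF _ ind2 Dint] indep_vars_lebesgue_integral[OF _ ind2 Dint] by simp
  qed
  have eq: "((\<Sum>i\<in>J. W i \<omega>) - (\<Sum>i\<in>J. expectation (W i)))\<^sup>2 = (\<Sum>i\<in>J. \<Sum>j\<in>J. D i \<omega> * D j \<omega>)" for \<omega>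
    unfolding D_def power2_eq_square sum_product[symmetric] sum_subtractf ..
  show "integrable M (\<lambda>\<omega>. ((\<Sum>i\<in>J. W i \<omega>) - (\<Sum>i\<in>J. expectation (W i)))\<^sup>2)"
    unfolding eq using prod by (intro Bochner_Integration.integrable_sum) auto
  show "expectation (\<lambda>\<omega>. ((\<Sum>i\<in>J. W i \<omega>) - (\<Sum>i\<in>J. expectation (W i)))\<^sup>2) = (\<Sum>i\<in>J. variance (W i))"
  proof -
    have "expectation (\<lambda>\<omega>. \<Sum>i\<in>J. \<Sum>j\<in>J. D i \<omega> * D j \<omega>) = (\<Sum>i\<in>J. expectation (\<lambda>\<omega>. \<Sum>j\<in>J. D i \<omega> * D j \<omega>))"
      using prod by (intro Bochner_Integration.integral_sum Bochner_Integration.integrable_sum) auto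
    also have "\<dots> = (\<Sum>i\<in>J. \<Sum>j\<in>J. expectation (\<lambda>\<omega>. D i \<omega> * D j \<omega>))"
      using prod by (intro sum.cong refl Bochner_Integration.integral_sum) auto
    also have "\<dots> = (\<Sum>i\<in>J. \<Sum>j\<in>J. if i = j then variance (W i) else 0)"
      using prod by (intro sum.cong refl) auto
    also have "\<dots> = (\<Sum>i\<in>J. variance (W i))" using fin by simp
    finally show ?thesis unfolding eq .
  qed
qed

text \<open>Stands in for Chebyshev's inequality with the Borel-Cantelli lemma: a series of
  nonnegative variables with summable expectations is almost surely finite.\<close>

lemma AE_tendsto_0_of_summable_expectation:
  fixes f :: "nat \<Rightarrow> 'a \<Rightarrow> real"
  assumes int: "\<And>i. integrable M (f i)" and nonneg: "\<And>i \<omega>. f i \<omega> \<ge> 0"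
    and sum: "summable (\<lambda>i. expectation (f i))"
  shows "AE \<omega> in M. (\<lambda>i. f i \<omega>) \<longlonglongrightarrow> 0"
proof -
  have "(\<integral>\<^sup>+\<omega>. (\<Sum>i. ennreal (f i \<omega>)) \<partial>M) = (\<Sum>i. \<integral>\<^sup>+\<omega>. ennreal (f i \<omega>) \<partial>M)"
    using int by (intro nn_integral_suminf) auto
  also have "\<dots> = (\<Sum>i. ennreal (expectation (f i)))"
    using int nonneg by (subst nn_integral_eq_integral) auto
  also have "\<dots> = ennreal (\<Sum>i. expectation (f i))"
    using sum nonneg by (intro suminf_ennreal2) auto
  also have "\<dots> \<noteq> \<infinity>" by simp
  finally have "AE \<omega> in M. (\<Sum>i. ennreal (f i \<omega>)) \<noteq> \<infinity>"
    using int by (intro nn_integral_PInf_AE) auto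
  then show ?thesis
  proof eventually_elim
    case (elim \<omega>)
    then have "summable (\<lambda>i. f i \<omega>)" using nonneg by (intro summable_suminf_not_top) auto
    then show ?case by (rule summable_LIMSEQ_zero)
  qed
qed

text \<open>Along a geometric subsequence the scaled variances of the partial sums are summable, as
  an exchange of the two sums shows. Nonnegativity makes partial sums monotone and the bounded means
  control the gaps, so the whole sequence follows.\<close>

theorem slln_nonneg_variance:
  fixes W :: "nat \<Rightarrow> 'a \<Rightarrow> real"
  assumes ind: "indep_vars (\<lambda>_. borel) W {1..}" and nonneg: "\<And>k \<omega>. k \<ge> 1 \<Longrightarrow> W k \<omega> \<ge> 0"
    and sq: "\<And>k. k \<ge> 1 \<Longrightarrow> integrable M (\<lambda>\<omega>. (W k \<omega>)\<^sup>2)"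
    and mean: "\<And>k. k \<ge> 1 \<Longrightarrow> expectation (W k) \<le> C"
    and var: "\<And>N. (\<Sum>k=1..N. variance (W k) / (real k)\<^sup>2) \<le> V"
  shows "AE \<omega> in M. (\<lambda>n. (\<Sum>k=1..n. W k \<omega> - expectation (W k)) / real n) \<longlonglongrightarrow> 0"
proof -
  define s where "s \<omega> n = (\<Sum>k=1..n. W k \<omega>)" for \<omega> n
  define m where "m n = (\<Sum>k=1..n. expectation (W k))" for n
  have Enonneg: "expectation (W k) \<ge> 0" if "k \<ge> 1" for k using nonneg[OF that] by (intro Bochner_Integration.integral_nonneg) auto
  have geom: "AE \<omega> in M. (\<lambda>i. (s \<omega> (nat \<lfloor>\<alpha> ^ i\<rfloor>) - m (nat \<lfloor>\<alpha> ^ i\<rfloor>)) / real (nat \<lfloor>\<alpha> ^ i\<rfloor>)) \<longlonglongrightarrow> 0"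
    if \<alpha>: "\<alpha> > 1" for \<alpha> :: real
  proof -
    define k where "k i = nat \<lfloor>\<alpha> ^ i\<rfloor>" for i
    define f where "f i \<omega> = ((s \<omega> (k i) - m (k i)) / real (k i))\<^sup>2" for i \<omega>
    have fint: "integrable M (f i)" and fexp: "expectation (f i) = (\<Sum>j=1..k i. variance (W j)) / (real (k i))\<^sup>2" for i
      using variance_sum_indep[OF ind, of "{1..k i}"] sq
      by (auto simp: f_def[abs_def] power_divide s_def m_def)
    have "(\<Sum>i<N. expectation (f i)) \<le> 4 / (1 - 1 / \<alpha>\<^sup>2) * V" for N
    proof -
      define K where "K = (\<Sum>i<N. k i)"
      have kK: "k i \<le> K" if "i < N" for i unfolding K_def using that by (intro member_le_sum) auto
      have "(\<Sum>i<N. expectation (f i)) = (\<Sum>i<N. \<Sum>j=1..K. variance (W j) * (if j \<le> k i then 1 / (real (k i))\<^sup>2 else 0))"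
      proof (intro sum.cong refl)
        fix i assume "i \<in> {..<N}"
        then have "k i \<le> K" using kK by simp
        then have "(\<Sum>j=1..K. variance (W j) * (if j \<le> k i then 1 / (real (k i))\<^sup>2 else 0)) = (\<Sum>j=1..k i. variance (W j) * (1 / (real (k i))\<^sup>2))"
          by (intro sum.mono_neutral_cong_right) auto
        then show "expectation (f i) = (\<Sum>j=1..K. variance (W j) * (if j \<le> k i then 1 / (real (k i))\<^sup>2 else 0))"
          by (simp add: fexp sum_divide_distrib)
      qed
      also have "\<dots> = (\<Sum>j=1..K. variance (W j) * (\<Sum>i<N. if j \<le> k i then 1 / (real (k i))\<^sup>2 else 0))"
        by (subst sum.swap) (simp add: sum_distrib_left)
      also have "\<dots> \<le> (\<Sum>j=1..K. variance (W j) * (4 / (1 - 1 / \<alpha>\<^sup>2) * (1 / (real j)\<^sup>2)))"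
        unfolding k_def by (intro sum_mono mult_left_mono sum_inverse_floor_powers_le \<alpha> variance_positive) auto
      also have "\<dots> = 4 / (1 - 1 / \<alpha>\<^sup>2) * (\<Sum>j=1..K. variance (W j) / (real j)\<^sup>2)"
        by (simp add: sum_distrib_left ac_simps)
      also have "\<dots> \<le> 4 / (1 - 1 / \<alpha>\<^sup>2) * V" using \<alpha> var by (intro mult_left_mono) (auto simp: field_simps)
      finally show ?thesis .
    qed
    moreover have "expectation (f i) \<ge> 0" for i by (intro Bochner_Integration.integral_nonneg) (auto simp: f_def)
    ultimately have "summable (\<lambda>i. expectation (f i))" by (intro summableI_nonneg_bounded)
    then have "AE \<omega> in M. (\<lambda>i. f i \<omega>) \<longlonglongrightarrow> 0"
      using fint by (intro AE_tendsto_0_of_summable_expectation) (simp_all add: f_def[abs_def])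
    then show ?thesis
    proof eventually_elim
      case (elim \<omega>)
      then have "(\<lambda>i. sqrt (f i \<omega>)) \<longlonglongrightarrow> sqrt 0" by (rule tendsto_real_sqrt)
      then have "(\<lambda>i. \<bar>(s \<omega> (k i) - m (k i)) / real (k i)\<bar>) \<longlonglongrightarrow> 0" by (simp add: f_def)
      then show ?case unfolding k_def by (simp only: tendsto_rabs_zero_iff)
    qed
  qed
  \<comment> \<open>Countably many ratios decreasing to 1, so that one null event suffices.\<close>
  have "AE \<omega> in M. \<forall>l. (\<lambda>i. (s \<omega> (nat \<lfloor>(1 + 1 / real (Suc l)) ^ i\<rfloor>) - m (nat \<lfloor>(1 + 1 / real (Suc l)) ^ i\<rfloor>))
      / real (nat \<lfloor>(1 + 1 / real (Suc l)) ^ i\<rfloor>)) \<longlonglongrightarrow> 0"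
    unfolding AE_all_countable by (intro allI geom) simp
  then show ?thesis
  proof eventually_elim
    case (elim \<omega>)
    have "(\<lambda>n. (s \<omega> n - m n) / real n) \<longlonglongrightarrow> 0"
    proof (rule tendsto_from_geometric_subsequences)
      fix i j :: nat assume ij: "i \<le> j"
      show "s \<omega> i \<le> s \<omega> j" "m i \<le> m j"
        unfolding s_def m_def using ij nonneg Enonneg by (auto intro!: sum_mono2)
      have "m j - m i = (\<Sum>k\<in>{i<..j}. expectation (W k))"
      proof -
        have "{1..j} = {1..i} \<union> {i<..j}" "{1..i} \<inter> {i<..j} = {}" using ij by auto
        then show ?thesis unfolding m_def by (simp add: sum.union_disjoint)
      qed
      also have "\<dots> \<le> (\<Sum>k\<in>{i<..j}. C)" using mean by (intro sum_mono) auto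
      finally show "m j - m i \<le> C * real (j - i)" by (simp add: mult.commute)
    qed (use elim in blast)
    then show ?case by (simp add: s_def m_def sum_subtractf)
  qed
qed

text \<open>With a random variable for \<open>a\<close>, integration bounds the scaled second
  moments of its truncations at \<open>k\<close> by twice its mean. The tail of the series of
  inverse squares is compared with a telescoping one.\<close>

lemma sum_truncated_squares_le:
  fixes a :: real
  assumes a: "a \<ge> 0"
  shows "(\<Sum>k=1..N. if a \<le> real k then a\<^sup>2 / (real k)\<^sup>2 else 0) \<le> 2 * a"
proof -
  \<comment> \<open>The first index that is counted; the maximum with 1 covers \<open>a = 0\<close>,
    as the sum starts at 1.\<close>
  define m where "m = max 1 (nat \<lceil>a\<rceil>)"
  have m: "m \<ge> 1" "a \<le> real m" by (auto simp: m_def) linarith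
  have tele: "(\<Sum>k=m..N. 1 / (real k)\<^sup>2) \<le> 2 / real m - 1 / real N" if "N \<ge> m" for N
    using that
  proof (induction N rule: dec_induct)
    case base
    have "1 / (real m)\<^sup>2 \<le> 1 / real m"
      using m by (intro divide_left_mono) (auto simp: power2_eq_square)
    then show ?case by simp
  next
    case (step n)
    have n: "real n > 0" using step m by simp
    have "1 / (real (Suc n))\<^sup>2 \<le> 1 / (real n * real (Suc n))"
      using n by (intro divide_left_mono) (auto simp: power2_eq_square)
    also have "\<dots> = 1 / real n - 1 / real (Suc n)" using n by (simp add: field_simps)
    finally show ?case using step by simp
  qed
  have "(\<Sum>k=1..N. if a \<le> real k then a\<^sup>2 / (real k)\<^sup>2 else 0) \<le> a\<^sup>2 * (2 / real m)"
  proof -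
    have "(\<Sum>k=1..N. if a \<le> real k then a\<^sup>2 / (real k)\<^sup>2 else 0) \<le> (\<Sum>k=1..N. if m \<le> k then a\<^sup>2 * (1 / (real k)\<^sup>2) else 0)"
    proof (intro sum_mono)
      fix k assume "k \<in> {1..N}"
      then have "a \<le> real k \<longleftrightarrow> m \<le> k" by (auto simp: m_def nat_le_iff ceiling_le_iff)
      then show "(if a \<le> real k then a\<^sup>2 / (real k)\<^sup>2 else 0) \<le> (if m \<le> k then a\<^sup>2 * (1 / (real k)\<^sup>2) else 0)" by simp
    qed
    also have "\<dots> = a\<^sup>2 * (\<Sum>k=m..N. 1 / (real k)\<^sup>2)"
      unfolding sum_distrib_left using m by (subst sum.inter_filter[symmetric]) (auto intro!: sum.cong)
    also have "\<dots> \<le> a\<^sup>2 * (2 / real m)"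
    proof (intro mult_left_mono)
      show "(\<Sum>k=m..N. 1 / (real k)\<^sup>2) \<le> 2 / real m"
      proof (cases "m \<le> N")
        case True
        have "0 \<le> 1 / real N" by simp
        then show ?thesis using tele[OF True] by linarith
      qed simp
    qed simp
    finally show ?thesis .
  qed
  also have "\<dots> \<le> 2 * a"
  proof -
    have "a * a \<le> a * real m" using m a by (intro mult_left_mono) auto
    then show ?thesis using m by (simp add: power2_eq_square field_simps)
  qed
  finally show ?thesis .
qed

text \<open>Truncation at level \<open>k\<close>: truncated variables satisfy the variance
  condition, almost surely only finitely many variables are changed, and the means change by terms
  tending to 0. The weights make room for indicators of the places of a fixed design.\<close>

theorem slln_iid_weighted:
  fixes W :: "nat \<Rightarrow> 'a \<Rightarrow> real" and w :: "nat \<Rightarrow> real"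
  assumes ind: "indep_vars (\<lambda>_. borel) W {1..}" and nonneg: "\<And>k \<omega>. k \<ge> 1 \<Longrightarrow> W k \<omega> \<ge> 0"
    and distr: "\<And>k. k \<ge> 1 \<Longrightarrow> distr M borel (W k) = distr M borel (W 1)"
    and int: "integrable M (W 1)" and w: "\<And>k. 0 \<le> w k \<and> w k \<le> 1"
  shows "AE \<omega> in M. (\<lambda>n. (\<Sum>k=1..n. w k * W k \<omega> - w k * expectation (W 1)) / real n) \<longlonglongrightarrow> 0"
proof -
  have rv[measurable]: "random_variable borel (W k)" if "k \<ge> 1" for k
    using ind that by (auto simp: indep_vars_def)
  have W1: "W 1 \<omega> \<ge> 0" for \<omega> by (simp add: nonneg)
  have rv1[measurable]: "W 1 \<in> borel_measurable M" using rv[of 1] by simp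
  have transfer: "expectation (\<lambda>\<omega>. h (W k \<omega>)) = expectation (\<lambda>\<omega>. h (W 1 \<omega>))"
    if [measurable]: "h \<in> borel_measurable borel" and k: "k \<ge> 1" for h :: "real \<Rightarrow> real" and k
    using integral_distr[OF rv[OF k] that(1)] integral_distr[OF rv1 that(1)] distr[OF k] by simp
  define h where "h k y = (if y \<le> real k then w k * y else 0)" for k y
  have [measurable]: "h k \<in> borel_measurable borel" for k unfolding h_def[abs_def] by measurable
  define V where "V k \<omega> = h k (W k \<omega>)" for k \<omega>
  have rvV[measurable]: "V k \<in> borel_measurable M" if "k \<ge> 1" for k
    using rv[OF that] unfolding V_def[abs_def] by measurable
  have indV: "indep_vars (\<lambda>_. borel) V {1..}"
    unfolding V_def[abs_def] by (rule indep_vars_compose2[OF ind]) auto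
  have h0: "0 \<le> h k y" "h k y \<le> y" "h k y \<le> real k" if "y \<ge> 0" for k y
    using w[of k] that mult_right_mono[of "w k" 1 y] by (auto simp: h_def)
  have hint: "integrable M (\<lambda>\<omega>. h k (W 1 \<omega>))" for k
    using h0[OF W1] W1 by (intro Bochner_Integration.integrable_bound[OF int]) auto
  have EV: "expectation (V k) = expectation (\<lambda>\<omega>. h k (W 1 \<omega>))" if "k \<ge> 1" for k
    unfolding V_def by (intro transfer that) simp
  have V2: "integrable M (\<lambda>\<omega>. (V k \<omega>)\<^sup>2)" if k: "k \<ge> 1" for k
  proof (rule integrable_const_bound[where B = "(real k)\<^sup>2"])
    show "AE \<omega> in M. norm ((V k \<omega>)\<^sup>2) \<le> (real k)\<^sup>2"
      using h0[OF nonneg[OF k]] by (intro AE_I2) (auto simp: V_def intro!: power_mono)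
  qed (use rvV[OF k] in measurable)
  have slln: "AE \<omega> in M. (\<lambda>n. (\<Sum>k=1..n. V k \<omega> - expectation (V k)) / real n) \<longlonglongrightarrow> 0"
  proof (rule slln_nonneg_variance[OF indV])
    show "V k \<omega> \<ge> 0" if "k \<ge> 1" for k \<omega> using h0(1)[OF nonneg[OF that]] by (simp add: V_def)
    show "integrable M (\<lambda>\<omega>. (V k \<omega>)\<^sup>2)" if "k \<ge> 1" for k by (rule V2[OF that])
    show "expectation (V k) \<le> expectation (W 1)" if "k \<ge> 1" for k
      unfolding EV[OF that] using h0(2)[OF W1] by (intro integral_mono hint int)
    show "(\<Sum>k=1..N. variance (V k) / (real k)\<^sup>2) \<le> 2 * expectation (W 1)" for N
    proof -
      define t where "t k \<omega> = (if W 1 \<omega> \<le> real k then (W 1 \<omega>)\<^sup>2 / (real k)\<^sup>2 else 0)" for k \<omega>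
      have tint: "integrable M (t k)" if k: "k \<ge> 1" for k
      proof (rule integrable_const_bound[where B = 1])
        show "AE \<omega> in M. norm (t k \<omega>) \<le> 1"
          using k W1 by (intro AE_I2) (auto simp: t_def divide_le_eq_1 intro!: power_mono)
      qed (unfold t_def, measurable)
      have "variance (V k) / (real k)\<^sup>2 \<le> expectation (t k)" if k: "k \<ge> 1" for k
      proof -
        have "variance (V k) \<le> expectation (\<lambda>\<omega>. (V k \<omega>)\<^sup>2)"
          using V2[OF k] square_integrable_imp_integrable[OF rvV[OF k] V2[OF k]] by (subst variance_eq) auto
        also have "\<dots> = expectation (\<lambda>\<omega>. (h k (W 1 \<omega>))\<^sup>2)"
          unfolding V_def by (rule transfer[of "\<lambda>y. (h k y)\<^sup>2"]) (use k in auto)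
        finally have "variance (V k) / (real k)\<^sup>2 \<le> expectation (\<lambda>\<omega>. (h k (W 1 \<omega>))\<^sup>2) / (real k)\<^sup>2"
          by (intro divide_right_mono) auto
        also have "\<dots> = expectation (\<lambda>\<omega>. (h k (W 1 \<omega>))\<^sup>2 / (real k)\<^sup>2)" by simp
        also have "\<dots> \<le> expectation (t k)"
        proof (rule integral_mono')
          show "integrable M (t k)" by (rule tint[OF k])
          show "(h k (W 1 \<omega>))\<^sup>2 / (real k)\<^sup>2 \<le> t k \<omega>" for \<omega>
            using h0[OF W1, of k \<omega>] by (auto simp: t_def h_def[of k] intro!: divide_right_mono power_mono)
        qed (auto simp: t_def)
        finally show ?thesis .
      qed
      then have "(\<Sum>k=1..N. variance (V k) / (real k)\<^sup>2) \<le> (\<Sum>k=1..N. expectation (t k))"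
        by (intro sum_mono) auto
      also have "\<dots> = expectation (\<lambda>\<omega>. \<Sum>k=1..N. t k \<omega>)"
        using tint by (subst Bochner_Integration.integral_sum) auto
      also have "\<dots> \<le> expectation (\<lambda>\<omega>. 2 * W 1 \<omega>)"
      proof (intro integral_mono Bochner_Integration.integrable_sum integrable_mult_right int)
        show "integrable M (t k)" if "k \<in> {1..N}" for k using tint that by simp
        show "(\<Sum>k=1..N. t k \<omega>) \<le> 2 * W 1 \<omega>" for \<omega>
          unfolding t_def by (rule sum_truncated_squares_le[OF W1])
      qed
      finally show ?thesis by simp
    qed
  qed
  \<comment> \<open>The expected number of truncated variables is a sum of tail probabilities and is
    at most the mean.\<close>
  have tail: "AE \<omega> in M. (\<lambda>k. if W (Suc k) \<omega> > real (Suc k) then 1 else 0 :: real) \<longlonglongrightarrow> 0"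
  proof (rule AE_tendsto_0_of_summable_expectation)
    fix k show "integrable M (\<lambda>\<omega>. if W (Suc k) \<omega> > real (Suc k) then 1 else 0 :: real)"
      using rv[of "Suc k"] by (intro integrable_const_bound[where B = 1]) auto
  next
    have int1: "integrable M (\<lambda>\<omega>. if W 1 \<omega> > real (Suc k) then 1 else 0 :: real)" for k
      by (intro integrable_const_bound[where B = 1]) auto
    have "(\<Sum>k<N. expectation (\<lambda>\<omega>. if W (Suc k) \<omega> > real (Suc k) then 1 else 0 :: real)) \<le> expectation (W 1)" for N
    proof -
      have "(\<Sum>k<N. expectation (\<lambda>\<omega>. if W (Suc k) \<omega> > real (Suc k) then 1 else 0 :: real))
          = (\<Sum>k<N. expectation (\<lambda>\<omega>. if W 1 \<omega> > real (Suc k) then 1 else 0 :: real))"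
        by (intro sum.cong refl transfer[of "\<lambda>y. if y > real (Suc _) then 1 else 0"]) auto
      also have "\<dots> = expectation (\<lambda>\<omega>. \<Sum>k<N. if W 1 \<omega> > real (Suc k) then 1 else 0 :: real)"
        using int1 by (subst Bochner_Integration.integral_sum) auto
      also have "\<dots> \<le> expectation (W 1)"
      proof (intro integral_mono Bochner_Integration.integrable_sum int1 int)
        fix \<omega>
        \<comment> \<open>The second bound, by \<open>N\<close>, strengthens the induction: a new
          term counts only if \<open>a\<close> exceeds \<open>Suc N\<close>.\<close>
        have "(\<Sum>k<N. if a > real (Suc k) then 1 else 0 :: real) \<le> a \<and> (\<Sum>k<N. if a > real (Suc k) then 1 else 0 :: real) \<le> real N"
          if "a \<ge> 0" for a
          using that by (induction N) auto
        then show "(\<Sum>k<N. if W 1 \<omega> > real (Suc k) then 1 else 0 :: real) \<le> W 1 \<omega>" using W1 by blast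
      qed
      finally show ?thesis .
    qed
    then show "summable (\<lambda>k. expectation (\<lambda>\<omega>. if W (Suc k) \<omega> > real (Suc k) then 1 else 0 :: real))"
      by (intro summableI_nonneg_bounded Bochner_Integration.integral_nonneg) auto
  qed simp
  \<comment> \<open>Dominated convergence for the part cut off, then Cesaro means.\<close>
  have bias: "(\<lambda>n. (\<Sum>k=1..n. expectation (V k) - w k * expectation (W 1)) / real n) \<longlonglongrightarrow> 0"
  proof -
    have "(\<lambda>k. expectation (\<lambda>\<omega>. if W 1 \<omega> \<le> real k then 0 else W 1 \<omega>)) \<longlonglongrightarrow> expectation (\<lambda>\<omega>. 0)"
    proof (rule integral_dominated_convergence[where w = "W 1"])
      show "AE \<omega> in M. (\<lambda>k. if W 1 \<omega> \<le> real k then 0 else W 1 \<omega>) \<longlonglongrightarrow> 0"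
      proof (rule AE_I2)
        fix \<omega>
        obtain N where N: "W 1 \<omega> < real N" using reals_Archimedean2 by blast
        have "\<forall>\<^sub>F k in sequentially. (if W 1 \<omega> \<le> real k then 0 else W 1 \<omega>) = 0"
          using eventually_ge_at_top[of N] by eventually_elim (use N in auto)
        then show "(\<lambda>k. if W 1 \<omega> \<le> real k then 0 else W 1 \<omega>) \<longlonglongrightarrow> 0" by (rule tendsto_eventually)
      qed
    qed (use int W1 in \<open>auto intro!: AE_I2\<close>)
    then have lim: "(\<lambda>k. expectation (\<lambda>\<omega>. if W 1 \<omega> \<le> real k then 0 else W 1 \<omega>)) \<longlonglongrightarrow> 0" by simp
    define b where "b k = expectation (\<lambda>\<omega>. h k (W 1 \<omega>)) - w k * expectation (W 1)" for k
    have "b \<longlonglongrightarrow> 0"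
    proof (rule Lim_null_comparison[OF _ lim], rule always_eventually, rule allI)
      fix k
      have "b k = expectation (\<lambda>\<omega>. h k (W 1 \<omega>) - w k * W 1 \<omega>)"
        using hint int by (simp add: b_def)
      also have "norm \<dots> \<le> expectation (\<lambda>\<omega>. norm (h k (W 1 \<omega>) - w k * W 1 \<omega>))"
        by (rule integral_norm_bound)
      also have "\<dots> \<le> expectation (\<lambda>\<omega>. if W 1 \<omega> \<le> real k then 0 else W 1 \<omega>)"
      proof (rule integral_mono')
        show "integrable M (\<lambda>\<omega>. if W 1 \<omega> \<le> real k then 0 else W 1 \<omega>)"
          using W1 by (intro Bochner_Integration.integrable_bound[OF int]) auto
        fix \<omega> show "norm (h k (W 1 \<omega>) - w k * W 1 \<omega>) \<le> (if W 1 \<omega> \<le> real k then 0 else W 1 \<omega>)"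
          using w[of k] W1[of \<omega>] mult_right_mono[of "w k" 1 "W 1 \<omega>"] by (auto simp: h_def abs_mult)
        show "0 \<le> (if W 1 \<omega> \<le> real k then 0 else W 1 \<omega>)" using W1 by simp
      qed
      finally show "norm (b k) \<le> expectation (\<lambda>\<omega>. if W 1 \<omega> \<le> real k then 0 else W 1 \<omega>)" .
    qed
    from cesaro_mean_tendsto_0[OF this] show ?thesis
      by (simp add: b_def EV cong: sum.cong_simp)
  qed
  show ?thesis
    using slln tail
  proof eventually_elim
    case (elim \<omega>)
    have "\<forall>\<^sub>F k in sequentially. (if W (Suc k) \<omega> > real (Suc k) then 1 else 0 :: real) < 1"
      using elim(2) by (rule order_tendstoD) simp
    then obtain N where N: "\<And>k. k \<ge> N \<Longrightarrow> W (Suc k) \<omega> \<le> real (Suc k)"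
      unfolding eventually_sequentially by (metis less_irrefl not_le)
    define a where "a k = w k * W k \<omega> - V k \<omega>" for k
    have "\<forall>\<^sub>F k in sequentially. a k = 0"
      using eventually_ge_at_top[of "Suc N"]
    proof eventually_elim
      case (elim k)
      then obtain j where "k = Suc j" "j \<ge> N" by (cases k) auto
      then show ?case using N[of j] by (simp add: a_def V_def h_def)
    qed
    then have "a \<longlonglongrightarrow> 0" by (rule tendsto_eventually)
    \<comment> \<open>Truncation error, plus centred truncated sum, plus bias.\<close>
    from tendsto_add[OF cesaro_mean_tendsto_0[OF this] tendsto_add[OF elim(1) bias]]
    have "(\<lambda>n. (\<Sum>k=1..n. a k) / real n + ((\<Sum>k=1..n. V k \<omega> - expectation (V k)) / real n
        + (\<Sum>k=1..n. expectation (V k) - w k * expectation (W 1)) / real n)) \<longlonglongrightarrow> 0" by simp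
    then show ?case
      by (simp add: a_def flip: add_divide_distrib sum.distrib)
  qed
qed

end

section \<open>Regularity of random paths\<close>

lemma count_in_eq_sum: "real (count_in x n A) = (\<Sum>k=1..n. indicator A (x k))"
proof -
  have "(\<Sum>k=1..n. indicator A (x k) :: real) = (\<Sum>k\<in>{j\<in>{1..n}. x j \<in> A}. 1)"
    by (intro sum.mono_neutral_cong_right) (auto simp: indicator_def)
  then show ?thesis by (simp add: count_in_def)
qed

lemma count_in_mono: "A \<subseteq> B \<Longrightarrow> count_in x n A \<le> count_in x n B"
  unfolding count_in_def by (intro card_mono) auto

section \<open>Mass of the interior and frequencies of a fixed design\<close>

lemma emeasure_lborel_eq_0_iff_negligible:
  fixes A :: "'a::euclidean_space set"
  assumes "A \<in> sets borel"
  shows "emeasure lborel A = 0 \<longleftrightarrow> negligible A"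
  using assms by (simp add: negligible_iff_null_sets null_sets_completion_iff null_sets_def)

text \<open>The frontier of a convex set is Lebesgue null, and \<open>\<nu>\<close> has the same
  null subsets of \<open>S\<close>.\<close>

lemma measure_interior_eq_1:
  fixes S :: "'a::euclidean_space set"
  assumes S: "closed S" "convex S" and \<nu>: "lebesgue_equivalent_on S \<nu>"
  shows "measure \<nu> (interior S) = 1"
proof -
  interpret prob_space \<nu> using \<nu> by (simp add: lebesgue_equivalent_on_def)
  have sets: "sets \<nu> = sets borel" using \<nu> by (simp add: lebesgue_equivalent_on_def)
  have fr: "frontier S \<in> sets borel" "frontier S \<subseteq> S"
    using S by (auto simp: frontier_closed frontier_def closure_closed)
  have "emeasure lborel (frontier S) = 0"
    using negligible_convex_frontier[OF S(2)] fr by (simp add: emeasure_lborel_eq_0_iff_negligible)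
  then have "emeasure \<nu> (frontier S) = 0" using \<nu> fr by (simp add: lebesgue_equivalent_on_def)
  then have "measure \<nu> (frontier S) = 0" by (simp add: measure_def)
  moreover have "measure \<nu> S = 1" using \<nu> by (simp add: lebesgue_equivalent_on_def measure_def)
  moreover have "S = interior S \<union> frontier S" "interior S \<inter> frontier S = {}"
    using S interior_subset by (auto simp: frontier_def closure_closed)
  ultimately show ?thesis
    using finite_measure_Union[of "interior S" "frontier S"] sets fr by (metis add.right_neutral borel_open open_interior)
qed

lemma measure_box_pos:
  fixes S :: "'a::euclidean_space set"
  assumes \<nu>: "lebesgue_equivalent_on S \<nu>" and box: "box a b \<noteq> {}" "box a b \<subseteq> S"
  shows "measure \<nu> (box a b) > 0"
proof -
  interpret prob_space \<nu> using \<nu> by (simp add: lebesgue_equivalent_on_def)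
  have "\<not> negligible (box a b)" using box by (intro open_not_negligible) auto
  then have "emeasure lborel (box a b) \<noteq> 0" by (simp add: emeasure_lborel_eq_0_iff_negligible)
  then have "emeasure \<nu> (box a b) \<noteq> 0" using \<nu> box(2) by (simp add: lebesgue_equivalent_on_def)
  then show ?thesis by (simp add: emeasure_eq_measure zero_less_measure_iff)
qed

lemma measure_core_tendsto:
  fixes S :: "'a::euclidean_space set"
  assumes \<nu>: "prob_space \<nu>" "sets \<nu> = sets borel"
  shows "(\<lambda>l. measure \<nu> (interior (core S l))) \<longlonglongrightarrow> measure \<nu> (interior S)"
proof -
  interpret prob_space \<nu> by (rule \<nu>(1))
  have "(\<lambda>l. measure \<nu> (interior (core S l))) \<longlonglongrightarrow> measure \<nu> (\<Union>l. interior (core S l))"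
  proof (rule finite_Lim_measure_incseq)
    show "incseq (\<lambda>l. interior (core S l))" by (rule incseq_SucI, rule interior_mono, rule core_mono) simp
  next
    show "range (\<lambda>l. interior (core S l)) \<subseteq> sets \<nu>" unfolding \<nu>(2) by (intro image_subsetI borel_open open_interior)
  qed
  then show ?thesis unfolding Union_interior_core .
qed

text \<open>
  A finite union of open boxes is handled by inclusion and exclusion, because the intersection of
  two boxes is a box.
\<close>

lemma fixed_design_finite_Union_boxes:
  fixes S :: "'a::euclidean_space set" and N :: nat
  assumes design: "fixed_design S x \<nu>" and sub: "\<And>i. i < N \<Longrightarrow> box (c i) (d i) \<subseteq> interior S"
  shows "(\<lambda>n. real (count_in x n (\<Union>i<N. box (c i) (d i))) / real n) \<longlonglongrightarrow> measure \<nu> (\<Union>i<N. box (c i) (d i))"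
  using sub
proof (induction N arbitrary: c d)
  case 0
  then show ?case by (simp add: count_in_def)
next
  case (Suc N)
  have \<nu>: "prob_space \<nu>" "sets \<nu> = sets borel"
    using design by (simp_all add: fixed_design_def lebesgue_equivalent_on_def)
  interpret prob_space \<nu> by (rule \<nu>(1))
  define U where "U = (\<Union>i<N. box (c i) (d i))"
  define R where "R = box (c N) (d N)"
  \<comment> \<open>Corners of the intersection of box \<open>i\<close> with the last box; the
    induction hypothesis is general in the corners and applies to these boxes.\<close>
  define c' where "c' i = (\<Sum>j\<in>Basis. max (c i \<bullet> j) (c N \<bullet> j) *\<^sub>R j)" for i
  define d' where "d' i = (\<Sum>j\<in>Basis. min (d i \<bullet> j) (d N \<bullet> j) *\<^sub>R j)" for i
  have int: "box (c i) (d i) \<inter> R = box (c' i) (d' i)" for i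
    by (simp add: R_def c'_def d'_def box_Int_box)
  then have UR: "U \<inter> R = (\<Union>i<N. box (c' i) (d' i))" by (auto simp: U_def)
  have Un: "(\<Union>i<Suc N. box (c i) (d i)) = U \<union> R" by (auto simp: U_def R_def lessThan_Suc)
  have 1: "(\<lambda>n. real (count_in x n U) / real n) \<longlonglongrightarrow> measure \<nu> U"
    unfolding U_def by (intro Suc.IH Suc.prems) simp
  have 2: "(\<lambda>n. real (count_in x n (U \<inter> R)) / real n) \<longlonglongrightarrow> measure \<nu> (U \<inter> R)"
    unfolding UR
  proof (rule Suc.IH)
    fix i assume "i < N"
    then show "box (c' i) (d' i) \<subseteq> interior S" using Suc.prems[of i] int[of i] by auto
  qed
  have 3: "(\<lambda>n. real (count_in x n R) / real n) \<longlonglongrightarrow> measure \<nu> R"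
    using design Suc.prems[of N] by (simp add: fixed_design_def R_def)
  have "measure \<nu> (U \<union> R) = measure \<nu> U + measure \<nu> R - measure \<nu> (U \<inter> R)"
  proof -
    have "U \<in> sets \<nu>" "R \<in> sets \<nu>" by (auto simp: \<nu>(2) U_def R_def)
    then show ?thesis
      using finite_measure_Union'[of U R] finite_measure_Diff'[of R U] by (simp add: Int_commute)
  qed
  moreover have "real (count_in x n (U \<union> R)) = real (count_in x n U) + real (count_in x n R) - real (count_in x n (U \<inter> R))" for n
    unfolding count_in_eq_sum sum.distrib[symmetric] sum_subtractf[symmetric]
    by (intro sum.cong) (auto simp: indicator_def)
  moreover have "(\<lambda>n. real (count_in x n U) / real n + real (count_in x n R) / real n - real (count_in x n (U \<inter> R)) / real n)
      \<longlonglongrightarrow> measure \<nu> U + measure \<nu> R - measure \<nu> (U \<inter> R)"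
    by (intro tendsto_intros 1 2 3)
  ultimately show ?case unfolding Un by (simp add: add_divide_distrib diff_divide_distrib)
qed

text \<open>Frequencies are known to converge on boxes, and a core need not be a finite union of
  boxes. A finite union of boxes inside of the core with mass above \<open>1 - \<delta>\<close>
  eventually has a frequency above \<open>1 - \<delta>\<close>, which bounds what remains
  outside.\<close>

lemma fixed_design_outside_core:
  fixes S :: "'a::euclidean_space set"
  assumes S: "closed S" "convex S" and design: "fixed_design S x \<nu>" and \<delta>: "\<delta> > 0"
  shows "\<exists>l. \<forall>\<^sub>F n in sequentially. (\<Sum>k=1..n. indicator (- core S l) (x k)) \<le> \<delta> * real n"
proof -
  have eqv: "lebesgue_equivalent_on S \<nu>" using design by (simp add: fixed_design_def)
  then have \<nu>: "prob_space \<nu>" "sets \<nu> = sets borel" by (simp_all add: lebesgue_equivalent_on_def)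
  interpret prob_space \<nu> by (rule \<nu>(1))
  have "(\<lambda>l. measure \<nu> (interior (core S l))) \<longlonglongrightarrow> 1"
    using measure_core_tendsto[OF \<nu>] measure_interior_eq_1[OF S eqv] by metis
  then have "\<forall>\<^sub>F l in sequentially. measure \<nu> (interior (core S l)) > 1 - \<delta>"
    using \<delta> by (intro order_tendstoD(1)) auto
  then obtain l where l: "measure \<nu> (interior (core S l)) > 1 - \<delta>"
    by (auto simp: eventually_sequentially)
  obtain D where D: "countable D" "D \<subseteq> Pow (interior (core S l))" "\<And>B. B \<in> D \<Longrightarrow> \<exists>a b. B = box a b" "\<Union>D = interior (core S l)"
    using open_countable_Union_open_box[OF open_interior] by metis
  \<comment> \<open>The countable family becomes a sequence of corners; an empty family is
    represented by empty boxes.\<close>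
  have "\<exists>c d. (\<forall>i::nat. box (c i) (d i) \<subseteq> interior (core S l)) \<and> (\<Union>i. box (c i) (d i)) = interior (core S l)"
  proof (cases "D = {}")
    case True
    then show ?thesis using D(4) by (intro exI[of _ "\<lambda>_. 0"]) auto
  next
    case False
    have "\<forall>i. \<exists>p. from_nat_into D i = box (fst p) (snd p)" using D(3) from_nat_into[OF False] by (metis fst_conv snd_conv)
    from choice[OF this] obtain p where p: "\<And>i. from_nat_into D i = box (fst (p i)) (snd (p i))" by blast
    have "range (from_nat_into D) = D" by (rule range_from_nat_into[OF False D(1)])
    moreover define c d where "c i = fst (p i)" and "d i = snd (p i)" for i
    ultimately have Un: "(\<Union>i. box (c i) (d i)) = interior (core S l)" using D(4) p by simp
    have "\<forall>i. box (c i) (d i) \<subseteq> interior (core S l)" unfolding Un[symmetric] by blast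
    from conjI[OF this Un] show ?thesis by (intro exI)
  qed
  then obtain c where "\<exists>d. (\<forall>i::nat. box (c i) (d i) \<subseteq> interior (core S l)) \<and> (\<Union>i. box (c i) (d i)) = interior (core S l)" ..
  then obtain d where cd': "(\<forall>i::nat. box (c i) (d i) \<subseteq> interior (core S l)) \<and> (\<Union>i. box (c i) (d i)) = interior (core S l)" ..
  note cd = conjunct1[OF cd', rule_format] conjunct2[OF cd']
  define U where "U N = (\<Union>i<N. box (c i) (d i))" for N :: nat
  have "(\<lambda>N. measure \<nu> (U N)) \<longlonglongrightarrow> measure \<nu> (\<Union>N. U N)"
  proof (rule finite_Lim_measure_incseq)
    show "incseq U" by (rule incseq_SucI) (auto simp: U_def lessThan_Suc)
    show "range U \<subseteq> sets \<nu>" unfolding \<nu>(2) U_def by (intro image_subsetI borel_open open_UN ballI open_box)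
  qed
  moreover have "(\<Union>N. U N) = interior (core S l)" unfolding cd(2)[symmetric] U_def by blast
  ultimately have "\<forall>\<^sub>F N in sequentially. measure \<nu> (U N) > 1 - \<delta>"
    using l by (intro order_tendstoD(1)) auto
  then obtain N where N: "measure \<nu> (U N) > 1 - \<delta>" by (auto simp: eventually_sequentially)
  have "(\<lambda>n. real (count_in x n (U N)) / real n) \<longlonglongrightarrow> measure \<nu> (U N)"
    unfolding U_def
  proof (rule fixed_design_finite_Union_boxes[OF design])
    show "box (c i) (d i) \<subseteq> interior S" for i
      using cd(1)[of i] interior_subset[of "core S l"] core_subset_interior[of S l] by blast
  qed
  then have "\<forall>\<^sub>F n in sequentially. real (count_in x n (U N)) / real n > 1 - \<delta>"
    using N by (rule order_tendstoD(1))
  then have "\<forall>\<^sub>F n in sequentially. (\<Sum>k=1..n. indicator (- core S l) (x k)) \<le> \<delta> * real n"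
    using eventually_gt_at_top[of 0]
  proof eventually_elim
    case (elim n)
    have "U N \<subseteq> core S l" unfolding U_def using cd(1) interior_subset by blast
    then have "real (count_in x n (U N)) \<le> real (count_in x n (core S l))" by (simp add: count_in_mono)
    also have "\<dots> = real n - (\<Sum>k=1..n. indicator (- core S l) (x k))"
    proof -
      have "(\<Sum>k=1..n. indicator (core S l) (x k)) + (\<Sum>k=1..n. indicator (- core S l) (x k)) = (\<Sum>k=1..n. 1 :: real)"
        unfolding sum.distrib[symmetric] by (intro sum.cong) (auto simp: indicator_def)
      then show ?thesis by (simp add: count_in_eq_sum)
    qed
    finally show ?case using elim by (simp add: less_divide_eq algebra_simps)
  qed
  then show ?thesis ..
qed

section \<open>Almost sure regularity from countably many laws of large numbers\<close>

context prob_space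
begin

text \<open>The law for nonnegative variables is applied to the positive and the negative parts,
  whose variances are at most \<open>C\<close>; their means cancel.\<close>

lemma slln_centered:
  fixes U :: "nat \<Rightarrow> 'a \<Rightarrow> real"
  assumes ind: "indep_vars (\<lambda>_. borel) U {1..}"
    and sq: "\<And>k. k \<ge> 1 \<Longrightarrow> integrable M (\<lambda>\<omega>. (U k \<omega>)\<^sup>2)" "\<And>k. k \<ge> 1 \<Longrightarrow> expectation (\<lambda>\<omega>. (U k \<omega>)\<^sup>2) \<le> C"
    and mean: "\<And>k. k \<ge> 1 \<Longrightarrow> expectation (U k) = 0"
  shows "AE \<omega> in M. (\<lambda>n. (\<Sum>k=1..n. U k \<omega>) / real n) \<longlonglongrightarrow> 0"
proof -
  have rv[measurable]: "U k \<in> borel_measurable M" if "k \<ge> 1" for k using ind that by (auto simp: indep_vars_def)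
  have int: "integrable M (U k)" if "k \<ge> 1" for k by (rule square_integrable_imp_integrable[OF rv sq(1)]) (use that in auto)
  have half: "AE \<omega> in M. (\<lambda>n. (\<Sum>k=1..n. max 0 (s * U k \<omega>) - expectation (\<lambda>\<omega>. max 0 (s * U k \<omega>))) / real n) \<longlonglongrightarrow> 0"
    if s: "s = 1 \<or> s = -1" for s :: real
  proof (rule slln_nonneg_variance)
    have le: "(max 0 (s * U k \<omega>))\<^sup>2 \<le> (U k \<omega>)\<^sup>2" "max 0 (s * U k \<omega>) \<le> 1 + (U k \<omega>)\<^sup>2" for k \<omega>
    proof -
      have "\<bar>max 0 (s * U k \<omega>)\<bar> \<le> \<bar>U k \<omega>\<bar>" using s by auto
      then show "(max 0 (s * U k \<omega>))\<^sup>2 \<le> (U k \<omega>)\<^sup>2" by (simp only: abs_le_square_iff)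
      have "\<bar>U k \<omega>\<bar> \<le> 1 + (U k \<omega>)\<^sup>2"
        using zero_le_power2[of "\<bar>U k \<omega>\<bar> - 1"] by (simp add: power2_diff)
      then show "max 0 (s * U k \<omega>) \<le> 1 + (U k \<omega>)\<^sup>2" using s by auto
    qed
    show "indep_vars (\<lambda>_. borel) (\<lambda>k \<omega>. max 0 (s * U k \<omega>)) {1..}"
      by (rule indep_vars_compose2[OF ind]) auto
    show "integrable M (\<lambda>\<omega>. (max 0 (s * U k \<omega>))\<^sup>2)" if "k \<ge> 1" for k
      using le(1) that by (intro Bochner_Integration.integrable_bound[OF sq(1)[OF that]]) auto
    note int2 = this
    have int3: "integrable M (\<lambda>\<omega>. max 0 (s * U k \<omega>))" if "k \<ge> 1" for k
      using int[OF that] by (intro integrable_max) auto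
    show "expectation (\<lambda>\<omega>. max 0 (s * U k \<omega>)) \<le> 1 + C" if "k \<ge> 1" for k
    proof -
      have "expectation (\<lambda>\<omega>. max 0 (s * U k \<omega>)) \<le> expectation (\<lambda>\<omega>. 1 + (U k \<omega>)\<^sup>2)"
        using sq(1)[OF that] int3[OF that] le(2) by (intro integral_mono) auto
      then show ?thesis using sq[OF that] by (simp add: prob_space)
    qed
    show "(\<Sum>k=1..N. variance (\<lambda>\<omega>. max 0 (s * U k \<omega>)) / (real k)\<^sup>2) \<le> C * 2" for N
    proof -
      have "variance (\<lambda>\<omega>. max 0 (s * U k \<omega>)) \<le> C" if k: "k \<ge> 1" for k
      proof -
        have "variance (\<lambda>\<omega>. max 0 (s * U k \<omega>)) \<le> expectation (\<lambda>\<omega>. (max 0 (s * U k \<omega>))\<^sup>2)"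
          using int2[OF k] int3[OF k] by (subst variance_eq) auto
        also have "\<dots> \<le> expectation (\<lambda>\<omega>. (U k \<omega>)\<^sup>2)" using int2[OF k] sq(1)[OF k] le(1) by (intro integral_mono) auto
        also have "\<dots> \<le> C" by (rule sq(2)[OF k])
        finally show ?thesis .
      qed
      \<comment> \<open>With \<open>a = 1\<close>, the bound on truncated squares says that the
        inverse squares sum to at most 2.\<close>
      then have "(\<Sum>k=1..N. variance (\<lambda>\<omega>. max 0 (s * U k \<omega>)) / (real k)\<^sup>2) \<le> (\<Sum>k=1..N. C * (if 1 \<le> real k then 1\<^sup>2 / (real k)\<^sup>2 else 0))"
        by (intro sum_mono) (auto intro!: divide_right_mono)
      also have "\<dots> \<le> C * (2 * 1)"
      proof -
        have "0 \<le> expectation (\<lambda>\<omega>. (U 1 \<omega>)\<^sup>2)" by (rule Bochner_Integration.integral_nonneg) simp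
        then have "0 \<le> C" using sq(2)[of 1] by linarith
        then show ?thesis unfolding sum_distrib_left[symmetric] by (intro mult_left_mono sum_truncated_squares_le) auto
      qed
      finally show ?thesis by simp
    qed
  qed simp
  have "AE \<omega> in M. (\<lambda>n. (\<Sum>k=1..n. max 0 (U k \<omega>) - expectation (\<lambda>\<omega>. max 0 (U k \<omega>))) / real n) \<longlonglongrightarrow> 0"
    "AE \<omega> in M. (\<lambda>n. (\<Sum>k=1..n. max 0 (- U k \<omega>) - expectation (\<lambda>\<omega>. max 0 (- U k \<omega>))) / real n) \<longlonglongrightarrow> 0"
    using half[of 1] half[of "-1"] by simp_all
  then show ?thesis
  proof eventually_elim
    case (elim \<omega>)
    have Eeq: "expectation (\<lambda>\<omega>. max 0 (U k \<omega>)) - expectation (\<lambda>\<omega>. max 0 (- U k \<omega>)) = 0" if "k \<ge> 1" for k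
    proof -
      have "expectation (\<lambda>\<omega>. max 0 (U k \<omega>)) - expectation (\<lambda>\<omega>. max 0 (- U k \<omega>)) = expectation (\<lambda>\<omega>. max 0 (U k \<omega>) - max 0 (- U k \<omega>))"
        using int[OF that] by (intro Bochner_Integration.integral_diff[symmetric] integrable_max) auto
      also have "(\<lambda>\<omega>. max 0 (U k \<omega>) - max 0 (- U k \<omega>)) = U k" by (auto simp: fun_eq_iff max_def)
      finally show ?thesis using mean[OF that] by simp
    qed
    have eq: "(\<Sum>k=1..n. max 0 (U k \<omega>) - expectation (\<lambda>\<omega>. max 0 (U k \<omega>))) / real n
        - (\<Sum>k=1..n. max 0 (- U k \<omega>) - expectation (\<lambda>\<omega>. max 0 (- U k \<omega>))) / real n = (\<Sum>k=1..n. U k \<omega>) / real n" for n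
      unfolding diff_divide_distrib[symmetric] sum_subtractf[symmetric]
    proof (intro arg_cong2[where f = "(/)"] sum.cong refl)
      fix k assume "k \<in> {1..n}"
      then have "expectation (\<lambda>\<omega>. max 0 (U k \<omega>)) - expectation (\<lambda>\<omega>. max 0 (- U k \<omega>)) = 0" by (intro Eeq) simp
      moreover have "max 0 (U k \<omega>) - max 0 (- U k \<omega>) = U k \<omega>" by (simp add: max_def)
      ultimately show "max 0 (U k \<omega>) - expectation (\<lambda>\<omega>. max 0 (U k \<omega>)) - (max 0 (- U k \<omega>) - expectation (\<lambda>\<omega>. max 0 (- U k \<omega>))) = U k \<omega>"
        by linarith
    qed
    from tendsto_diff[OF elim] show ?case unfolding eq by simp
  qed
qed

text \<open>Each hypothesis holds off its own null event, so uncountable families are replaced by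
  countable ones: open sets by a basis, \<open>\<delta>\<close> by the numbers
  \<open>1 / real (Suc m)\<close>, and one finite partition is fixed for each core and each
  mesh.\<close>

lemma AE_regular_path:
  fixes S :: "'b::euclidean_space set" and X :: "nat \<Rightarrow> 'a \<Rightarrow> 'b" and e :: "nat \<Rightarrow> 'a \<Rightarrow> real"
  assumes S: "closed S"
    and lin: "\<And>B. B \<in> sets borel \<Longrightarrow> AE \<omega> in M. (\<lambda>n. (\<Sum>k=1..n. indicator B (X k \<omega>) * e k \<omega>) / real n) \<longlonglongrightarrow> 0"
    and sq: "AE \<omega> in M. \<forall>\<^sub>F n in sequentially. (\<Sum>k=1..n. (e k \<omega>)\<^sup>2) \<le> C * real n"
    and out: "\<And>\<delta>. \<delta> > 0 \<Longrightarrow> \<exists>l. AE \<omega> in M. \<forall>\<^sub>F n in sequentially.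
      (\<Sum>k=1..n. indicator (- core S l) (X k \<omega>) * (e k \<omega>)\<^sup>2) \<le> \<delta> * real n"
    and dense: "\<And>a b. box a b \<noteq> {} \<Longrightarrow> box a b \<subseteq> interior S \<Longrightarrow>
      \<exists>p>0. AE \<omega> in M. \<forall>\<^sub>F n in sequentially. p * real n \<le> real (count_in (\<lambda>k. X k \<omega>) n (box a b))"
  shows "AE \<omega> in M. regular_path S (\<lambda>k. X k \<omega>) (\<lambda>k. e k \<omega>)"
proof -
  obtain D :: "'b set set" where D: "countable D" "topological_basis D" using ex_countable_basis by blast
  have "AE \<omega> in M. \<forall>V\<in>{V\<in>D. V \<noteq> {} \<and> V \<subseteq> interior S}. \<exists>p>0. \<forall>\<^sub>F n in sequentially. p * real n \<le> real (count_in (\<lambda>k. X k \<omega>) n V)"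
  proof (rule AE_ball_countable')
    fix V assume V: "V \<in> {V\<in>D. V \<noteq> {} \<and> V \<subseteq> interior S}"
    then have "open V" using D(2) by (simp add: topological_basis_open)
    moreover obtain x where "x \<in> V" using V by blast
    ultimately obtain r where x: "x \<in> V" "r > 0" "ball x r \<subseteq> V" using open_contains_ball by blast
    obtain a b where ab: "x \<in> box a b" "box a b \<subseteq> ball x r" using rational_boxes[OF x(2)] by metis
    have "box a b \<noteq> {}" "box a b \<subseteq> interior S" using ab x V by auto
    from dense[OF this] obtain p where p: "p > 0" "AE \<omega> in M. \<forall>\<^sub>F n in sequentially. p * real n \<le> real (count_in (\<lambda>k. X k \<omega>) n (box a b))"
      by blast
    from p(2) show "AE \<omega> in M. \<exists>p>0. \<forall>\<^sub>F n in sequentially. p * real n \<le> real (count_in (\<lambda>k. X k \<omega>) n V)"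
    proof eventually_elim
      case (elim \<omega>)
      have "box a b \<subseteq> V" using ab x by blast
      then have "real (count_in (\<lambda>k. X k \<omega>) n (box a b)) \<le> real (count_in (\<lambda>k. X k \<omega>) n V)" for n by (simp add: count_in_mono)
      then have "\<forall>\<^sub>F n in sequentially. p * real n \<le> real (count_in (\<lambda>k. X k \<omega>) n V)"
        using elim by (auto elim!: eventually_mono intro: order_trans)
      then show ?case using p(1) by blast
    qed
  qed (use D in auto)
  then have 1: "AE \<omega> in M. \<forall>U. open U \<longrightarrow> U \<noteq> {} \<longrightarrow> U \<subseteq> interior S \<longrightarrow>
      (\<exists>p>0. \<forall>\<^sub>F n in sequentially. p * real n \<le> real (count_in (\<lambda>k. X k \<omega>) n U))"
  proof eventually_elim
    case (elim \<omega>)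
    show ?case
    proof (intro allI impI)
      fix U :: "'b set" assume U: "open U" "U \<noteq> {}" "U \<subseteq> interior S"
      obtain x where "x \<in> U" using U by blast
      then obtain V where V: "V \<in> D" "x \<in> V" "V \<subseteq> U" using topological_basisE[OF D(2) U(1)] by metis
      then obtain p where p: "p > 0" "\<forall>\<^sub>F n in sequentially. p * real n \<le> real (count_in (\<lambda>k. X k \<omega>) n V)"
        using elim U by blast
      have "real (count_in (\<lambda>k. X k \<omega>) n V) \<le> real (count_in (\<lambda>k. X k \<omega>) n U)" for n using V by (simp add: count_in_mono)
      then have "\<forall>\<^sub>F n in sequentially. p * real n \<le> real (count_in (\<lambda>k. X k \<omega>) n U)"
        using p(2) by (auto elim!: eventually_mono intro: order_trans)
      then show "\<exists>p>0. \<forall>\<^sub>F n in sequentially. p * real n \<le> real (count_in (\<lambda>k. X k \<omega>) n U)" using p(1) by blast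
    qed
  qed
  have part: "AE \<omega> in M. \<exists>P. finite P \<and> disjoint P \<and> \<Union>P = core S l \<and>
      (\<forall>W\<in>P. (\<forall>u\<in>W. \<forall>v\<in>W. dist u v \<le> 1 / real (Suc m)) \<and>
        (\<lambda>n. (\<Sum>k=1..n. indicator W (X k \<omega>) * e k \<omega>) / real n) \<longlonglongrightarrow> 0)" for l m
  proof -
    obtain P where P: "finite P" "disjoint P" "\<Union>P = core S l" "P \<subseteq> sets borel"
      "\<forall>W\<in>P. \<forall>u\<in>W. \<forall>v\<in>W. dist u v \<le> 1 / real (Suc m)"
      using finite_borel_partition[OF compact_core[OF S], of "1 / real (Suc m)" l] by auto
    have "AE \<omega> in M. \<forall>W\<in>P. (\<lambda>n. (\<Sum>k=1..n. indicator W (X k \<omega>) * e k \<omega>) / real n) \<longlonglongrightarrow> 0"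
      using P(1,4) by (intro AE_ball_countable' lin) (auto intro: countable_finite)
    then show ?thesis by eventually_elim (use P in blast)
  qed
  have "AE \<omega> in M. \<forall>l m. \<exists>P. finite P \<and> disjoint P \<and> \<Union>P = core S l \<and>
      (\<forall>W\<in>P. (\<forall>u\<in>W. \<forall>v\<in>W. dist u v \<le> 1 / real (Suc m)) \<and>
        (\<lambda>n. (\<Sum>k=1..n. indicator W (X k \<omega>) * e k \<omega>) / real n) \<longlonglongrightarrow> 0)"
    unfolding AE_all_countable using part by blast
  then have 2: "AE \<omega> in M. \<forall>l. \<forall>\<delta>>0. \<exists>P. finite P \<and> disjoint P \<and> \<Union>P = core S l \<and>
      (\<forall>W\<in>P. (\<forall>u\<in>W. \<forall>v\<in>W. dist u v \<le> \<delta>) \<and>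
        (\<lambda>n. (\<Sum>k=1..n. indicator W (X k \<omega>) * e k \<omega>) / real n) \<longlonglongrightarrow> 0)"
  proof eventually_elim
    case (elim \<omega>)
    show ?case
    proof (intro allI impI)
      fix l and \<delta> :: real assume "\<delta> > 0"
      then obtain m where m: "1 / real (Suc m) < \<delta>" using nat_approx_posE by blast
      from elim[rule_format, of l m] obtain P where P: "finite P \<and> disjoint P \<and> \<Union>P = core S l \<and>
        (\<forall>W\<in>P. (\<forall>u\<in>W. \<forall>v\<in>W. dist u v \<le> 1 / real (Suc m)) \<and>
          (\<lambda>n. (\<Sum>k=1..n. indicator W (X k \<omega>) * e k \<omega>) / real n) \<longlonglongrightarrow> 0)" ..
      have "dist u v \<le> \<delta>" if "W \<in> P" "u \<in> W" "v \<in> W" for W u v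
      proof -
        have "dist u v \<le> 1 / real (Suc m)" using P that by blast
        then show ?thesis using m by linarith
      qed
      with P show "\<exists>P. finite P \<and> disjoint P \<and> \<Union>P = core S l \<and> (\<forall>W\<in>P. (\<forall>u\<in>W. \<forall>v\<in>W. dist u v \<le> \<delta>) \<and>
        (\<lambda>n. (\<Sum>k=1..n. indicator W (X k \<omega>) * e k \<omega>) / real n) \<longlonglongrightarrow> 0)"
        by (intro exI[of _ P] conjI ballI) simp_all
    qed
  qed
  have "\<forall>m. \<exists>l. AE \<omega> in M. \<forall>\<^sub>F n in sequentially.
      (\<Sum>k=1..n. indicator (- core S l) (X k \<omega>) * (e k \<omega>)\<^sup>2) \<le> 1 / real (Suc m) * real n"
    by (intro allI out) simp
  from choice[OF this] obtain l where l: "\<And>m. AE \<omega> in M. \<forall>\<^sub>F n in sequentially.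
      (\<Sum>k=1..n. indicator (- core S (l m)) (X k \<omega>) * (e k \<omega>)\<^sup>2) \<le> 1 / real (Suc m) * real n" by blast
  then have "AE \<omega> in M. \<forall>m. \<forall>\<^sub>F n in sequentially.
      (\<Sum>k=1..n. indicator (- core S (l m)) (X k \<omega>) * (e k \<omega>)\<^sup>2) \<le> 1 / real (Suc m) * real n"
    unfolding AE_all_countable by blast
  then have 3: "AE \<omega> in M. \<forall>\<delta>>0. \<exists>l. \<forall>\<^sub>F n in sequentially.
      (\<Sum>k=1..n. indicator (- core S l) (X k \<omega>) * (e k \<omega>)\<^sup>2) \<le> \<delta> * real n"
  proof eventually_elim
    case (elim \<omega>)
    show ?case
    proof (intro allI impI)
      fix \<delta> :: real assume "\<delta> > 0"
      then obtain m where m: "1 / real (Suc m) < \<delta>" using nat_approx_posE by blast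
      have "1 / real (Suc m) * real n \<le> \<delta> * real n" for n using m by (intro mult_right_mono) auto
      then have "\<forall>\<^sub>F n in sequentially. (\<Sum>k=1..n. indicator (- core S (l m)) (X k \<omega>) * (e k \<omega>)\<^sup>2) \<le> \<delta> * real n"
        using elim[rule_format, of m] by (auto elim!: eventually_mono intro: order_trans)
      then show "\<exists>l. \<forall>\<^sub>F n in sequentially. (\<Sum>k=1..n. indicator (- core S l) (X k \<omega>) * (e k \<omega>)\<^sup>2) \<le> \<delta> * real n" ..
    qed
  qed
  show ?thesis using 1 2 3 sq
  proof eventually_elim
    case (elim \<omega>)
    show ?case unfolding regular_path_def by (intro conjI elim(1-3) exI[of _ C] elim(4))
  qed
qed

end

section \<open>The three settings\<close>

lemma regular_path_cong:
  assumes "\<And>k. k \<ge> 1 \<Longrightarrow> x k = x' k \<and> e k = e' k"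
  shows "regular_path S x e = regular_path S x' e'"
proof -
  have "count_in x n A = count_in x' n A" for n A
    unfolding count_in_def using assms by (intro arg_cong[where f = card]) auto
  moreover have "(\<Sum>k=1..n. indicator W (x k) * e k) = (\<Sum>k=1..n. indicator W (x' k) * e' k)" for n W
    using assms by (intro sum.cong) auto
  moreover have "(\<Sum>k=1..n. (e k)\<^sup>2) = (\<Sum>k=1..n. (e' k)\<^sup>2)" for n
    using assms by (intro sum.cong) auto
  moreover have "(\<Sum>k=1..n. indicator W (x k) * (e k)\<^sup>2) = (\<Sum>k=1..n. indicator W (x' k) * (e' k)\<^sup>2)" for n W
    using assms by (intro sum.cong) auto
  ultimately show ?thesis unfolding regular_path_def by (simp only:)
qed

text \<open>
  \<open>\<phi>\<close> is replaced by 0 outside of the interior of \<open>S\<close>, a null event, to get a noise function that is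
  Borel measurable and not only measurable for the completion of \<open>\<mu>\<close>.
\<close>

lemma stochastic_design_noise:
  fixes S :: "'b::euclidean_space set" and \<mu> :: "('b \<times> real) measure"
  assumes S: "closed S" "convex S" and \<phi>: "proper_convex \<phi>" "S \<subseteq> eff_dom \<phi>"
    and \<mu>: "prob_space \<mu>" "sets \<mu> = sets borel"
    and cond: "AE p in completion \<mu>. real_cond_exp (completion \<mu>) (vimage_algebra UNIV fst borel)
        (\<lambda>(x, y). y - real_of_ereal (\<phi> x)) p = 0"
    and sq_int: "integrable (completion \<mu>) (\<lambda>(x, y). \<bar>y - real_of_ereal (\<phi> x)\<bar>\<^sup>2)"
    and \<nu>: "lebesgue_equivalent_on S (distr \<mu> borel fst)"
  obtains e where "e \<in> borel_measurable borel" "integrable \<mu> (\<lambda>p. (e p)\<^sup>2)" "AE p in \<mu>. fst p \<in> interior S"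
    "\<And>p. fst p \<in> interior S \<Longrightarrow> e p = snd p - real_of_ereal (\<phi> (fst p))"
    "\<And>B. B \<in> sets borel \<Longrightarrow> (\<integral>p. indicator B (fst p) * e p \<partial>\<mu>) = 0"
proof -
  interpret \<mu>: prob_space \<mu> by (rule \<mu>(1))
  have space\<mu>: "space \<mu> = UNIV" using sets_eq_imp_space_eq[OF \<mu>(2)] by simp
  have meas\<mu>: "measurable \<mu> N = measurable borel N" for N :: "'c measure" by (rule measurable_cong_sets[OF \<mu>(2) refl])
  define g where "g x = real_of_ereal (\<phi> x)" for x
  have "convex_on S g"
    unfolding g_def using \<phi> S(2) by (intro proper_convex_imp_convex_on) (auto simp: eff_dom_def)
  then have gcont: "continuous_on (interior S) g"
    by (intro convex_on_continuous open_interior convex_on_subset[OF _ interior_subset]) (simp_all add: convex_interior S)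
  define g' where "g' x = indicator (interior S) x *\<^sub>R g x" for x
  have g'[measurable]: "g' \<in> borel_measurable borel"
    unfolding g'_def[abs_def] by (intro borel_measurable_continuous_on_indicator gcont) simp
  have fst[measurable]: "(fst :: 'b \<times> real \<Rightarrow> 'b) \<in> borel_measurable borel"
    and snd[measurable]: "(snd :: 'b \<times> real \<Rightarrow> real) \<in> borel_measurable borel"
    by (intro borel_measurable_continuous_onI continuous_on_fst continuous_on_snd continuous_on_id)+
  define e where "e p = snd p - g' (fst p)" for p :: "'b \<times> real"
  have e[measurable]: "e \<in> borel_measurable borel" unfolding e_def[abs_def]
    by (intro borel_measurable_diff snd measurable_compose[OF fst g'])
  have ind_fst: "(\<lambda>p :: 'b \<times> real. indicator B (fst p) :: real) \<in> borel_measurable borel" if "B \<in> sets borel" for B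
    by (rule measurable_compose[OF fst borel_measurable_indicator[OF that]])
  have fst\<mu>: "fst \<in> measurable \<mu> borel" and e\<mu>: "e \<in> borel_measurable \<mu>" unfolding meas\<mu> by simp_all
  define f where "f p = snd p - g (fst p)" for p :: "'b \<times> real"
  have ae_int: "AE p in \<mu>. fst p \<in> interior S"
  proof -
    have "\<mu>.prob (fst -` interior S \<inter> space \<mu>) = 1"
      using measure_interior_eq_1[OF S \<nu>] by (simp add: measure_distr[OF fst\<mu>])
    then have "AE p in \<mu>. p \<in> fst -` interior S \<inter> space \<mu>"
      using measurable_sets[OF fst\<mu>, of "interior S"] by (subst (asm) \<mu>.prob_eq_1) auto
    then show ?thesis by eventually_elim simp
  qed
  have f_eq: "f p = e p" if "fst p \<in> interior S" for p using that by (simp add: f_def e_def g'_def)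
  have ae_f: "AE p in completion \<mu>. f p = e p"
    by (rule AE_completion) (use ae_int in \<open>eventually_elim, auto simp: f_eq\<close>)
  have null: "{p. fst p \<notin> interior S} \<in> null_sets \<mu>"
  proof -
    have "{p \<in> space \<mu>. \<not> fst p \<in> interior S} \<in> sets \<mu>"
      using measurable_sets[OF fst\<mu>, of "- interior S"] by (simp add: vimage_def Int_def conj_commute)
    then show ?thesis using ae_int by (simp add: AE_iff_null space\<mu>)
  qed
  \<comment> \<open>Off a null set \<open>f\<close> agrees with a Borel function, and every subset
    of a null set is measurable for the completion.\<close>
  have f_meas: "f \<in> borel_measurable (completion \<mu>)"
  proof (rule measurableI)
    fix B :: "real set" assume B: "B \<in> sets borel"
    have "f -` B \<inter> space (completion \<mu>) = (e -` B \<inter> {p. fst p \<in> interior S}) \<union> (f -` B \<inter> {p. fst p \<notin> interior S})"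
      by (auto simp: space\<mu> f_eq)
    moreover have "e -` B \<inter> {p. fst p \<in> interior S} \<in> sets (completion \<mu>)"
    proof -
      have "(e -` B \<inter> space \<mu>) \<inter> (fst -` interior S \<inter> space \<mu>) \<in> sets \<mu>"
        by (rule sets.Int[OF measurable_sets[OF e\<mu> B] measurable_sets[OF fst\<mu>]]) simp
      then show ?thesis by (intro sets_completionI_sets) (simp add: space\<mu> vimage_def)
    qed
    moreover have "f -` B \<inter> {p. fst p \<notin> interior S} \<in> sets (completion \<mu>)"
      by (rule null_sets_completion[OF null]) auto
    ultimately show "f -` B \<inter> space (completion \<mu>) \<in> sets (completion \<mu>)" by simp
  qed simp
  have ec: "e \<in> borel_measurable (completion \<mu>)" by (rule measurable_completion[OF e\<mu>])
  have e2: "integrable \<mu> (\<lambda>p. (e p)\<^sup>2)"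
  proof -
    have "integrable (completion \<mu>) (\<lambda>p. (f p)\<^sup>2)"
      using sq_int by (simp add: f_def g_def case_prod_beta')
    moreover have "AE p in completion \<mu>. (f p)\<^sup>2 = (e p)\<^sup>2" using ae_f by eventually_elim simp
    ultimately have "integrable (completion \<mu>) (\<lambda>p. (e p)\<^sup>2)"
      using f_meas ec by (subst (asm) integrable_cong_AE[of _ _ "\<lambda>p. (e p)\<^sup>2"]) auto
    then show ?thesis using e\<mu> by (subst (asm) integrable_completion) auto
  qed
  have e1: "integrable \<mu> e" by (rule \<mu>.square_integrable_imp_integrable[OF e\<mu> e2])
  \<comment> \<open>Integration against a function of the design replaces \<open>f\<close> by its
    conditional expectation, which is 0.\<close>
  have mean0: "(\<integral>p. indicator B (fst p) * e p \<partial>\<mu>) = 0" if B: "B \<in> sets borel" for B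
  proof -
    define F where "F = vimage_algebra UNIV (fst :: 'b \<times> real \<Rightarrow> 'b) borel"
    have "subalgebra (completion \<mu>) F"
      unfolding subalgebra_def
    proof
      show "space F = space (completion \<mu>)" by (simp add: F_def space\<mu>)
      show "sets F \<subseteq> sets (completion \<mu>)"
      proof
        fix A assume "A \<in> sets F"
        then obtain A' where "A = fst -` A' \<inter> UNIV" "A' \<in> sets borel"
          unfolding F_def by (subst (asm) sets_vimage_algebra2) auto
        then show "A \<in> sets (completion \<mu>)"
          using measurable_sets[OF fst\<mu>, of A'] by (intro sets_completionI_sets) (simp add: space\<mu>)
      qed
    qed
    moreover have "finite_measure (completion \<mu>)"
      by (rule finite_measureI) (simp add: emeasure_completion \<mu>.emeasure_space_1)
    ultimately have sub: "sigma_finite_subalgebra (completion \<mu>) F"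
      by (intro finite_measure_subalgebra_is_sigma_finite)
        (simp add: finite_measure_subalgebra_def finite_measure_subalgebra_axioms_def)
    have iF: "(\<lambda>p. indicator B (fst p) :: real) \<in> borel_measurable F"
    proof -
      have "fst \<in> measurable F borel" unfolding F_def by (rule measurable_vimage_algebra1) simp
      then show ?thesis using B by (intro borel_measurable_indicator' ) (auto intro: measurable_sets)
    qed
    have Bc: "(\<lambda>p. indicator B (fst p) :: real) \<in> borel_measurable \<mu>"
      unfolding meas\<mu> by (rule ind_fst[OF B])
    have "integrable \<mu> (\<lambda>p. indicator B (fst p) * e p)"
      using Bc e\<mu> by (intro Bochner_Integration.integrable_bound[OF e1]) (auto simp: indicator_def)
    then have "integrable (completion \<mu>) (\<lambda>p. indicator B (fst p) * e p)"
      using Bc e\<mu> by (subst integrable_completion) auto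
    moreover have ae: "AE p in completion \<mu>. indicator B (fst p) * e p = indicator B (fst p) * f p"
      using ae_f by eventually_elim simp
    moreover have Bcc: "(\<lambda>p. indicator B (fst p) :: real) \<in> borel_measurable (completion \<mu>)"
      by (rule measurable_completion[OF Bc])
    ultimately have intf: "integrable (completion \<mu>) (\<lambda>p. indicator B (fst p) * f p)"
      using ec f_meas by (subst (asm) integrable_cong_AE[of _ _ "\<lambda>p. indicator B (fst p) * f p"]) auto
    have "(\<integral>p. indicator B (fst p) * e p \<partial>\<mu>) = (\<integral>p. indicator B (fst p) * e p \<partial>completion \<mu>)"
      using Bc e\<mu> by (intro integral_completion[symmetric]) auto
    also have "\<dots> = (\<integral>p. indicator B (fst p) * f p \<partial>completion \<mu>)"
      using ae Bcc ec f_meas by (intro integral_cong_AE) auto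
    also have "\<dots> = (\<integral>p. indicator B (fst p) * real_cond_exp (completion \<mu>) F f p \<partial>completion \<mu>)"
      by (rule sigma_finite_subalgebra.real_cond_exp_intg(2)[OF sub intf iF f_meas, symmetric])
    also have "\<dots> = (\<integral>p. 0 \<partial>completion \<mu>)"
    proof (rule integral_cong_AE)
      have "(\<lambda>(x, y). y - real_of_ereal (\<phi> x)) = f" by (auto simp: f_def g_def)
      then have "AE p in completion \<mu>. real_cond_exp (completion \<mu>) F f p = 0" using cond by (simp add: F_def)
      then show "AE p in completion \<mu>. indicator B (fst p) * real_cond_exp (completion \<mu>) F f p = 0"
        by eventually_elim simp
      show "(\<lambda>p. indicator B (fst p) * real_cond_exp (completion \<mu>) F f p) \<in> borel_measurable (completion \<mu>)"
        using Bcc borel_measurable_cond_exp2 by (intro borel_measurable_times)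
    qed simp
    finally show ?thesis by simp
  qed
  have "e p = snd p - real_of_ereal (\<phi> (fst p))" if "fst p \<in> interior S" for p
    using f_eq[OF that] by (simp add: f_def g_def)
  from that[OF e e2 ae_int this mean0] show ?thesis .
qed

section \<open>Verification for fixed designs and for the random design\<close>

context prob_space
begin

text \<open>What the two fixed design settings share. They differ in the source of the law of large
  numbers for squared errors, which is therefore a hypothesis; 0-1 weights restrict it to the design
  points outside of a core.\<close>

lemma fixed_design_regular_path:
  fixes S :: "'b::euclidean_space set" and \<epsilon> :: "nat \<Rightarrow> 'a \<Rightarrow> real"
  assumes S: "closed S" "convex S" and design: "fixed_design S x \<nu>"
    and ind: "indep_vars (\<lambda>_. borel) \<epsilon> {1..}"
    and mean: "\<And>k. k \<ge> 1 \<Longrightarrow> integrable M (\<epsilon> k) \<and> expectation (\<epsilon> k) = 0"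
    and sq: "\<And>k. k \<ge> 1 \<Longrightarrow> integrable M (\<lambda>\<omega>. (\<epsilon> k \<omega>)\<^sup>2)" "\<And>k. k \<ge> 1 \<Longrightarrow> expectation (\<lambda>\<omega>. (\<epsilon> k \<omega>)\<^sup>2) \<le> C"
    and slln: "\<And>w. (\<And>k. w k = 0 \<or> w k = (1::real)) \<Longrightarrow>
      AE \<omega> in M. (\<lambda>n. (\<Sum>k=1..n. w k * (\<epsilon> k \<omega>)\<^sup>2 - w k * expectation (\<lambda>\<omega>. (\<epsilon> k \<omega>)\<^sup>2)) / real n) \<longlonglongrightarrow> 0"
  shows "AE \<omega> in M. regular_path S x (\<lambda>k. \<epsilon> k \<omega>)"
proof -
  have C: "0 \<le> C"
  proof -
    have "0 \<le> expectation (\<lambda>\<omega>. (\<epsilon> 1 \<omega>)\<^sup>2)" by (rule Bochner_Integration.integral_nonneg) simp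
    then show ?thesis using sq(2)[of 1] by linarith
  qed
  \<comment> \<open>The noise energy on the selected indices is at most \<open>C\<close> times their
    number, up to a small multiple of \<open>n\<close> for the random deviation.\<close>
  have weighted: "AE \<omega> in M. \<forall>\<^sub>F n in sequentially. (\<Sum>k=1..n. w k * (\<epsilon> k \<omega>)\<^sup>2) \<le> C * (\<Sum>k=1..n. w k) + \<eta> * real n"
    if w: "\<And>k. w k = 0 \<or> w k = (1::real)" and \<eta>: "\<eta> > 0" for w \<eta>
    using slln[of w, OF w]
  proof eventually_elim
    case (elim \<omega>)
    have "\<forall>\<^sub>F n in sequentially. (\<Sum>k=1..n. w k * (\<epsilon> k \<omega>)\<^sup>2 - w k * expectation (\<lambda>\<omega>. (\<epsilon> k \<omega>)\<^sup>2)) / real n < \<eta>"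
      using elim \<eta> by (rule order_tendstoD(2))
    then show ?case using eventually_gt_at_top[of 0]
    proof eventually_elim
      case (elim n)
      have "(\<Sum>k=1..n. w k * expectation (\<lambda>\<omega>. (\<epsilon> k \<omega>)\<^sup>2)) \<le> (\<Sum>k=1..n. w k * C)"
      proof (intro sum_mono mult_left_mono)
        fix k assume "k \<in> {1..n}"
        then show "expectation (\<lambda>\<omega>. (\<epsilon> k \<omega>)\<^sup>2) \<le> C" by (intro sq(2)) simp
        show "0 \<le> w k" using w[of k] by auto
      qed
      also have "\<dots> = C * (\<Sum>k=1..n. w k)" by (simp add: sum_distrib_left mult.commute)
      finally have "(\<Sum>k=1..n. w k * expectation (\<lambda>\<omega>. (\<epsilon> k \<omega>)\<^sup>2)) \<le> C * (\<Sum>k=1..n. w k)" .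
      moreover have "(\<Sum>k=1..n. w k * (\<epsilon> k \<omega>)\<^sup>2 - w k * expectation (\<lambda>\<omega>. (\<epsilon> k \<omega>)\<^sup>2)) < \<eta> * real n"
        using elim by (simp add: divide_less_eq)
      ultimately show ?case by (simp add: sum_subtractf)
    qed
  qed
  have "AE \<omega> in M. regular_path S (\<lambda>k. (\<lambda>_. x k) \<omega>) (\<lambda>k. \<epsilon> k \<omega>)"
  proof (rule AE_regular_path[OF S(1), where C = "C + 1"])
    fix B :: "'b set" assume "B \<in> sets borel"
    show "AE \<omega> in M. (\<lambda>n. (\<Sum>k=1..n. indicator B (x k) * \<epsilon> k \<omega>) / real n) \<longlonglongrightarrow> 0"
    proof (rule slln_centered)
      show "indep_vars (\<lambda>_. borel) (\<lambda>k \<omega>. indicator B (x k) * \<epsilon> k \<omega>) {1..}"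
        by (rule indep_vars_compose2[OF ind]) simp
      show "integrable M (\<lambda>\<omega>. (indicator B (x k) * \<epsilon> k \<omega>)\<^sup>2)" if "k \<ge> 1" for k
        using sq(1)[OF that] by (simp add: power_mult_distrib)
      show "expectation (\<lambda>\<omega>. (indicator B (x k) * \<epsilon> k \<omega>)\<^sup>2) \<le> C" if "k \<ge> 1" for k
        using sq(2)[OF that] C by (cases "x k \<in> B") (auto simp: power_mult_distrib)
      show "expectation (\<lambda>\<omega>. indicator B (x k) * \<epsilon> k \<omega>) = 0" if "k \<ge> 1" for k
        using mean[OF that] by simp
    qed
  next
    show "AE \<omega> in M. \<forall>\<^sub>F n in sequentially. (\<Sum>k=1..n. (\<epsilon> k \<omega>)\<^sup>2) \<le> (C + 1) * real n"
      using weighted[of "\<lambda>_. 1" 1] by (simp add: distrib_right)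
  next
    fix \<delta> :: real assume \<delta>: "\<delta> > 0"
    \<comment> \<open>Half of \<open>\<delta>\<close> is kept for the random deviation;
      \<open>C + 1\<close> in place of \<open>C\<close> avoids division by 0.\<close>
    have "\<delta> / (2 * (C + 1)) > 0" using \<delta> C by simp
    from fixed_design_outside_core[OF S design this] obtain l
      where l: "\<forall>\<^sub>F n in sequentially. (\<Sum>k=1..n. indicator (- core S l) (x k)) \<le> \<delta> / (2 * (C + 1)) * real n" ..
    have "AE \<omega> in M. \<forall>\<^sub>F n in sequentially. (\<Sum>k=1..n. indicator (- core S l) (x k) * (\<epsilon> k \<omega>)\<^sup>2)
        \<le> C * (\<Sum>k=1..n. indicator (- core S l) (x k)) + \<delta> / 2 * real n"
      using \<delta> by (intro weighted) (auto simp: indicator_def)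
    then have "AE \<omega> in M. \<forall>\<^sub>F n in sequentially. (\<Sum>k=1..n. indicator (- core S l) (x k) * (\<epsilon> k \<omega>)\<^sup>2) \<le> \<delta> * real n"
    proof eventually_elim
      case (elim \<omega>)
      from elim l show ?case
      proof eventually_elim
        case (elim n)
        have "C * (\<Sum>k=1..n. indicator (- core S l) (x k)) \<le> (C + 1) * (\<delta> / (2 * (C + 1)) * real n)"
          using elim(2) C by (intro mult_mono) (auto intro!: sum_nonneg)
        also have "\<dots> = \<delta> / 2 * real n" using C by (simp add: field_simps)
        finally show ?case using elim(1) by simp
      qed
    qed
    then show "\<exists>l. AE \<omega> in M. \<forall>\<^sub>F n in sequentially. (\<Sum>k=1..n. indicator (- core S l) (x k) * (\<epsilon> k \<omega>)\<^sup>2) \<le> \<delta> * real n" ..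
  next
    fix a b :: 'b assume box: "box a b \<noteq> {}" "box a b \<subseteq> interior S"
    have pos: "measure \<nu> (box a b) > 0"
      using design box interior_subset[of S] by (intro measure_box_pos[of S]) (auto simp: fixed_design_def)
    have "(\<lambda>n. real (count_in x n (box a b)) / real n) \<longlonglongrightarrow> measure \<nu> (box a b)"
      using design box by (simp add: fixed_design_def)
    then have "\<forall>\<^sub>F n in sequentially. real (count_in x n (box a b)) / real n > measure \<nu> (box a b) / 2"
      using pos by (intro order_tendstoD(1)) auto
    then have "\<forall>\<^sub>F n in sequentially. measure \<nu> (box a b) / 2 * real n \<le> real (count_in x n (box a b))"
      using eventually_gt_at_top[of 0] by eventually_elim (simp add: less_divide_eq)
    then show "\<exists>p>0. AE \<omega> in M. \<forall>\<^sub>F n in sequentially. p * real n \<le> real (count_in (\<lambda>k. x k) n (box a b))"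
      using pos by (intro exI[of _ "measure \<nu> (box a b) / 2"]) auto
  qed
  then show ?thesis .
qed

text \<open>The interface between the settings and the estimator. The noise is existential because
  for a random design it is a Borel modification of \<open>Y - \<phi>(X)\<close>, which satisfies
  the model equation almost surely.\<close>

definition regular_sample ::
    "'b::euclidean_space set \<Rightarrow> ('b \<Rightarrow> ereal) \<Rightarrow> (nat \<Rightarrow> 'a \<Rightarrow> 'b) \<Rightarrow> (nat \<Rightarrow> 'a \<Rightarrow> real) \<Rightarrow> bool" where
  "regular_sample S \<phi> X Y \<longleftrightarrow>
     (\<forall>k\<ge>1. X k \<in> borel_measurable M \<and> Y k \<in> borel_measurable M) \<and>
     (\<exists>e. AE \<omega> in M. (\<forall>k\<ge>1. X k \<omega> \<in> S \<and> Y k \<omega> = real_of_ereal (\<phi> (X k \<omega>)) + e k \<omega>) \<and>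
        regular_path S (\<lambda>k. X k \<omega>) (\<lambda>k. e k \<omega>))"

lemma fixed_design_regular_sample:
  fixes S :: "'b::euclidean_space set"
  assumes design: "fixed_design S x \<nu>"
    and XY: "\<forall>n\<ge>1. \<forall>\<omega>\<in>space M. X n \<omega> = x n \<and> Y n \<omega> = real_of_ereal (\<phi> (x n)) + \<epsilon> n \<omega>"
    and ind: "indep_vars (\<lambda>_. borel) \<epsilon> {1..}"
    and reg: "AE \<omega> in M. regular_path S x (\<lambda>k. \<epsilon> k \<omega>)"
  shows "regular_sample S \<phi> X Y"
  unfolding regular_sample_def
proof (intro conjI allI impI exI[of _ \<epsilon>])
  fix k :: nat assume k: "k \<ge> 1"
  have [measurable]: "\<epsilon> k \<in> borel_measurable M" using ind k by (auto simp: indep_vars_def)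
  have "(\<lambda>_. x k) \<in> borel_measurable M" by simp
  then show "X k \<in> borel_measurable M" by (rule measurable_cong[THEN iffD2, rotated]) (use XY k in simp)
  have "(\<lambda>\<omega>. real_of_ereal (\<phi> (x k)) + \<epsilon> k \<omega>) \<in> borel_measurable M" by measurable
  then show "Y k \<in> borel_measurable M" by (rule measurable_cong[THEN iffD2, rotated]) (use XY k in simp)
next
  show "AE \<omega> in M. (\<forall>k\<ge>1. X k \<omega> \<in> S \<and> Y k \<omega> = real_of_ereal (\<phi> (X k \<omega>)) + \<epsilon> k \<omega>) \<and>
      regular_path S (\<lambda>k. X k \<omega>) (\<lambda>k. \<epsilon> k \<omega>)"
    using reg AE_space
  proof eventually_elim
    case (elim \<omega>)
    have "regular_path S (\<lambda>k. X k \<omega>) (\<lambda>k. \<epsilon> k \<omega>)"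
      using elim XY by (subst regular_path_cong[where x' = x and e' = "\<lambda>k. \<epsilon> k \<omega>"]) auto
    then show ?case using elim XY design by (simp add: fixed_design_def)
  qed
qed

lemma setting_iid_errors_regular_sample:
  fixes S :: "'b::euclidean_space set"
  assumes S: "closed S" "convex S" and setting: "setting_iid_errors S \<phi> X Y \<sigma>"
  shows "regular_sample S \<phi> X Y"
proof -
  obtain \<epsilon> where \<epsilon>: "fixed_design_model S \<phi> X Y \<epsilon>" "indep_vars (\<lambda>_. borel) \<epsilon> {1..}"
    "\<forall>j\<ge>1. \<forall>k\<ge>1. distr M borel (\<epsilon> j) = distr M borel (\<epsilon> k)"
    "\<forall>k\<ge>1. integrable M (\<epsilon> k) \<and> expectation (\<epsilon> k) = 0 \<and>
       integrable M (\<lambda>\<omega>. (\<epsilon> k \<omega>)\<^sup>2) \<and> expectation (\<lambda>\<omega>. (\<epsilon> k \<omega>)\<^sup>2) = \<sigma>\<^sup>2"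
    using setting unfolding setting_iid_errors_def by blast
  obtain x \<nu> where x: "fixed_design S x \<nu>"
    "\<forall>n\<ge>1. \<forall>\<omega>\<in>space M. X n \<omega> = x n \<and> Y n \<omega> = real_of_ereal (\<phi> (x n)) + \<epsilon> n \<omega>"
    using \<epsilon>(1) unfolding fixed_design_model_def by blast
  have rv: "\<epsilon> k \<in> borel_measurable M" if "k \<ge> 1" for k using \<epsilon>(2) that by (auto simp: indep_vars_def)
  have "AE \<omega> in M. regular_path S x (\<lambda>k. \<epsilon> k \<omega>)"
  proof (rule fixed_design_regular_path[OF S x(1) \<epsilon>(2), where C = "\<sigma>\<^sup>2"])
    fix w :: "nat \<Rightarrow> real" assume w: "\<And>k. w k = 0 \<or> w k = 1"
    have "AE \<omega> in M. (\<lambda>n. (\<Sum>k=1..n. w k * (\<epsilon> k \<omega>)\<^sup>2 - w k * expectation (\<lambda>\<omega>. (\<epsilon> 1 \<omega>)\<^sup>2)) / real n) \<longlonglongrightarrow> 0"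
    proof (rule slln_iid_weighted)
      show "indep_vars (\<lambda>_. borel) (\<lambda>k \<omega>. (\<epsilon> k \<omega>)\<^sup>2) {1..}"
        by (rule indep_vars_compose2[OF \<epsilon>(2)]) simp
      show "distr M borel (\<lambda>\<omega>. (\<epsilon> k \<omega>)\<^sup>2) = distr M borel (\<lambda>\<omega>. (\<epsilon> 1 \<omega>)\<^sup>2)" if "k \<ge> 1" for k
      proof -
        have "distr M borel (\<lambda>\<omega>. (\<epsilon> j \<omega>)\<^sup>2) = distr (distr M borel (\<epsilon> j)) borel (\<lambda>y. y\<^sup>2)" if "j \<ge> 1" for j
          using rv[OF that] by (subst distr_distr) (auto simp: comp_def)
        then show ?thesis using \<epsilon>(3) that by (metis le_refl)
      qed
      show "0 \<le> w k \<and> w k \<le> 1" for k using w[of k] by auto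
    qed (use \<epsilon>(4) in auto)
    moreover have "(\<Sum>k=1..n. w k * (\<epsilon> k \<omega>)\<^sup>2 - w k * expectation (\<lambda>\<omega>. (\<epsilon> k \<omega>)\<^sup>2))
        = (\<Sum>k=1..n. w k * (\<epsilon> k \<omega>)\<^sup>2 - w k * expectation (\<lambda>\<omega>. (\<epsilon> 1 \<omega>)\<^sup>2))" for n \<omega>
      using \<epsilon>(4) by (intro sum.cong) auto
    ultimately show "AE \<omega> in M. (\<lambda>n. (\<Sum>k=1..n. w k * (\<epsilon> k \<omega>)\<^sup>2 - w k * expectation (\<lambda>\<omega>. (\<epsilon> k \<omega>)\<^sup>2)) / real n) \<longlonglongrightarrow> 0"
      by simp
  qed (use \<epsilon>(4) in auto)
  then show ?thesis by (rule fixed_design_regular_sample[OF x \<epsilon>(2)])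
qed

lemma setting_heteroscedastic_regular_sample:
  fixes S :: "'b::euclidean_space set"
  assumes S: "closed S" "convex S" and setting: "setting_heteroscedastic S \<phi> X Y \<sigma>"
  shows "regular_sample S \<phi> X Y"
proof -
  obtain \<epsilon> where \<epsilon>: "fixed_design_model S \<phi> X Y \<epsilon>" "indep_vars (\<lambda>_. borel) \<epsilon> {1..}"
    "\<forall>k\<ge>1. integrable M (\<epsilon> k) \<and> expectation (\<epsilon> k) = 0"
    "\<forall>k\<ge>1. integrable M (\<lambda>\<omega>. (\<epsilon> k \<omega>)\<^sup>2) \<and> integrable M (\<lambda>\<omega>. ((\<epsilon> k \<omega>)\<^sup>2)\<^sup>2)"
    "summable (\<lambda>n. variance (\<lambda>\<omega>. (\<epsilon> (Suc n) \<omega>)\<^sup>2) / (real (Suc n))\<^sup>2)"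
    "(SUP n\<in>{1..}. ereal (expectation (\<lambda>\<omega>. (\<epsilon> n \<omega>)\<^sup>2))) < \<infinity>"
    using setting unfolding setting_heteroscedastic_def by blast
  obtain x \<nu> where x: "fixed_design S x \<nu>"
    "\<forall>n\<ge>1. \<forall>\<omega>\<in>space M. X n \<omega> = x n \<and> Y n \<omega> = real_of_ereal (\<phi> (x n)) + \<epsilon> n \<omega>"
    using \<epsilon>(1) unfolding fixed_design_model_def by blast
  have upper: "ereal (expectation (\<lambda>\<omega>. (\<epsilon> k \<omega>)\<^sup>2)) \<le> (SUP n\<in>{1..}. ereal (expectation (\<lambda>\<omega>. (\<epsilon> n \<omega>)\<^sup>2)))" if "k \<ge> 1" for k
    using that by (intro SUP_upper) simp
  obtain C where C: "(SUP n\<in>{1..}. ereal (expectation (\<lambda>\<omega>. (\<epsilon> n \<omega>)\<^sup>2))) = ereal C"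
    using \<epsilon>(6) upper[of 1] by (cases "SUP n\<in>{1..}. ereal (expectation (\<lambda>\<omega>. (\<epsilon> n \<omega>)\<^sup>2))") auto
  have EC: "expectation (\<lambda>\<omega>. (\<epsilon> k \<omega>)\<^sup>2) \<le> C" if "k \<ge> 1" for k using upper[OF that] unfolding C by simp
  have E0: "0 \<le> expectation (\<lambda>\<omega>. (\<epsilon> k \<omega>)\<^sup>2)" for k by (rule Bochner_Integration.integral_nonneg) simp
  have "AE \<omega> in M. regular_path S x (\<lambda>k. \<epsilon> k \<omega>)"
  proof (rule fixed_design_regular_path[OF S x(1) \<epsilon>(2) _ _ EC])
    fix w :: "nat \<Rightarrow> real" assume w: "\<And>k. w k = 0 \<or> w k = 1"
    \<comment> \<open>Weights 0 and 1 can only remove variances, so the summability hypothesis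
      persists.\<close>
    have var_le: "variance (\<lambda>\<omega>. w k * (\<epsilon> k \<omega>)\<^sup>2) \<le> variance (\<lambda>\<omega>. (\<epsilon> k \<omega>)\<^sup>2)" for k
      using w[of k] variance_positive[of "\<lambda>\<omega>. (\<epsilon> k \<omega>)\<^sup>2"] by auto
    have "AE \<omega> in M. (\<lambda>n. (\<Sum>k=1..n. w k * (\<epsilon> k \<omega>)\<^sup>2 - expectation (\<lambda>\<omega>. w k * (\<epsilon> k \<omega>)\<^sup>2)) / real n) \<longlonglongrightarrow> 0"
    proof (rule slln_nonneg_variance)
      show "indep_vars (\<lambda>_. borel) (\<lambda>k \<omega>. w k * (\<epsilon> k \<omega>)\<^sup>2) {1..}"
        by (rule indep_vars_compose2[OF \<epsilon>(2)]) simp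
      show "0 \<le> w k * (\<epsilon> k \<omega>)\<^sup>2" for k \<omega> using w[of k] by auto
      show "integrable M (\<lambda>\<omega>. (w k * (\<epsilon> k \<omega>)\<^sup>2)\<^sup>2)" if "k \<ge> 1" for k
        using \<epsilon>(4) that by (simp add: power_mult_distrib)
      show "expectation (\<lambda>\<omega>. w k * (\<epsilon> k \<omega>)\<^sup>2) \<le> C" if "k \<ge> 1" for k
        using w[of k] EC[OF that] order_trans[OF E0 EC[OF that]] by auto
      show "(\<Sum>k=1..N. variance (\<lambda>\<omega>. w k * (\<epsilon> k \<omega>)\<^sup>2) / (real k)\<^sup>2)
          \<le> (\<Sum>n. variance (\<lambda>\<omega>. (\<epsilon> (Suc n) \<omega>)\<^sup>2) / (real (Suc n))\<^sup>2)" for N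
      proof -
        have "(\<Sum>k=1..N. variance (\<lambda>\<omega>. w k * (\<epsilon> k \<omega>)\<^sup>2) / (real k)\<^sup>2) \<le> (\<Sum>k=1..N. variance (\<lambda>\<omega>. (\<epsilon> k \<omega>)\<^sup>2) / (real k)\<^sup>2)"
          by (intro sum_mono divide_right_mono var_le) simp
        also have "\<dots> = (\<Sum>n<N. variance (\<lambda>\<omega>. (\<epsilon> (Suc n) \<omega>)\<^sup>2) / (real (Suc n))\<^sup>2)"
          unfolding One_nat_def sum.atLeast_Suc_atMost_Suc_shift
          by (rule sum.reindex_bij_witness[where i = Suc and j = "\<lambda>k. k - 1"]) auto
        also have "\<dots> \<le> (\<Sum>n. variance (\<lambda>\<omega>. (\<epsilon> (Suc n) \<omega>)\<^sup>2) / (real (Suc n))\<^sup>2)"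
          by (intro sum_le_suminf \<epsilon>(5) divide_nonneg_nonneg variance_positive) auto
        finally show ?thesis .
      qed
    qed
    then show "AE \<omega> in M. (\<lambda>n. (\<Sum>k=1..n. w k * (\<epsilon> k \<omega>)\<^sup>2 - w k * expectation (\<lambda>\<omega>. (\<epsilon> k \<omega>)\<^sup>2)) / real n) \<longlonglongrightarrow> 0"
      by simp
  qed (use \<epsilon>(3,4) in auto)
  then show ?thesis by (rule fixed_design_regular_sample[OF x \<epsilon>(2)])
qed

text \<open>Every clause of \<open>regular_path\<close> becomes a law of large numbers for a Borel
  function of the pair: an indicator times the noise, the squared noise, the squared noise outside
  of a core, the indicator of a box. The limits are integrals under \<open>\<mu>\<close>.\<close>

lemma setting_stochastic_design_regular_sample:
  fixes S :: "'b::euclidean_space set"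
  assumes S: "closed S" "convex S" and \<phi>: "proper_convex \<phi>" "S \<subseteq> eff_dom \<phi>"
    and setting: "setting_stochastic_design S \<phi> X Y \<sigma>"
  shows "regular_sample S \<phi> X Y"
proof -
  obtain \<mu> :: "('b \<times> real) measure" where \<mu>: "prob_space \<mu>" "sets \<mu> = sets borel"
    and ind: "indep_vars (\<lambda>_. borel) (\<lambda>n \<omega>. (X n \<omega>, Y n \<omega>)) {1..}"
    and distr: "\<forall>n\<ge>1. distr M borel (\<lambda>\<omega>. (X n \<omega>, Y n \<omega>)) = \<mu>"
    and cond: "AE p in completion \<mu>. real_cond_exp (completion \<mu>) (vimage_algebra UNIV fst borel)
        (\<lambda>(x, y). y - real_of_ereal (\<phi> x)) p = 0"
    and sq_int: "integrable (completion \<mu>) (\<lambda>(x, y). \<bar>y - real_of_ereal (\<phi> x)\<bar>\<^sup>2)"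
    and \<nu>: "lebesgue_equivalent_on S (distr \<mu> borel fst)"
    using setting unfolding setting_stochastic_design_def by blast
  have space\<mu>: "space \<mu> = UNIV" using sets_eq_imp_space_eq[OF \<mu>(2)] by simp
  have meas\<mu>: "measurable \<mu> N = measurable borel N" for N :: "'c measure" by (rule measurable_cong_sets[OF \<mu>(2) refl])
  have fst[measurable]: "(fst :: 'b \<times> real \<Rightarrow> 'b) \<in> borel_measurable borel"
    and snd[measurable]: "(snd :: 'b \<times> real \<Rightarrow> real) \<in> borel_measurable borel"
    by (intro borel_measurable_continuous_onI continuous_on_fst continuous_on_snd continuous_on_id)+
  have ind_fst: "(\<lambda>p :: 'b \<times> real. indicator B (fst p) :: real) \<in> borel_measurable borel" if "B \<in> sets borel" for B
    by (rule measurable_compose[OF fst borel_measurable_indicator[OF that]])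
  have fst\<mu>: "fst \<in> measurable \<mu> borel" unfolding meas\<mu> by (rule fst)
  obtain e' where e'[measurable]: "e' \<in> borel_measurable borel" and e'2: "integrable \<mu> (\<lambda>p. (e' p)\<^sup>2)"
    and ae_int: "AE p in \<mu>. fst p \<in> interior S"
    and e'_eq: "\<And>p. fst p \<in> interior S \<Longrightarrow> e' p = snd p - real_of_ereal (\<phi> (fst p))"
    and mean0: "\<And>B. B \<in> sets borel \<Longrightarrow> (\<integral>p. indicator B (fst p) * e' p \<partial>\<mu>) = 0"
    using stochastic_design_noise[OF S \<phi> \<mu> cond sq_int \<nu>] by blast
  have pair[measurable]: "(\<lambda>\<omega>. (X k \<omega>, Y k \<omega>)) \<in> borel_measurable M" if "k \<ge> 1" for k
    using ind that by (auto simp: indep_vars_def)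
  have transfer: "integrable M (\<lambda>\<omega>. h (X k \<omega>, Y k \<omega>)) \<longleftrightarrow> integrable \<mu> h"
    "expectation (\<lambda>\<omega>. h (X k \<omega>, Y k \<omega>)) = (\<integral>p. h p \<partial>\<mu>)"
    if "h \<in> borel_measurable borel" "k \<ge> 1" for h :: "'b \<times> real \<Rightarrow> real" and k
    using integrable_distr_eq[OF pair[OF that(2)] that(1)] integral_distr[OF pair[OF that(2)] that(1)] distr that(2) by auto
  have indh: "indep_vars (\<lambda>_. borel) (\<lambda>k \<omega>. h (X k \<omega>, Y k \<omega>)) {1..}"
    if "h \<in> borel_measurable borel" for h :: "'b \<times> real \<Rightarrow> real"
    using indep_vars_compose2[OF ind, of "\<lambda>_. h" "\<lambda>_. borel"] that by simp
  have slln: "AE \<omega> in M. \<forall>\<^sub>F n in sequentially. \<bar>(\<Sum>k=1..n. h (X k \<omega>, Y k \<omega>)) - (\<integral>p. h p \<partial>\<mu>) * real n\<bar> \<le> \<eta> * real n"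
    if h: "h \<in> borel_measurable borel" "\<And>p. h p \<ge> 0" "integrable \<mu> h" and \<eta>: "\<eta> > 0" for h :: "'b \<times> real \<Rightarrow> real" and \<eta>
  proof -
    have "AE \<omega> in M. (\<lambda>n. (\<Sum>k=1..n. (\<lambda>_. 1) k * h (X k \<omega>, Y k \<omega>) - (\<lambda>_. 1) k * expectation (\<lambda>\<omega>. h (X 1 \<omega>, Y 1 \<omega>))) / real n) \<longlonglongrightarrow> 0"
    proof (rule slln_iid_weighted)
      show "distr M borel (\<lambda>\<omega>. h (X k \<omega>, Y k \<omega>)) = distr M borel (\<lambda>\<omega>. h (X 1 \<omega>, Y 1 \<omega>))" if "k \<ge> 1" for k
      proof -
        have "distr M borel (\<lambda>\<omega>. h (X j \<omega>, Y j \<omega>)) = distr \<mu> borel h" if j: "j \<ge> 1" for j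
          using distr_distr[OF h(1) pair[OF j]] distr j by (simp add: comp_def)
        then show ?thesis using that by simp
      qed
      show "integrable M (\<lambda>\<omega>. h (X 1 \<omega>, Y 1 \<omega>))" using transfer(1)[OF h(1), of 1] h(3) by simp
    qed (use indh[OF h(1)] h(2) in auto)
    then show ?thesis
    proof eventually_elim
      case (elim \<omega>)
      then have "(\<lambda>n. ((\<Sum>k=1..n. h (X k \<omega>, Y k \<omega>)) - (\<integral>p. h p \<partial>\<mu>) * real n) / real n) \<longlonglongrightarrow> 0"
        using transfer(2)[OF h(1), of 1] by (simp add: sum_subtractf mult.commute)
      then have "(\<lambda>n. \<bar>((\<Sum>k=1..n. h (X k \<omega>, Y k \<omega>)) - (\<integral>p. h p \<partial>\<mu>) * real n) / real n\<bar>) \<longlonglongrightarrow> 0"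
        by (simp only: tendsto_rabs_zero_iff)
      then have "\<forall>\<^sub>F n in sequentially. \<bar>((\<Sum>k=1..n. h (X k \<omega>, Y k \<omega>)) - (\<integral>p. h p \<partial>\<mu>) * real n) / real n\<bar> < \<eta>"
        using \<eta> by (rule order_tendstoD(2))
      then show ?case using eventually_gt_at_top[of 0]
        by eventually_elim (simp add: abs_divide divide_less_eq)
    qed
  qed
  define C where "C = (\<integral>p. (e' p)\<^sup>2 \<partial>\<mu>)"
  have reg: "AE \<omega> in M. regular_path S (\<lambda>k. X k \<omega>) (\<lambda>k. (\<lambda>\<omega>. e' (X k \<omega>, Y k \<omega>)) \<omega>)"
  proof (rule AE_regular_path[OF S(1), where C = "C + 1"])
    fix B :: "'b set" assume B[measurable]: "B \<in> sets borel"
    define h where "h p = indicator B (fst p) * e' p" for p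
    have h[measurable]: "h \<in> borel_measurable borel"
      unfolding h_def[abs_def] by (intro borel_measurable_times ind_fst B e')
    have h2le: "(h p)\<^sup>2 \<le> (e' p)\<^sup>2" for p by (simp add: h_def indicator_def)
    have h2: "integrable \<mu> (\<lambda>p. (h p)\<^sup>2)"
      using h2le by (intro Bochner_Integration.integrable_bound[OF e'2]) (auto simp: meas\<mu>)
    have "AE \<omega> in M. (\<lambda>n. (\<Sum>k=1..n. h (X k \<omega>, Y k \<omega>)) / real n) \<longlonglongrightarrow> 0"
    proof (rule slln_centered[OF indh[OF h]])
      fix k :: nat assume k: "k \<ge> 1"
      show "integrable M (\<lambda>\<omega>. (h (X k \<omega>, Y k \<omega>))\<^sup>2)" using transfer(1)[of "\<lambda>p. (h p)\<^sup>2" k] h2 k by simp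
      show "expectation (\<lambda>\<omega>. (h (X k \<omega>, Y k \<omega>))\<^sup>2) \<le> C"
        unfolding C_def using transfer(2)[of "\<lambda>p. (h p)\<^sup>2" k] k integral_mono[OF h2 e'2 h2le] by simp
      show "expectation (\<lambda>\<omega>. h (X k \<omega>, Y k \<omega>)) = 0"
        using transfer(2)[OF h k] mean0[OF B] by (simp add: h_def)
    qed
    then show "AE \<omega> in M. (\<lambda>n. (\<Sum>k=1..n. indicator B (X k \<omega>) * e' (X k \<omega>, Y k \<omega>)) / real n) \<longlonglongrightarrow> 0"
      by (simp add: h_def)
  next
    from slln[of "\<lambda>p. (e' p)\<^sup>2" 1] e'2
    have "AE \<omega> in M. \<forall>\<^sub>F n in sequentially. \<bar>(\<Sum>k=1..n. (e' (X k \<omega>, Y k \<omega>))\<^sup>2) - C * real n\<bar> \<le> 1 * real n"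
      by (simp add: C_def)
    then show "AE \<omega> in M. \<forall>\<^sub>F n in sequentially. (\<Sum>k=1..n. (e' (X k \<omega>, Y k \<omega>))\<^sup>2) \<le> (C + 1) * real n"
    proof eventually_elim
      case (elim \<omega>)
      then show ?case by eventually_elim (simp add: distrib_right abs_le_iff)
    qed
  next
    fix \<delta> :: real assume \<delta>: "\<delta> > 0"
    have core[measurable]: "- core S l \<in> sets borel" for l using compact_core[OF S(1)] by (intro borel_comp borel_compact)
    define h where "h l p = indicator (- core S l) (fst p) * (e' p)\<^sup>2" for l p
    have h[measurable]: "h l \<in> borel_measurable borel" for l
      unfolding h_def[abs_def] by (intro borel_measurable_times borel_measurable_power ind_fst core e')
    have hint: "integrable \<mu> (h l)" for l
      by (intro Bochner_Integration.integrable_bound[OF e'2]) (auto simp: meas\<mu> h_def indicator_def)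
    \<comment> \<open>Almost every design point lies in some core and in all later ones, so
      dominated convergence makes the expected noise energy outside of the core small.\<close>
    have "(\<lambda>l. \<integral>p. h l p \<partial>\<mu>) \<longlonglongrightarrow> (\<integral>p. 0 \<partial>\<mu>)"
    proof (rule integral_dominated_convergence[where w = "\<lambda>p. (e' p)\<^sup>2"])
      show "AE p in \<mu>. (\<lambda>l. h l p) \<longlonglongrightarrow> 0"
        using ae_int
      proof eventually_elim
        case (elim p)
        then obtain l0 where "fst p \<in> interior (core S l0)" using interior_subset_interior_core by blast
        then have l0: "fst p \<in> core S l0" using interior_subset by blast
        have "\<forall>\<^sub>F l in sequentially. h l p = 0"
          using eventually_ge_at_top[of l0]
        proof eventually_elim
          case (elim l)
          then have "fst p \<in> core S l" using core_mono[of l0 l S] l0 by blast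
          then show ?case by (simp add: h_def)
        qed
        then show ?case by (rule tendsto_eventually)
      qed
      show "AE p in \<mu>. norm (h l p) \<le> (e' p)\<^sup>2" for l by (auto simp: h_def indicator_def)
    qed (use e'2 in \<open>auto simp: meas\<mu>\<close>)
    then have "\<forall>\<^sub>F l in sequentially. (\<integral>p. h l p \<partial>\<mu>) < \<delta> / 2" using \<delta> by (intro order_tendstoD(2)) auto
    then obtain l where l: "(\<integral>p. h l p \<partial>\<mu>) < \<delta> / 2" by (auto simp: eventually_sequentially)
    have "AE \<omega> in M. \<forall>\<^sub>F n in sequentially. \<bar>(\<Sum>k=1..n. h l (X k \<omega>, Y k \<omega>)) - (\<integral>p. h l p \<partial>\<mu>) * real n\<bar> \<le> \<delta> / 2 * real n"
      using \<delta> by (intro slln h hint) (auto simp: h_def)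
    then have "AE \<omega> in M. \<forall>\<^sub>F n in sequentially. (\<Sum>k=1..n. indicator (- core S l) (X k \<omega>) * (e' (X k \<omega>, Y k \<omega>))\<^sup>2) \<le> \<delta> * real n"
    proof eventually_elim
      case (elim \<omega>)
      then show ?case
      proof eventually_elim
        case (elim n)
        have "(\<integral>p. h l p \<partial>\<mu>) * real n \<le> \<delta> / 2 * real n" using l by (intro mult_right_mono) auto
        then have "(\<Sum>k=1..n. h l (X k \<omega>, Y k \<omega>)) \<le> \<delta> / 2 * real n + \<delta> / 2 * real n" using elim by linarith
        then show ?case by (simp add: h_def)
      qed
    qed
    then show "\<exists>l. AE \<omega> in M. \<forall>\<^sub>F n in sequentially. (\<Sum>k=1..n. indicator (- core S l) (X k \<omega>) * (e' (X k \<omega>, Y k \<omega>))\<^sup>2) \<le> \<delta> * real n" ..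
  next
    fix a b :: 'b assume box: "box a b \<noteq> {}" "box a b \<subseteq> interior S"
    define p where "p = measure (distr \<mu> borel fst) (box a b)"
    have p: "p > 0" unfolding p_def using \<nu> box interior_subset[of S] by (intro measure_box_pos[of S]) auto
    define h where "h q = (indicator (box a b) (fst q) :: real)" for q :: "'b \<times> real"
    have h[measurable]: "h \<in> borel_measurable borel" unfolding h_def[abs_def] by (rule ind_fst) simp
    have hint: "integrable \<mu> h"
      by (rule finite_measure.integrable_const_bound[OF prob_space.finite_measure[OF \<mu>(1)], where B = 1]) (auto simp: meas\<mu> h_def indicator_def)
    have "(\<integral>q. h q \<partial>\<mu>) = (\<integral>x. indicator (box a b) x \<partial>distr \<mu> borel fst)"
      unfolding h_def by (rule integral_distr[OF fst\<mu>, symmetric]) simp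
    also have "\<dots> = p" by (simp add: p_def)
    finally have hp: "(\<integral>q. h q \<partial>\<mu>) = p" .
    \<comment> \<open>A deviation of \<open>p / 2\<close> leaves half of the expected
      frequency.\<close>
    have "AE \<omega> in M. \<forall>\<^sub>F n in sequentially. \<bar>(\<Sum>k=1..n. h (X k \<omega>, Y k \<omega>)) - (\<integral>q. h q \<partial>\<mu>) * real n\<bar> \<le> p / 2 * real n"
      using p by (intro slln h hint) (auto simp: h_def)
    then have "AE \<omega> in M. \<forall>\<^sub>F n in sequentially. \<bar>(\<Sum>k=1..n. h (X k \<omega>, Y k \<omega>)) - p * real n\<bar> \<le> p / 2 * real n"
      unfolding hp .
    then have "AE \<omega> in M. \<forall>\<^sub>F n in sequentially. p / 2 * real n \<le> real (count_in (\<lambda>k. X k \<omega>) n (box a b))"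
    proof eventually_elim
      case (elim \<omega>)
      then show ?case
      proof eventually_elim
        case (elim n)
        have "real (count_in (\<lambda>k. X k \<omega>) n (box a b)) = (\<Sum>k=1..n. h (X k \<omega>, Y k \<omega>))"
          by (simp add: count_in_eq_sum h_def)
        moreover have "p / 2 * real n = p * real n - p / 2 * real n" by (simp add: field_simps)
        ultimately show ?case using elim by (simp only: abs_le_iff) linarith
      qed
    qed
    then show "\<exists>p>0. AE \<omega> in M. \<forall>\<^sub>F n in sequentially. p * real n \<le> real (count_in (\<lambda>k. X k \<omega>) n (box a b))"
      using p by (intro exI[of _ "p / 2"]) auto
  qed
  \<comment> \<open>In the interior the modified noise satisfies the model equation, and almost
    surely all design points lie there.\<close>
  have "AE \<omega> in M. \<forall>k\<in>{1..}. X k \<omega> \<in> interior S"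
  proof (rule AE_ball_countable')
    fix k :: nat assume "k \<in> {1..}"
    then have k: "k \<ge> 1" by simp
    have "AE p in distr M borel (\<lambda>\<omega>. (X k \<omega>, Y k \<omega>)). fst p \<in> interior S"
      unfolding distr[rule_format, OF k] by (rule ae_int)
    then have "AE \<omega> in M. fst (X k \<omega>, Y k \<omega>) \<in> interior S" by (rule AE_distrD[OF pair[OF k]])
    then show "AE \<omega> in M. X k \<omega> \<in> interior S" by simp
  qed simp
  with reg have ae: "AE \<omega> in M. (\<forall>k\<ge>1. X k \<omega> \<in> S \<and> Y k \<omega> = real_of_ereal (\<phi> (X k \<omega>)) + e' (X k \<omega>, Y k \<omega>)) \<and>
      regular_path S (\<lambda>k. X k \<omega>) (\<lambda>k. e' (X k \<omega>, Y k \<omega>))"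
  proof eventually_elim
    case (elim \<omega>)
    have "X k \<omega> \<in> S \<and> Y k \<omega> = real_of_ereal (\<phi> (X k \<omega>)) + e' (X k \<omega>, Y k \<omega>)" if "k \<ge> 1" for k
    proof -
      have "X k \<omega> \<in> interior S" using elim(2) that by simp
      then show ?thesis using interior_subset[of S] e'_eq[of "(X k \<omega>, Y k \<omega>)"] by auto
    qed
    then show ?case using elim(1) by simp
  qed
  have "X k \<in> borel_measurable M \<and> Y k \<in> borel_measurable M" if "k \<ge> 1" for k
    using measurable_compose[OF pair[OF that] fst] measurable_compose[OF pair[OF that] snd] by simp
  then have "\<forall>k\<ge>1. X k \<in> borel_measurable M \<and> Y k \<in> borel_measurable M" by blast
  moreover define en where "en k \<omega> = e' (X k \<omega>, Y k \<omega>)" for k \<omega>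
  have "AE \<omega> in M. (\<forall>k\<ge>1. X k \<omega> \<in> S \<and> Y k \<omega> = real_of_ereal (\<phi> (X k \<omega>)) + en k \<omega>) \<and>
      regular_path S (\<lambda>k. X k \<omega>) (\<lambda>k. en k \<omega>)"
    unfolding en_def by (rule ae)
  ultimately show ?thesis unfolding regular_sample_def by blast
qed

end

section \<open>Consistency\<close>

lemma tendsto_ereal_iff_abs_diff:
  fixes f :: "nat \<Rightarrow> ereal"
  shows "f \<longlonglongrightarrow> ereal r \<longleftrightarrow> (\<forall>e>0. \<forall>\<^sub>F n in sequentially. \<bar>f n - ereal r\<bar> \<le> ereal e)"
proof (intro iffI allI impI)
  fix e :: real assume f: "f \<longlonglongrightarrow> ereal r" and e: "e > 0"
  have "\<forall>\<^sub>F n in sequentially. ereal (r - e) < f n" "\<forall>\<^sub>F n in sequentially. f n < ereal (r + e)"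
    using order_tendstoD[OF f] e by auto
  then show "\<forall>\<^sub>F n in sequentially. \<bar>f n - ereal r\<bar> \<le> ereal e"
  proof eventually_elim
    case (elim n)
    then show ?case by (cases "f n") auto
  qed
next
  assume *: "\<forall>e>0. \<forall>\<^sub>F n in sequentially. \<bar>f n - ereal r\<bar> \<le> ereal e"
  have fin: "\<forall>\<^sub>F n in sequentially. ereal (real_of_ereal (f n)) = f n"
    using *[rule_format, OF zero_less_one]
  proof eventually_elim
    case (elim n)
    then show ?case by (cases "f n") auto
  qed
  have "(\<lambda>n. real_of_ereal (f n)) \<longlonglongrightarrow> r"
  proof (rule LIMSEQ_I)
    fix e :: real assume "e > 0"
    then have "\<forall>\<^sub>F n in sequentially. \<bar>f n - ereal r\<bar> \<le> ereal (e / 2)" using * by simp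
    then have "\<forall>\<^sub>F n in sequentially. norm (real_of_ereal (f n) - r) < e"
    proof eventually_elim
      case (elim n)
      then show ?case using \<open>e > 0\<close> by (cases "f n") auto
    qed
    then show "\<exists>no. \<forall>n\<ge>no. norm (real_of_ereal (f n) - r) < e" by (simp add: eventually_sequentially)
  qed
  then have "(\<lambda>n. ereal (real_of_ereal (f n))) \<longlonglongrightarrow> ereal r" by (intro tendsto_ereal)
  then show "f \<longlonglongrightarrow> ereal r" using fin by (rule Lim_transform_eventually)
qed

text \<open>In \<open>ereal\<close> the \<open>SUP\<close> over an empty set is -\<infinity>, which
  would spoil the limit 0, so the sets must be nonempty from some index on. For subdifferentials
  this has to be proved.\<close>

lemma tendsto_SUP_0_iff:
  fixes h :: "nat \<Rightarrow> 'a \<Rightarrow> ereal"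
  assumes K: "\<forall>\<^sub>F n in sequentially. K n \<noteq> {}" and h: "\<And>n x. 0 \<le> h n x"
  shows "(\<lambda>n. SUP x\<in>K n. h n x) \<longlonglongrightarrow> 0 \<longleftrightarrow> (\<forall>e>0. \<forall>\<^sub>F n in sequentially. \<forall>x\<in>K n. h n x \<le> ereal e)"
proof (intro iffI allI impI)
  fix e :: real assume lim: "(\<lambda>n. SUP x\<in>K n. h n x) \<longlonglongrightarrow> 0" and e: "e > 0"
  have "\<forall>\<^sub>F n in sequentially. (SUP x\<in>K n. h n x) < ereal e" using order_tendstoD(2)[OF lim, of "ereal e"] e by simp
  then show "\<forall>\<^sub>F n in sequentially. \<forall>x\<in>K n. h n x \<le> ereal e"
  proof eventually_elim
    case (elim n)
    show ?case
    proof
      fix x assume "x \<in> K n"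
      then have "h n x \<le> (SUP x\<in>K n. h n x)" by (rule SUP_upper)
      with elim show "h n x \<le> ereal e" by simp
    qed
  qed
next
  assume *: "\<forall>e>0. \<forall>\<^sub>F n in sequentially. \<forall>x\<in>K n. h n x \<le> ereal e"
  show "(\<lambda>n. SUP x\<in>K n. h n x) \<longlonglongrightarrow> 0"
  proof (rule order_tendstoI)
    fix a :: ereal assume a: "a < 0"
    show "\<forall>\<^sub>F n in sequentially. a < (SUP x\<in>K n. h n x)"
      using K
    proof eventually_elim
      case (elim n)
      then obtain x where x: "x \<in> K n" by blast
      have "a < h n x" using a h[of n x] by simp
      also have "\<dots> \<le> (SUP x\<in>K n. h n x)" by (rule SUP_upper[OF x])
      finally show ?case .
    qed
  next
    fix a :: ereal assume "0 < a"
    then obtain e where e: "0 < ereal e" "ereal e < a" using ereal_dense2 by blast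
    then have "\<forall>\<^sub>F n in sequentially. \<forall>x\<in>K n. h n x \<le> ereal e" using * by simp
    then show "\<forall>\<^sub>F n in sequentially. (SUP x\<in>K n. h n x) < a"
    proof eventually_elim
      case (elim n)
      then have "(SUP x\<in>K n. h n x) \<le> ereal e" by (intro SUP_least) simp
      then show ?case using e(2) by simp
    qed
  qed
qed

text \<open>The complement of a measurable null set covering the exceptional outcomes is an event of
  full probability inside of the set.\<close>

lemma (in prob_space) inner_prob_eq_1:
  assumes "AE \<omega> in M. P \<omega>"
  shows "inner_prob {\<omega> \<in> space M. P \<omega>} = 1"
proof -
  obtain N where N: "{\<omega> \<in> space M. \<not> P \<omega>} \<subseteq> N" "emeasure M N = 0" "N \<in> sets M"
    using AE_E[OF assms] by metis
  have "prob N = 0" using N(2) by (simp add: measure_def)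
  then have "prob (space M - N) = 1" using prob_compl[OF N(3)] by simp
  moreover have "prob (space M - N) \<le> inner_prob {\<omega> \<in> space M. P \<omega>}"
    unfolding inner_prob_def
  proof (rule cSUP_upper)
    show "space M - N \<in> {B \<in> events. B \<subseteq> {\<omega> \<in> space M. P \<omega>}}" using N by auto
    show "bdd_above (prob ` {B \<in> events. B \<subseteq> {\<omega> \<in> space M. P \<omega>}})" by (intro bdd_aboveI[of _ 1]) auto
  qed
  moreover have "inner_prob {\<omega> \<in> space M. P \<omega>} \<le> 1"
    unfolding inner_prob_def by (intro cSUP_least) auto
  ultimately show ?thesis by simp
qed

text \<open>
  The event in part (i) is measurable because, by convexity, it only depends on the convergence at
  the points of a countable dense set.
\<close>

lemma uniform_convergence_iff_dense:
  fixes F :: "nat \<Rightarrow> 'a::euclidean_space \<Rightarrow> ereal"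
  assumes F: "\<And>n. proper_convex (F n)" and G: "open G" and g: "continuous_on G g"
    and \<phi>: "\<And>s. s \<in> G \<Longrightarrow> \<phi> s = ereal (g s)"
    and D: "\<And>U. open U \<Longrightarrow> U \<noteq> {} \<Longrightarrow> \<exists>d\<in>D. d \<in> U"
  shows "(\<forall>K. compact K \<and> K \<noteq> {} \<and> K \<subseteq> G \<longrightarrow> (\<lambda>n. SUP x\<in>K. \<bar>F n x - \<phi> x\<bar>) \<longlonglongrightarrow> 0) \<longleftrightarrow>
    (\<forall>d\<in>D \<inter> G. (\<lambda>n. F n d) \<longlonglongrightarrow> \<phi> d)"
proof (intro iffI ballI allI impI)
  fix d assume *: "\<forall>K. compact K \<and> K \<noteq> {} \<and> K \<subseteq> G \<longrightarrow> (\<lambda>n. SUP x\<in>K. \<bar>F n x - \<phi> x\<bar>) \<longlonglongrightarrow> 0" and d: "d \<in> D \<inter> G"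
  have "(\<lambda>n. SUP x\<in>{d}. \<bar>F n x - \<phi> x\<bar>) \<longlonglongrightarrow> 0" using * d by (intro *[rule_format]) auto
  then have "\<forall>e>0. \<forall>\<^sub>F n in sequentially. \<forall>x\<in>{d}. \<bar>F n x - \<phi> x\<bar> \<le> ereal e"
    by (subst (asm) tendsto_SUP_0_iff) auto
  then show "(\<lambda>n. F n d) \<longlonglongrightarrow> \<phi> d" using d \<phi> by (simp add: tendsto_ereal_iff_abs_diff)
next
  fix K assume lim: "\<forall>d\<in>D \<inter> G. (\<lambda>n. F n d) \<longlonglongrightarrow> \<phi> d" and K: "compact K \<and> K \<noteq> {} \<and> K \<subseteq> G"
  \<comment> \<open>A dense point in each open set provides the good points that uniform convergence
    asks for.\<close>
  have near: "\<forall>\<^sub>F n in sequentially. \<exists>u\<in>U. \<bar>F n u - ereal (g u)\<bar> \<le> ereal \<eta>"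
    if U: "open U" "U \<noteq> {}" "U \<subseteq> G" and \<eta>: "\<eta> > 0" for U \<eta>
  proof -
    obtain d where d: "d \<in> D" "d \<in> U" using D U by blast
    then have "(\<lambda>n. F n d) \<longlonglongrightarrow> ereal (g d)" using lim U \<phi> by (metis IntI subsetD)
    then have "\<forall>\<^sub>F n in sequentially. \<bar>F n d - ereal (g d)\<bar> \<le> ereal \<eta>" using \<eta> by (simp add: tendsto_ereal_iff_abs_diff)
    then show ?thesis by eventually_elim (use d in blast)
  qed
  have "\<forall>\<^sub>F n in sequentially. \<forall>s\<in>K. \<bar>F n s - \<phi> s\<bar> \<le> ereal \<eta>" if "\<eta> > 0" for \<eta>
  proof -
    have "\<forall>\<^sub>F n in sequentially. \<forall>s\<in>K. \<bar>F n s - ereal (g s)\<bar> \<le> ereal \<eta>"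
      using K that by (intro proper_convex_uniform_convergence[OF F G g near]) auto
    then show ?thesis using K \<phi> by (auto elim!: eventually_mono)
  qed
  then show "(\<lambda>n. SUP x\<in>K. \<bar>F n x - \<phi> x\<bar>) \<longlonglongrightarrow> 0"
    using K by (subst tendsto_SUP_0_iff) auto
qed

theorem theorem3p1:
  fixes M :: "'w measure"
    and S :: "'a::euclidean_space set"
    and \<phi> :: "'a \<Rightarrow> ereal"
    and X :: "nat \<Rightarrow> 'w \<Rightarrow> 'a"
    and Y :: "nat \<Rightarrow> 'w \<Rightarrow> real"
    and \<sigma> :: real
    and \<phi>hat :: "nat \<Rightarrow> 'w \<Rightarrow> 'a \<Rightarrow> ereal"
  defines "\<phi>hat \<equiv> (\<lambda>n \<omega>. convex_lse S n (\<lambda>k. X k \<omega>) (\<lambda>k. Y k \<omega>))"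
  assumes "prob_space M"
    and "regression_domain S \<phi>"
    and "prob_space.setting_iid_errors M S \<phi> X Y \<sigma> \<or>
         prob_space.setting_heteroscedastic M S \<phi> X Y \<sigma> \<or>
         prob_space.setting_stochastic_design M S \<phi> X Y \<sigma>"
  shows
    "(measure M {\<omega> \<in> space M. \<forall>K. compact K \<and> K \<noteq> {} \<and> K \<subseteq> interior S \<longrightarrow>
        (\<lambda>n. SUP x\<in>K. \<bar>\<phi>hat n \<omega> x - \<phi> x\<bar>) \<longlonglongrightarrow> 0} = 1) \<and>
     (\<forall>x\<in>interior S. \<forall>\<xi>. AE \<omega> in M.
        limsup (\<lambda>n. dir_deriv (\<phi>hat n \<omega>) x \<xi>) \<le> dir_deriv \<phi> x \<xi>) \<and>
     (\<forall>\<epsilon>>0. \<forall>x\<in>interior S. prob_space.inner_prob M {\<omega> \<in> space M. \<forall>\<^sub>F n in sequentially.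
        subdifferential (\<phi>hat n \<omega>) x \<subseteq>
          {\<xi> + \<epsilon> *\<^sub>R b | \<xi> b. \<xi> \<in> subdifferential \<phi> x \<and> b \<in> cball 0 1}} = 1) \<and>
     (\<forall>x\<in>interior S. \<forall>g. GDERIV (\<lambda>y. real_of_ereal (\<phi> y)) x :> g \<longrightarrow>
        prob_space.inner_prob M {\<omega> \<in> space M.
          (\<lambda>n. SUP \<xi>\<in>subdifferential (\<phi>hat n \<omega>) x. ereal (norm (\<xi> - g))) \<longlonglongrightarrow> 0} = 1)"
proof -
  interpret prob_space M by fact
  have S: "closed S" "convex S" and \<phi>: "proper_convex \<phi>" "S \<subseteq> eff_dom \<phi>"
    using assms(3) by (auto simp: regression_domain_def)
  have "regular_sample S \<phi> X Y"
    using assms(4) setting_iid_errors_regular_sample[OF S] setting_heteroscedastic_regular_sample[OF S]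
      setting_stochastic_design_regular_sample[OF S \<phi>] by blast
  then obtain e where meas: "\<And>k. k \<ge> 1 \<Longrightarrow> X k \<in> borel_measurable M" "\<And>k. k \<ge> 1 \<Longrightarrow> Y k \<in> borel_measurable M"
    and path: "AE \<omega> in M. (\<forall>k\<ge>1. X k \<omega> \<in> S \<and> Y k \<omega> = real_of_ereal (\<phi> (X k \<omega>)) + e k \<omega>) \<and>
        regular_path S (\<lambda>k. X k \<omega>) (\<lambda>k. e k \<omega>)"
    unfolding regular_sample_def by blast
  define g where "g x = real_of_ereal (\<phi> x)" for x
  have g: "convex_on S g"
    unfolding g_def using \<phi> S(2) by (intro proper_convex_imp_convex_on) (auto simp: eff_dom_def)
  have gcont: "continuous_on (interior S) g"
    using convex_on_continuous[OF open_interior convex_on_subset[OF g interior_subset]]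
    by (simp add: convex_interior S)
  have \<phi>g: "\<phi> s = ereal (g s)" if "s \<in> S" for s
    using \<phi> that by (cases "\<phi> s") (auto simp: g_def eff_dom_def proper_convex_def)
  have F: "proper_convex (\<phi>hat n \<omega>)" for n \<omega> unfolding \<phi>hat_def by (rule proper_convex_convex_lse)
  \<comment> \<open>One almost sure event for all compact sets and all tolerances; the four parts
    are read off from it.\<close>
  have unif: "AE \<omega> in M. \<forall>K \<eta>. compact K \<longrightarrow> K \<subseteq> interior S \<longrightarrow> \<eta> > 0 \<longrightarrow>
      (\<forall>\<^sub>F n in sequentially. \<forall>s\<in>K. \<bar>\<phi>hat n \<omega> s - ereal (g s)\<bar> \<le> ereal \<eta>)"
    using path
  proof eventually_elim
    case (elim \<omega>)
    show ?case
    proof (intro allI impI)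
      fix K and \<eta> :: real assume K: "compact K" "K \<subseteq> interior S" "\<eta> > 0"
      show "\<forall>\<^sub>F n in sequentially. \<forall>s\<in>K. \<bar>\<phi>hat n \<omega> s - ereal (g s)\<bar> \<le> ereal \<eta>"
        unfolding \<phi>hat_def
        by (rule convex_lse_consistent_on_path[OF S g _ _ K, where e = "\<lambda>k. e k \<omega>"]) (use elim in \<open>auto simp: g_def\<close>)
    qed
  qed
  have ball: "\<exists>r>0. cball x r \<subseteq> interior S" if "x \<in> interior S" for x
    using open_contains_cball[of "interior S"] that by blast
  have 1: "measure M {\<omega> \<in> space M. \<forall>K. compact K \<and> K \<noteq> {} \<and> K \<subseteq> interior S \<longrightarrow>
        (\<lambda>n. SUP x\<in>K. \<bar>\<phi>hat n \<omega> x - \<phi> x\<bar>) \<longlonglongrightarrow> 0} = 1"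
  proof -
    obtain D :: "'a set" where D: "countable D" "\<And>U. open U \<Longrightarrow> U \<noteq> {} \<Longrightarrow> \<exists>d\<in>D. d \<in> U"
      using countable_dense_exists by metis
    \<comment> \<open>Reduces the event to countably many limits, each a comparison of a measurable
      \<open>liminf\<close> and \<open>limsup\<close>.\<close>
    have iff: "(\<forall>K. compact K \<and> K \<noteq> {} \<and> K \<subseteq> interior S \<longrightarrow> (\<lambda>n. SUP x\<in>K. \<bar>\<phi>hat n \<omega> x - \<phi> x\<bar>) \<longlonglongrightarrow> 0) \<longleftrightarrow>
        (\<forall>d\<in>D \<inter> interior S. (\<lambda>n. \<phi>hat n \<omega> d) \<longlonglongrightarrow> \<phi> d)" for \<omega>
      using \<phi>g interior_subset[of S] D(2) by (intro uniform_convergence_iff_dense[OF F open_interior gcont]) auto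
    have [measurable]: "(\<lambda>\<omega>. \<phi>hat n \<omega> d) \<in> borel_measurable M" for n d
      unfolding \<phi>hat_def by (rule borel_measurable_convex_lse[OF S meas])
    have "{\<omega> \<in> space M. \<forall>d\<in>D \<inter> interior S. (\<lambda>n. \<phi>hat n \<omega> d) \<longlonglongrightarrow> \<phi> d} \<in> sets M"
    proof (rule sets.sets_Collect_countable_All')
      fix d
      have lims: "(\<lambda>\<omega>. liminf (\<lambda>n. \<phi>hat n \<omega> d)) \<in> borel_measurable M" "(\<lambda>\<omega>. limsup (\<lambda>n. \<phi>hat n \<omega> d)) \<in> borel_measurable M"
        by measurable
      have "((\<lambda>\<omega>. liminf (\<lambda>n. \<phi>hat n \<omega> d)) -` {\<phi> d} \<inter> space M) \<inter> ((\<lambda>\<omega>. limsup (\<lambda>n. \<phi>hat n \<omega> d)) -` {\<phi> d} \<inter> space M) \<in> sets M"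
        by (rule sets.Int[OF measurable_sets[OF lims(1)] measurable_sets[OF lims(2)]]) simp_all
      also have "((\<lambda>\<omega>. liminf (\<lambda>n. \<phi>hat n \<omega> d)) -` {\<phi> d} \<inter> space M) \<inter> ((\<lambda>\<omega>. limsup (\<lambda>n. \<phi>hat n \<omega> d)) -` {\<phi> d} \<inter> space M)
          = {\<omega> \<in> space M. (\<lambda>n. \<phi>hat n \<omega> d) \<longlonglongrightarrow> \<phi> d}"
        unfolding tendsto_iff_Liminf_eq_Limsup[OF sequentially_bot] by auto
      finally show "{\<omega> \<in> space M. (\<lambda>n. \<phi>hat n \<omega> d) \<longlonglongrightarrow> \<phi> d} \<in> sets M" .
    next
      show "countable (D \<inter> interior S)" using D(1) by (rule countable_subset[rotated]) simp
    qed
    moreover have "AE \<omega> in M. \<forall>d\<in>D \<inter> interior S. (\<lambda>n. \<phi>hat n \<omega> d) \<longlonglongrightarrow> \<phi> d"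
      using unif
    proof eventually_elim
      case (elim \<omega>)
      show ?case
      proof
        fix d assume d: "d \<in> D \<inter> interior S"
        have "\<forall>\<^sub>F n in sequentially. \<bar>\<phi>hat n \<omega> d - ereal (g d)\<bar> \<le> ereal \<eta>" if "\<eta> > 0" for \<eta>
          using elim[rule_format, of "{d}" \<eta>] d that by simp
        then show "(\<lambda>n. \<phi>hat n \<omega> d) \<longlonglongrightarrow> \<phi> d"
          using d \<phi>g[of d] interior_subset[of S] by (auto simp: tendsto_ereal_iff_abs_diff)
      qed
    qed
    ultimately show ?thesis unfolding iff by (simp add: prob_Collect_eq_1)
  qed
  have 2: "AE \<omega> in M. limsup (\<lambda>n. dir_deriv (\<phi>hat n \<omega>) x \<xi>) \<le> dir_deriv \<phi> x \<xi>" if x: "x \<in> interior S" for x \<xi>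
    using unif
  proof eventually_elim
    case (elim \<omega>)
    obtain r where r: "r > 0" "cball x r \<subseteq> interior S" using ball[OF x] by blast
    show ?case
    proof (rule limsup_dir_deriv_le[OF F \<phi>(1) r(1)])
      fix s assume "s \<in> ball x r"
      then have s: "s \<in> interior S" using r(2) by auto
      have "\<forall>\<^sub>F n in sequentially. \<bar>\<phi>hat n \<omega> s - ereal (g s)\<bar> \<le> ereal \<eta>" if "\<eta> > 0" for \<eta>
        using elim[rule_format, of "{s}" \<eta>] s that by simp
      then show "\<phi> s = ereal (g s) \<and> (\<lambda>n. \<phi>hat n \<omega> s) \<longlonglongrightarrow> ereal (g s)"
        using s \<phi>g[of s] interior_subset[of S] by (auto simp: tendsto_ereal_iff_abs_diff)
    qed
  qed
  \<comment> \<open>The quantifier over \<open>\<epsilon>\<close> is inside, so that the same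
    outcomes serve the convergence to the gradient, where \<open>\<epsilon>\<close> tends to
    0.\<close>
  have sub: "AE \<omega> in M. \<forall>\<epsilon>>0. \<forall>\<^sub>F n in sequentially. subdifferential (\<phi>hat n \<omega>) x \<subseteq>
      {\<xi> + \<epsilon> *\<^sub>R b | \<xi> b. \<xi> \<in> subdifferential \<phi> x \<and> b \<in> cball 0 1}" if x: "x \<in> interior S" for x
    using unif
  proof eventually_elim
    case (elim \<omega>)
    obtain r where r: "r > 0" "cball x r \<subseteq> interior S" using ball[OF x] by blast
    show ?case
    proof (intro allI impI)
      fix \<epsilon> :: real assume \<epsilon>: "\<epsilon> > 0"
      show "\<forall>\<^sub>F n in sequentially. subdifferential (\<phi>hat n \<omega>) x \<subseteq>
          {\<xi> + \<epsilon> *\<^sub>R b | \<xi> b. \<xi> \<in> subdifferential \<phi> x \<and> b \<in> cball 0 1}"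
      proof (rule eventually_subdifferential_subset[OF \<phi>(1) r(1) _ _ _ \<epsilon>])
        show "\<phi> s = ereal (g s)" if "s \<in> cball x r" for s
          using that r(2) interior_subset[of S] by (intro \<phi>g) blast
        show "continuous_on (cball x r) g" using gcont r(2) by (rule continuous_on_subset)
        show "\<forall>\<^sub>F n in sequentially. \<forall>s\<in>cball x r. \<bar>\<phi>hat n \<omega> s - ereal (g s)\<bar> \<le> ereal \<eta>" if "\<eta> > 0" for \<eta>
          using elim[rule_format, OF compact_cball r(2) that] .
      qed
    qed
  qed
  have 3: "inner_prob {\<omega> \<in> space M. \<forall>\<^sub>F n in sequentially. subdifferential (\<phi>hat n \<omega>) x \<subseteq>
      {\<xi> + \<epsilon> *\<^sub>R b | \<xi> b. \<xi> \<in> subdifferential \<phi> x \<and> b \<in> cball 0 1}} = 1"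
    if "\<epsilon> > 0" and x: "x \<in> interior S" for \<epsilon> x
    using sub[OF x] that(1) by (intro inner_prob_eq_1) (auto elim!: eventually_mono)
  have 4: "inner_prob {\<omega> \<in> space M. (\<lambda>n. SUP \<xi>\<in>subdifferential (\<phi>hat n \<omega>) x. ereal (norm (\<xi> - d))) \<longlonglongrightarrow> 0} = 1"
    if x: "x \<in> interior S" and d: "GDERIV (\<lambda>y. real_of_ereal (\<phi> y)) x :> d" for x d
  proof (rule inner_prob_eq_1)
    obtain r where r: "r > 0" "cball x r \<subseteq> interior S" using ball[OF x] by blast
    \<comment> \<open>With a single possible subgradient, the enlarged set lies in a ball around the
      gradient.\<close>
    have grad: "\<xi> = d" if "\<xi> \<in> subdifferential \<phi> x" for \<xi>
    proof (rule subdifferential_eq_gradient[OF that r(1) _ d])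
      fix s assume "s \<in> ball x r"
      then have "s \<in> interior S" using r(2) by auto
      then have "s \<in> S" using interior_subset by blast
      then show "\<bar>\<phi> s\<bar> \<noteq> \<infinity>" using \<phi>g by simp
    qed
    show "AE \<omega> in M. (\<lambda>n. SUP \<xi>\<in>subdifferential (\<phi>hat n \<omega>) x. ereal (norm (\<xi> - d))) \<longlonglongrightarrow> 0"
      using sub[OF x] unif
    proof eventually_elim
      case (elim \<omega>)
      \<comment> \<open>The fit is finite near \<open>x\<close> from some index on, which excludes
        empty subdifferentials and hence suprema equal to -\<infinity>.\<close>
      have "\<forall>\<^sub>F n in sequentially. subdifferential (\<phi>hat n \<omega>) x \<noteq> {}"
        using elim(2)[rule_format, OF compact_cball r(2) zero_less_one]
      proof eventually_elim
        case (elim n)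
        show ?case
        proof (rule subdifferential_nonempty[OF F r(1)])
          fix s assume "s \<in> ball x r"
          then have "\<bar>\<phi>hat n \<omega> s - ereal (g s)\<bar> \<le> ereal 1" using elim by simp
          then show "\<phi>hat n \<omega> s < \<infinity>" by (cases "\<phi>hat n \<omega> s") auto
        qed
      qed
      moreover have "\<forall>\<^sub>F n in sequentially. \<forall>\<xi>\<in>subdifferential (\<phi>hat n \<omega>) x. ereal (norm (\<xi> - d)) \<le> ereal \<eta>" if "\<eta> > 0" for \<eta>
        using elim(1)[rule_format, OF that]
      proof eventually_elim
        case (elim n)
        show ?case
        proof
          fix \<xi> assume "\<xi> \<in> subdifferential (\<phi>hat n \<omega>) x"
          then obtain \<xi>' b where b: "\<xi> = \<xi>' + \<eta> *\<^sub>R b" "\<xi>' \<in> subdifferential \<phi> x" "b \<in> cball 0 1" using elim by blast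
          then have "\<xi> - d = \<eta> *\<^sub>R b" using grad by simp
          moreover have "\<eta> * norm b \<le> \<eta> * 1" using b(3) that by (intro mult_left_mono) auto
          ultimately show "ereal (norm (\<xi> - d)) \<le> ereal \<eta>" using that by simp
        qed
      qed
      ultimately show ?case by (subst tendsto_SUP_0_iff) auto
    qed
  qed
  show ?thesis using 1 2 3 4 by blast
qed

end
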